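(* Let $m,n\ge 1$, let $\mathbf w=(w_j)_{j=1}^m$ be a positive probability vector and let $\mathbf A=(A_j)_{j=1}^m$ be an $m$-tuple of positive definite matrices in $\mathbb{M}_n$. For every real $r$ with $-1\le r<0$, $$\left(\lambda_i^\downarrow\bigl(P_r(\mathbf w;\mathbf A)\bigr)\right)_{i=1}^n \prec_{w\log} \left(p_r\bigl(\mathbf w;\lambda_i^{\downarrow}(\mathbf A)\bigr)\right)_{i=1}^n,$$ where $P_r(\mathbf w;\mathbf A)$ is the Lim--Pálfia power mean of order $r$ and $p_r$ is the scalar power mean.
   Context: $\mathbb{M}_n$ is the algebra of complex $n\times n$ matrices; positive definite matrices are Hermitian with strictly positive eigenvalues. A positive probability vector is $\mathbf w=(w_j)_{j=1}^m$ with all $w_j>0$ and $\sum_j w_j=1$. Scalar power mean: for a positive vector $\mathbf a=(a_j)_{j=1}^m$ and real $r\ne 0$, $p_r(\mathbf w;\mathbf a):=\bigl(\sum_{j=1}^m w_ja_j^r\bigr)^{1/r}$. Weighted geometric mean: $A\#_tB:=A^{1/2}(A^{-1/2}BA^{-1/2})^tA^{1/2}$ for positive definite $A,B$. Lim--Pálfia power means: for $0<t\le 1$, the equation $X=\sum_{j=1}^m w_j\,(X\#_tA_j)$ has a unique positive definite solution $X$ (a known result), and $P_t(\mathbf w;\mathbf A)$ is defined to be this solution. For $-1\le r<0$, $P_r(\mathbf w;\mathbf A):=P_{-r}(\mathbf w;\mathbf A^{-1})^{-1}$, where $\mathbf A^{-1}:=(A_j^{-1})_{j=1}^m$. Eigenvalues: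 for Hermitian $A\in\mathbb{M}_n$, $\lambda_1^{\downarrow}(A)\ge\cdots\ge\lambda_n^{\downarrow}(A)$ are its eigenvalues in decreasing order, with multiplicity, and $\lambda_i^\downarrow(\mathbf A):=(\lambda_i^\downarrow(A_j))_{j=1}^m$. Weak log-majorization: for $x,y\in(0,\infty)^n$, $x\prec_{w\log}y$ means $\prod_{i=1}^k x_i^{\downarrow}\le\prod_{i=1}^k y_i^{\downarrow}$ for all $1\le k\le n$, where $x^\downarrow$ denotes the decreasing rearrangement of $x$. *)

theory Defs
  imports
    "Jordan_Normal_Form.Schur_Decomposition"
    "HOL-Computational_Algebra.Fundamental_Theorem_Algebra"
begin

(* An m-tuple is a function on nat whose values at j < m are used.
   Indices start at 0, so "eigval_desc A 0" is the largest eigenvalue. *)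

definition hermitian_mat :: "complex mat \<Rightarrow> bool" where
  "hermitian_mat A \<longleftrightarrow> mat_adjoint A = A"

definition positive_definite :: "complex mat \<Rightarrow> bool" where
  "positive_definite A \<longleftrightarrow>
     hermitian_mat A \<and> (\<forall>e. eigenvalue A e \<longrightarrow> e \<in> \<real> \<and> 0 < Re e)"

definition unitary_mat :: "nat \<Rightarrow> complex mat \<Rightarrow> bool" where
  "unitary_mat n U \<longleftrightarrow>
     U \<in> carrier_mat n n \<and> U * mat_adjoint U = 1\<^sub>m n \<and> mat_adjoint U * U = 1\<^sub>m n"

(* Functional calculus: if A = U diag(d) U* then A^t = U diag(d^t) U*;
   the result does not depend on the choice of the diagonalization. *)
definition pd_power :: "complex mat \<Rightarrow> real \<Rightarrow> complex mat" where
  "pd_power A t =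
     (let n = dim_row A in
      THE B. \<exists>U d. unitary_mat n U \<and> (\<forall>i<n. 0 < d i) \<and>
        A = U * mat_diag n (\<lambda>i. complex_of_real (d i)) * mat_adjoint U \<and>
        B = U * mat_diag n (\<lambda>i. complex_of_real (d i powr t)) * mat_adjoint U)"

definition geometric_mean :: "real \<Rightarrow> complex mat \<Rightarrow> complex mat \<Rightarrow> complex mat" where
  "geometric_mean t A B =
     pd_power A (1/2) * pd_power (pd_power A (-1/2) * B * pd_power A (-1/2)) t * pd_power A (1/2)"

(* The sum over j < m of w j times B j, written entrywise because the type of
   matrices (of all dimensions) has no additive monoid structure. *)
definition weighted_sum_mat ::
    "nat \<Rightarrow> nat \<Rightarrow> (nat \<Rightarrow> real) \<Rightarrow> (nat \<Rightarrow> complex mat) \<Rightarrow> complex mat" where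
  "weighted_sum_mat n m w B =
     Matrix.mat n n (\<lambda>ik. \<Sum>j<m. complex_of_real (w j) * (B j $$ ik))"

definition power_mean_pos ::
    "nat \<Rightarrow> nat \<Rightarrow> real \<Rightarrow> (nat \<Rightarrow> real) \<Rightarrow> (nat \<Rightarrow> complex mat) \<Rightarrow> complex mat" where
  "power_mean_pos n m t w A =
     (THE X. X \<in> carrier_mat n n \<and> positive_definite X \<and>
        X = weighted_sum_mat n m w (\<lambda>j. geometric_mean t X (A j)))"

definition inverse_mat :: "complex mat \<Rightarrow> complex mat" where
  "inverse_mat A = the (mat_inverse A)"

(* The Lim--Palfia power mean of order r; meaningful for nonzero r in [-1, 1]. *)
definition power_mean ::
    "nat \<Rightarrow> nat \<Rightarrow> real \<Rightarrow> (nat \<Rightarrow> real) \<Rightarrow> (nat \<Rightarrow> complex mat) \<Rightarrow> complex mat" where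
  "power_mean n m r w A =
     (if 0 < r then power_mean_pos n m r w A
      else inverse_mat (power_mean_pos n m (- r) w (\<lambda>j. inverse_mat (A j))))"

definition scalar_power_mean :: "nat \<Rightarrow> real \<Rightarrow> (nat \<Rightarrow> real) \<Rightarrow> (nat \<Rightarrow> real) \<Rightarrow> real" where
  "scalar_power_mean m r w a = (\<Sum>j<m. w j * a j powr r) powr (1 / r)"

(* For Hermitian A all roots of the characteristic polynomial are real, so Re
   is only a coercion. *)
definition eigval_desc :: "complex mat \<Rightarrow> nat \<Rightarrow> real" where
  "eigval_desc A i =
     rev (sorted_list_of_multiset (image_mset Re (proots (char_poly A)))) ! i"

definition weakly_log_majorized :: "real list \<Rightarrow> real list \<Rightarrow> bool" where
  "weakly_log_majorized xs ys \<longleftrightarrow>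
     length xs = length ys \<and> (\<forall>x\<in>set xs. 0 < x) \<and> (\<forall>y\<in>set ys. 0 < y) \<and>
     (\<forall>k\<in>{1..length xs}.
        prod_list (take k (rev (sort xs))) \<le> prod_list (take k (rev (sort ys))))"

end

theory Submission
  imports Defs "Jordan_Normal_Form.Spectral_Radius"
begin

text \<open>
  Let \<open>t = -r\<close>, let \<open>X\<close> be the power mean of order \<open>t\<close> of the inverses of the
  \<open>A j\<close>, and let \<open>p\<close> be the decreasing sequence of the eigenvalues of its inverse, the mean in
  question. The \<open>k\<close> largest of them belong to the \<open>k\<close> lowest eigenvectors \<open>u 0, u 1, ...\<close>
  of \<open>X\<close>. With \<open>H j = X^(-1/2) (A j)^(-1) X^(-1/2)\<close>, the equation for \<open>X\<close> says that the
  weighted sum of the \<open>(H j)^t\<close> is the identity. In particular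
  the sum over \<open>j\<close> of \<open>w j ((H j)^t (u i), u i)\<close> is 1 for every \<open>i\<close>.

  The key estimate, proved for each \<open>j\<close> separately in \<open>geometric_mean_diagonal_bound\<close>, is

    \<open>(\<Sum>i<k. (p i / \<alpha> j i) powr t) \<le> (\<Sum>i<k. ((H j)^t (u i), u i))\<close>,

  where \<open>\<alpha> j\<close> is the decreasing sequence of the eigenvalues of \<open>A j\<close>. Averaging over \<open>j\<close>
  gives \<open>(\<Sum>i<k. p i powr t * s i) \<le> k\<close> with \<open>s i = (\<Sum>j<m. w j * \<alpha> j i powr (-t))\<close>. By the
  inequality between the arithmetic and the geometric mean the product of the \<open>p i powr t * s i\<close>
  over \<open>i < k\<close> is at most 1. This is the claim, because the scalar power mean of order \<open>r\<close> of
  the \<open>\<alpha> j i\<close> is \<open>s i powr (1/r)\<close>, and it decreases in \<open>i\<close>.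

  For the key estimate, compress \<open>(H j)^(-1)\<close> to the span of \<open>u 0, ..., u (k-1)\<close>. By Jensen's
  inequality (\<open>peierls_inequality\<close>) the right-hand side is at least the trace of the power
  \<open>-t\<close> of the compression \<open>L\<close>. The span is invariant under \<open>X\<close>, so with
  \<open>P = diag(p 0, ..., p (k-1))\<close> the matrix \<open>P^(1/2) L P^(1/2)\<close> is a compression of \<open>A j\<close>, and
  its eigenvalues are at most those of \<open>A j\<close>. A Lidskii-type multiplicative majorization
  (\<open>log_threshold_majorization\<close>), which needs only monotonicity of eigenvalues and multiplicativity
  of determinants, then bounds the trace from below by the left-hand side.

  The power mean is given by a definite description, so its defining equation has to be shown to have
  exactly one solution. The right-hand side of the equation is a monotone map, homogeneous of degree
  \<open>1 - t\<close>. Such a map contracts the Thompson metric, which gives uniqueness, and its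
  iterates from a suitable start increase to a fixed point. Monotonicity is the Loewner--Heinz
  inequality, derived here from the monotonicity of the square root by midpoint convexity.
\<close>

section \<open>Adjoints, congruences of diagonal matrices and quadratic forms\<close>

notation mat_adjoint ("(_\<^sup>\<dagger>)" [1000] 999)

lemma adjoint_alt: "A\<^sup>\<dagger> = Matrix.mat (dim_col A) (dim_row A) (\<lambda>(i, j). cnj (A $$ (j, i)))"
  by (rule eq_matI) (auto simp: mat_adjoint_def mat_of_rows_def)

lemma adjoint_dim [simp]: "dim_row (A\<^sup>\<dagger>) = dim_col A" "dim_col (A\<^sup>\<dagger>) = dim_row (A :: complex mat)"
  by (simp_all add: adjoint_alt)

lemma adjoint_carrier [simp]:
  "A \<in> carrier_mat p q \<Longrightarrow> (A :: complex mat)\<^sup>\<dagger> \<in> carrier_mat q p"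
  by auto

lemma adjoint_index [simp]:
  "i < dim_col A \<Longrightarrow> j < dim_row A \<Longrightarrow> A\<^sup>\<dagger> $$ (i, j) = cnj (A $$ (j, i))"
  by (simp add: adjoint_alt)

lemma adjoint_adjoint [simp]: "((A :: complex mat)\<^sup>\<dagger>)\<^sup>\<dagger> = A"
  by (rule eq_matI) auto

lemma mult_index:
  "A \<in> carrier_mat p q \<Longrightarrow> B \<in> carrier_mat q r \<Longrightarrow> i < p \<Longrightarrow> j < r \<Longrightarrow>
    (A * B) $$ (i, j) = (\<Sum>l<q. A $$ (i, l) * B $$ (l, j))"
  by (auto simp: scalar_prod_def atLeast0LessThan)

lemma mult_vec_index:
  "A \<in> carrier_mat p q \<Longrightarrow> v \<in> carrier_vec q \<Longrightarrow> i < p \<Longrightarrow>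
    (A *\<^sub>v v) $ i = (\<Sum>l<q. A $$ (i, l) * v $ l)"
  by (auto simp: scalar_prod_def atLeast0LessThan)

lemma adjoint_mult:
  fixes A B :: "complex mat"
  assumes A: "A \<in> carrier_mat p q" and B: "B \<in> carrier_mat q r"
  shows "(A * B)\<^sup>\<dagger> = B\<^sup>\<dagger> * A\<^sup>\<dagger>"
proof (rule eq_matI)
  fix i j assume "i < dim_row (B\<^sup>\<dagger> * A\<^sup>\<dagger>)" "j < dim_col (B\<^sup>\<dagger> * A\<^sup>\<dagger>)"
  then have i: "i < r" and j: "j < p" using A B by auto
  have "(A * B)\<^sup>\<dagger> $$ (i, j) = cnj ((A * B) $$ (j, i))" using A B i j by simp
  also have "\<dots> = (\<Sum>l<q. B\<^sup>\<dagger> $$ (i, l) * A\<^sup>\<dagger> $$ (l, j))"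
    using A B i j by (subst mult_index[OF A B j i]) (auto simp: mult.commute intro!: sum.cong)
  also have "\<dots> = (B\<^sup>\<dagger> * A\<^sup>\<dagger>) $$ (i, j)"
    using A B i j by (subst mult_index[of _ r q _ p]) auto
  finally show "(A * B)\<^sup>\<dagger> $$ (i, j) = (B\<^sup>\<dagger> * A\<^sup>\<dagger>) $$ (i, j)" .
qed (use A B in auto)

abbreviation real_diag :: "nat \<Rightarrow> (nat \<Rightarrow> real) \<Rightarrow> complex mat" where
  "real_diag n d \<equiv> mat_diag n (\<lambda>i. complex_of_real (d i))"

lemma real_diag_adjoint [simp]: "(real_diag n d)\<^sup>\<dagger> = real_diag n d"
  by (rule eq_matI) (auto simp: mat_diag_def)

lemma real_diag_cong: "(\<And>i. i < n \<Longrightarrow> d i = e i) \<Longrightarrow> real_diag n d = real_diag n e"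
  by (rule eq_matI) (auto simp: mat_diag_def)

lemma one_mat_adjoint [simp]: "(1\<^sub>m n :: complex mat)\<^sup>\<dagger> = 1\<^sub>m n"
  by (rule eq_matI) auto

text \<open>
  For unitary \<open>U\<close> this is a spectral decomposition, for square invertible \<open>U\<close> a
  congruence of a diagonal matrix, and for a \<open>k \<times> n\<close> matrix with orthonormal rows a compression to a
  subspace. All three occur, hence no assumption on \<open>U\<close> and an explicit inner dimension \<open>n\<close>.
\<close>

definition congr_diag :: "nat \<Rightarrow> complex mat \<Rightarrow> (nat \<Rightarrow> real) \<Rightarrow> complex mat" where
  "congr_diag n U d = U * real_diag n d * U\<^sup>\<dagger>"

lemma congr_diag_carrier [simp]: "U \<in> carrier_mat p n \<Longrightarrow> congr_diag n U d \<in> carrier_mat p p"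
  unfolding congr_diag_def by (meson adjoint_carrier mat_diag_dim mult_carrier_mat)

lemma congr_diag_dim [simp]: "dim_row (congr_diag n U d) = dim_row U" "dim_col (congr_diag n U d) = dim_row U"
  by (simp_all add: congr_diag_def)

lemma congr_diag_index:
  assumes U: "U \<in> carrier_mat p n" and i: "i < p" and j: "j < p"
  shows "congr_diag n U d $$ (i, j) = (\<Sum>l<n. U $$ (i, l) * complex_of_real (d l) * cnj (U $$ (j, l)))"
proof -
  have "U * real_diag n d \<in> carrier_mat p n" using U by (metis mat_diag_dim mult_carrier_mat)
  from mult_index[OF this _ i j, of "U\<^sup>\<dagger>"]
  have "congr_diag n U d $$ (i, j) = (\<Sum>l<n. (U * real_diag n d) $$ (i, l) * U\<^sup>\<dagger> $$ (l, j))"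
    using U unfolding congr_diag_def by simp
  also have "\<dots> = (\<Sum>l<n. U $$ (i, l) * complex_of_real (d l) * cnj (U $$ (j, l)))"
    using U i j by (intro sum.cong) (auto simp: mat_diag_mult_right[OF U])
  finally show ?thesis .
qed

lemma congr_diag_adjoint [simp]:
  assumes U: "U \<in> carrier_mat p n"
  shows "(congr_diag n U d)\<^sup>\<dagger> = congr_diag n U d"
proof -
  have UD: "U * real_diag n d \<in> carrier_mat p n" by (rule mult_carrier_mat[OF U mat_diag_dim])
  have "(congr_diag n U d)\<^sup>\<dagger> = U * (real_diag n d * U\<^sup>\<dagger>)"
    unfolding congr_diag_def adjoint_mult[OF UD adjoint_carrier[OF U]] adjoint_mult[OF U mat_diag_dim]
    by simp
  then show ?thesis
    unfolding congr_diag_def assoc_mult_mat[OF U mat_diag_dim adjoint_carrier[OF U]] .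
qed

lemma square_mult_carrier [simp]: "A \<in> carrier_mat n n \<Longrightarrow> B \<in> carrier_mat n n \<Longrightarrow> A * B \<in> carrier_mat n n"
  by (rule mult_carrier_mat)

lemma square_mult_assoc:
  "A \<in> carrier_mat n n \<Longrightarrow> B \<in> carrier_mat n n \<Longrightarrow> C \<in> carrier_mat n n \<Longrightarrow> A * B * C = A * (B * C)"
  by (rule assoc_mult_mat)

lemma unitary_carrier: "unitary_mat n U \<Longrightarrow> U \<in> carrier_mat n n"
  by (simp add: unitary_mat_def)

lemma unitary_one [simp]: "unitary_mat n (1\<^sub>m n)"
  by (simp add: unitary_mat_def)

lemma unitary_adjoint: "unitary_mat n U \<Longrightarrow> unitary_mat n (U\<^sup>\<dagger>)"
  by (simp add: unitary_mat_def)

lemma unitaryI: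
  "U \<in> carrier_mat n n \<Longrightarrow> U\<^sup>\<dagger> * U = 1\<^sub>m n \<Longrightarrow> unitary_mat n U"
  "U \<in> carrier_mat n n \<Longrightarrow> U * U\<^sup>\<dagger> = 1\<^sub>m n \<Longrightarrow> unitary_mat n U"
  unfolding unitary_mat_def by (metis mat_mult_left_right_inverse adjoint_carrier)+

lemma mult_carrier3:
  "A \<in> carrier_mat p q \<Longrightarrow> B \<in> carrier_mat q r \<Longrightarrow> C \<in> carrier_mat r s \<Longrightarrow> A * B * C \<in> carrier_mat p s"
  by (meson mult_carrier_mat)

lemma unitary_mult:
  assumes "unitary_mat n U" "unitary_mat n W"
  shows "unitary_mat n (U * W)"
proof (rule unitaryI(2))
  have U: "U \<in> carrier_mat n n" and W: "W \<in> carrier_mat n n"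
    using assms by (auto simp: unitary_mat_def)
  show "U * W \<in> carrier_mat n n" using U W by simp
  have "U * W * (U * W)\<^sup>\<dagger> = U * (W * W\<^sup>\<dagger>) * U\<^sup>\<dagger>"
    using U W by (simp add: adjoint_mult[OF U W] square_mult_assoc[where n = n])
  then show "U * W * (U * W)\<^sup>\<dagger> = 1\<^sub>m n" using assms U by (simp add: unitary_mat_def)
qed

text \<open>
  Congruences act on the left factor only. Every change of basis and every compression below is
  an instance.
\<close>

lemma congr_diag_congruence:
  assumes S: "S \<in> carrier_mat p q" and U: "U \<in> carrier_mat q n"
  shows "S * congr_diag n U d * S\<^sup>\<dagger> = congr_diag n (S * U) d"
proof -
  have D: "real_diag n d \<in> carrier_mat n n" by simp
  note cs = S U D adjoint_carrier[OF S] adjoint_carrier[OF U]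
  have "congr_diag n (S * U) d = (S * U) * real_diag n d * (U\<^sup>\<dagger> * S\<^sup>\<dagger>)"
    unfolding congr_diag_def adjoint_mult[OF S U] ..
  also have "\<dots> = S * U * real_diag n d * U\<^sup>\<dagger> * S\<^sup>\<dagger>"
    by (rule assoc_mult_mat[symmetric, of _ p n _ q _ p])
       (use cs in \<open>auto intro: mult_carrier_mat\<close>)
  also have "S * U * real_diag n d = S * (U * real_diag n d)"
    by (rule assoc_mult_mat[OF S U D])
  also have "\<dots> * U\<^sup>\<dagger> = S * (U * real_diag n d * U\<^sup>\<dagger>)"
    by (rule assoc_mult_mat[of _ p q _ n _ q]) (use cs in \<open>auto intro: mult_carrier_mat\<close>)
  finally show ?thesis by (simp add: congr_diag_def)
qed

lemma congr_diag_mult: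
  assumes U: "unitary_mat n U"
  shows "congr_diag n U d * congr_diag n U e = congr_diag n U (\<lambda>i. d i * e i)"
proof -
  have c: "U \<in> carrier_mat n n" "real_diag n d \<in> carrier_mat n n" "real_diag n e \<in> carrier_mat n n"
    using U by (auto simp: unitary_mat_def)
  have "congr_diag n U d * congr_diag n U e = U * real_diag n d * (U\<^sup>\<dagger> * U) * real_diag n e * U\<^sup>\<dagger>"
    unfolding congr_diag_def using c by (simp add: square_mult_assoc[where n = n])
  also have "\<dots> = U * (real_diag n d * real_diag n e) * U\<^sup>\<dagger>"
    using U c by (simp add: unitary_mat_def square_mult_assoc[where n = n] left_mult_one_mat[of _ n n] del: mat_diag_diag)
  finally show ?thesis by (simp add: congr_diag_def)
qed

lemma congr_diag_one: "unitary_mat n U \<Longrightarrow> congr_diag n U (\<lambda>_. 1) = 1\<^sub>m n"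
  by (auto simp: congr_diag_def unitary_mat_def right_mult_one_mat[of _ n n])

lemma congr_diag_id: "congr_diag n (1\<^sub>m n) d = real_diag n d"
  by (simp add: congr_diag_def left_mult_one_mat[OF mat_diag_dim] right_mult_one_mat[OF mat_diag_dim])

lemma congr_diag_cong: "(\<And>i. i < n \<Longrightarrow> d i = e i) \<Longrightarrow> congr_diag n U d = congr_diag n U e"
  unfolding congr_diag_def using real_diag_cong[of n d e] by simp

lemma cscalar_adjoint:
  fixes M :: "complex mat"
  assumes M: "M \<in> carrier_mat p q" and v: "v \<in> carrier_vec q" and u: "u \<in> carrier_vec p"
  shows "(M *\<^sub>v v) \<bullet>c u = v \<bullet>c (M\<^sup>\<dagger> *\<^sub>v u)"
proof -
  have "(M *\<^sub>v v) \<bullet>c u = (\<Sum>i<p. (\<Sum>l<q. M $$ (i, l) * v $ l) * cnj (u $ i))"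
    using assms by (auto simp: scalar_prod_def atLeast0LessThan intro!: sum.cong)
  also have "\<dots> = (\<Sum>i<p. \<Sum>l<q. M $$ (i, l) * v $ l * cnj (u $ i))"
    by (simp add: sum_distrib_right)
  also have "\<dots> = (\<Sum>l<q. \<Sum>i<p. M $$ (i, l) * v $ l * cnj (u $ i))"
    by (rule sum.swap)
  also have "\<dots> = (\<Sum>l<q. v $ l * (\<Sum>i<p. M $$ (i, l) * cnj (u $ i)))"
    by (auto simp: sum_distrib_left mult_ac intro!: sum.cong)
  also have "\<dots> = v \<bullet>c (M\<^sup>\<dagger> *\<^sub>v u)"
    using assms by (auto simp: scalar_prod_def atLeast0LessThan intro!: sum.cong)
  finally show ?thesis .
qed

text \<open>
  The quadratic form of a Hermitian matrix is real, so taking the real part loses nothing there.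
\<close>

definition quad_form :: "complex mat \<Rightarrow> complex vec \<Rightarrow> real" where
  "quad_form A v = Re ((A *\<^sub>v v) \<bullet>c v)"

lemma quad_form_congruence:
  assumes S: "S \<in> carrier_mat p q" and A: "A \<in> carrier_mat q q" and v: "v \<in> carrier_vec p"
  shows "quad_form (S * A * S\<^sup>\<dagger>) v = quad_form A (S\<^sup>\<dagger> *\<^sub>v v)"
proof -
  have "(S * A * S\<^sup>\<dagger>) *\<^sub>v v = S *\<^sub>v (A *\<^sub>v (S\<^sup>\<dagger> *\<^sub>v v))"
    by (simp only: assoc_mult_mat_vec[OF mult_carrier_mat[OF S A] adjoint_carrier[OF S] v]
        assoc_mult_mat_vec[OF S A mult_mat_vec_carrier[OF adjoint_carrier[OF S] v]])
  moreover have "A *\<^sub>v (S\<^sup>\<dagger> *\<^sub>v v) \<in> carrier_vec q"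
    by (rule mult_mat_vec_carrier[OF A mult_mat_vec_carrier[OF adjoint_carrier[OF S] v]])
  ultimately show ?thesis unfolding quad_form_def using cscalar_adjoint[OF S _ v] by simp
qed

lemma quad_form_diag: "z \<in> carrier_vec n \<Longrightarrow> quad_form (real_diag n d) z = (\<Sum>i<n. d i * (cmod (z $ i))\<^sup>2)"
proof -
  assume z: "z \<in> carrier_vec n"
  have "(real_diag n d *\<^sub>v z) $ i = complex_of_real (d i) * z $ i" if "i < n" for i
  proof -
    have "(real_diag n d *\<^sub>v z) $ i = (\<Sum>l<n. real_diag n d $$ (i, l) * z $ l)"
      by (rule mult_vec_index[OF mat_diag_dim z that])
    also have "\<dots> = (\<Sum>l<n. if i = l then complex_of_real (d i) * z $ i else 0)"
      using that by (intro sum.cong) (auto simp: mat_diag_def)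
    finally have "(real_diag n d *\<^sub>v z) $ i = \<dots>" .
    then show ?thesis using that by simp
  qed
  moreover have "real_diag n d *\<^sub>v z \<in> carrier_vec n"
    by (rule mult_mat_vec_carrier[OF mat_diag_dim z])
  ultimately have "(real_diag n d *\<^sub>v z) \<bullet>c z
      = (\<Sum>i<n. complex_of_real (d i) * z $ i * cnj (z $ i))"
    using z by (auto simp: scalar_prod_def atLeast0LessThan intro!: sum.cong)
  moreover have "Re (complex_of_real (d i) * z $ i * cnj (z $ i)) = d i * (cmod (z $ i))\<^sup>2" for i
    unfolding cmod_power2 by (simp add: power2_eq_square algebra_simps)
  ultimately show ?thesis by (simp add: quad_form_def)
qed

lemma quad_form_congr_diag:
  assumes U: "U \<in> carrier_mat p n" and v: "v \<in> carrier_vec p"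
  shows "quad_form (congr_diag n U d) v = (\<Sum>i<n. d i * (cmod ((U\<^sup>\<dagger> *\<^sub>v v) $ i))\<^sup>2)"
  unfolding congr_diag_def
  by (simp only: quad_form_congruence[OF U mat_diag_dim v]
      quad_form_diag[OF mult_mat_vec_carrier[OF adjoint_carrier[OF U] v]])

definition norm_sq :: "complex vec \<Rightarrow> real" where
  "norm_sq v = (\<Sum>i<dim_vec v. (cmod (v $ i))\<^sup>2)"

lemma norm_sq_eq: "complex_of_real (norm_sq v) = v \<bullet>c v"
  by (auto simp: norm_sq_def scalar_prod_def atLeast0LessThan complex_norm_square
      simp del: of_real_power intro!: sum.cong)

lemma norm_sq_isometry:
  assumes V: "V \<in> carrier_mat p q" and "V\<^sup>\<dagger> * V = 1\<^sub>m q" and v: "v \<in> carrier_vec q"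
  shows "norm_sq (V *\<^sub>v v) = norm_sq v"
proof -
  have "complex_of_real (norm_sq (V *\<^sub>v v)) = v \<bullet>c (V\<^sup>\<dagger> *\<^sub>v (V *\<^sub>v v))"
    unfolding norm_sq_eq using cscalar_adjoint[OF V v, of "V *\<^sub>v v"] V v by simp
  also have "V\<^sup>\<dagger> *\<^sub>v (V *\<^sub>v v) = v"
    using assms by (metis adjoint_carrier assoc_mult_mat_vec one_mult_mat_vec)
  finally show ?thesis unfolding norm_sq_eq[symmetric] of_real_eq_iff .
qed

lemma norm_sq_unitary: "unitary_mat n U \<Longrightarrow> v \<in> carrier_vec n \<Longrightarrow> norm_sq (U *\<^sub>v v) = norm_sq v"
  by (rule norm_sq_isometry[of _ n n]) (auto simp: unitary_mat_def)

lemma norm_sq_nonneg: "0 \<le> norm_sq v"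
  by (simp add: norm_sq_def sum_nonneg)

lemma norm_sq_pos: "v \<in> carrier_vec n \<Longrightarrow> v \<noteq> 0\<^sub>v n \<Longrightarrow> 0 < norm_sq v"
proof -
  assume v: "v \<in> carrier_vec n" "v \<noteq> 0\<^sub>v n"
  then have "v \<bullet>c v \<noteq> 0" by simp
  then have "norm_sq v \<noteq> 0" by (metis norm_sq_eq of_real_0)
  then show ?thesis using norm_sq_nonneg[of v] by simp
qed

section \<open>The spectral theorem\<close>

text \<open>
  Gram--Schmidt applied to a basis that starts with \<open>v\<close>, followed by normalization of the
  columns.
\<close>

lemma unitary_completion:
  assumes v: "v \<in> carrier_vec n" and v0: "v \<noteq> 0\<^sub>v n" and n: "0 < n"
  shows "\<exists>U c. unitary_mat n U \<and> col U 0 = c \<cdot>\<^sub>v v"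
proof -
  define b where "b = basis_completion v"
  define ws where "ws = gram_schmidt n b"
  interpret cof_vec_space n "TYPE(complex)" .
  from basis_completion[OF v v0, folded b_def]
  have dist_b: "distinct b" and indep: "\<not> lin_dep (set b)" and b: "set b \<subseteq> carrier_vec n"
    and hdb: "hd b = v" and len_b: "length b = n" by auto
  from hdb len_b n obtain vs where bv: "b = v # vs" by (cases b) auto
  from gram_schmidt_result[OF b dist_b indep refl, folded ws_def]
  have ws: "set ws \<subseteq> carrier_vec n" "corthogonal ws" "length ws = n"
    by (auto simp: len_b)
  have "hd ws = v" using gram_schmidt_hd[OF v, of vs, folded bv] by (simp add: ws_def)
  then have ws0: "ws ! 0 = v" using ws(3) n by (metis hd_conv_nth length_0_conv less_numeral_extra(3))
  have wi: "ws ! i \<in> carrier_vec n" if "i < n" for i using ws that by auto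
  define c where "c i = 1 / sqrt (norm_sq (ws ! i))" for i
  define U where "U = Matrix.mat n n (\<lambda>(i, j). complex_of_real (c j) * (ws ! j) $ i)"
  have U: "U \<in> carrier_mat n n" by (simp add: U_def)
  have "U\<^sup>\<dagger> * U = 1\<^sub>m n"
  proof (rule eq_matI)
    fix i j assume "i < dim_row (1\<^sub>m n :: complex mat)" "j < dim_col (1\<^sub>m n :: complex mat)"
    then have i: "i < n" and j: "j < n" by auto
    have "(U\<^sup>\<dagger> * U) $$ (i, j) = (\<Sum>l<n. U\<^sup>\<dagger> $$ (i, l) * U $$ (l, j))"
      by (rule mult_index[OF adjoint_carrier[OF U] U i j])
    also have "\<dots> = (\<Sum>l<n. complex_of_real (c i * c j) * ((ws ! j) $ l * cnj ((ws ! i) $ l)))"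
      using i j by (intro sum.cong) (auto simp: U_def)
    also have "\<dots> = complex_of_real (c i * c j) * ((ws ! j) \<bullet>c (ws ! i))"
      using wi[OF i] wi[OF j]
      by (auto simp: scalar_prod_def atLeast0LessThan sum_distrib_left intro!: sum.cong)
    also have "\<dots> = (if i = j then 1 else 0)"
    proof (cases "i = j")
      case True
      have "ws ! i \<bullet>c ws ! i \<noteq> 0" using corthogonalD[OF ws(2), of i i] i ws(3) by simp
      then have "0 < norm_sq (ws ! i)" using norm_sq_nonneg[of "ws ! i"] norm_sq_eq[of "ws ! i"]
        by (metis less_eq_real_def of_real_0)
      then have "c i * c i * norm_sq (ws ! i) = 1"
        by (simp add: c_def field_simps flip: power2_eq_square)
      then show ?thesis using True by (metis norm_sq_eq of_real_1 of_real_mult)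
    next
      case False
      then show ?thesis using corthogonalD[OF ws(2), of j i] i j ws(3) by simp
    qed
    finally show "(U\<^sup>\<dagger> * U) $$ (i, j) = 1\<^sub>m n $$ (i, j)" using i j by simp
  qed (use U in auto)
  then have "unitary_mat n U" using U by (rule unitaryI(1)[rotated])
  moreover have "col U 0 = complex_of_real (c 0) \<cdot>\<^sub>v v"
    using n v by (intro eq_vecI) (auto simp: U_def ws0)
  ultimately show ?thesis by blast
qed

text \<open>
  Deflation: in an orthonormal basis that starts with an eigenvector the first column of a
  Hermitian matrix is zero below the diagonal, hence so is the first row beyond it, and the
  remaining block is Hermitian of smaller dimension.
\<close>

lemma hermitian_diagonalizable:
  "A \<in> carrier_mat n n \<Longrightarrow> A\<^sup>\<dagger> = A \<Longrightarrow> \<exists>U d. unitary_mat n U \<and> A = congr_diag n U d"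
proof (induction n arbitrary: A)
  case 0
  then have "A = congr_diag 0 (1\<^sub>m 0) (\<lambda>_. 0)" by (intro eq_matI) auto
  then show ?case by (intro exI[of _ "1\<^sub>m 0"] exI) simp
next
  case (Suc n)
  let ?n = "Suc n"
  note A = Suc.prems(1)
  obtain e where "eigenvalue A e" using spectrum_non_empty[OF A] by (auto simp: spectrum_def)
  then obtain v where v: "v \<in> carrier_vec ?n" "v \<noteq> 0\<^sub>v ?n" and ev: "A *\<^sub>v v = e \<cdot>\<^sub>v v"
    using A by (auto simp: eigenvalue_def eigenvector_def)
  obtain U c where UU: "unitary_mat ?n U" and col: "col U 0 = c \<cdot>\<^sub>v v"
    using unitary_completion[OF v] by auto
  have U: "U \<in> carrier_mat ?n ?n" and UU1: "U * U\<^sup>\<dagger> = 1\<^sub>m ?n" "U\<^sup>\<dagger> * U = 1\<^sub>m ?n"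
    using UU by (auto simp: unitary_mat_def)
  define M where "M = U\<^sup>\<dagger> * (A * U)"
  have M: "M \<in> carrier_mat ?n ?n" using A U by (simp add: M_def)
  (* M is the matrix A in the basis formed by the columns of U. *)
  have Mh: "M\<^sup>\<dagger> = M" using A U Suc.prems(2)
    by (simp add: M_def adjoint_mult[of _ ?n ?n _ ?n] square_mult_assoc[where n = ?n])
  have col0: "M $$ (i, 0) = (if i = 0 then e else 0)" if i: "i < ?n" for i
  proof -
    have "col (A * U) 0 = A *\<^sub>v col U 0" by (rule col_mult2[OF A U]) simp
    also have "\<dots> = e \<cdot>\<^sub>v col U 0" unfolding col using ev A v
      by (simp add: mult_mat_vec[OF A] smult_smult_assoc mult.commute)
    finally have AU: "(A * U) $$ (l, 0) = e * U $$ (l, 0)" if "l < ?n" for l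
      using that A U by (metis (no_types, lifting) carrier_matD(1) carrier_matD(2) col_def
          index_mult_mat(2) index_mult_mat(3) index_smult_vec(1) dim_vec index_vec zero_less_Suc)
    have "M $$ (i, 0) = (\<Sum>l<?n. U\<^sup>\<dagger> $$ (i, l) * (A * U) $$ (l, 0))"
      unfolding M_def by (rule mult_index[OF _ _ i]) (use A U in auto)
    also have "\<dots> = e * (\<Sum>l<?n. U\<^sup>\<dagger> $$ (i, l) * U $$ (l, 0))"
      unfolding sum_distrib_left by (rule sum.cong) (auto simp: AU)
    also have "(\<Sum>l<?n. U\<^sup>\<dagger> $$ (i, l) * U $$ (l, 0)) = (U\<^sup>\<dagger> * U) $$ (i, 0)"
      by (rule mult_index[OF _ _ i, symmetric]) (use U in auto)
    finally show ?thesis using UU1 i by simp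
  qed
  have herm: "M $$ (i, j) = cnj (M $$ (j, i))" if "i < ?n" "j < ?n" for i j
    using adjoint_index[of i M j] that M Mh by simp
  have row0: "M $$ (0, i) = (if i = 0 then e else 0)" if "i < ?n" for i
    using herm[of 0 i] herm[of 0 0] col0[OF that] that by (cases i) (auto simp: col0)
  have e: "complex_of_real (Re e) = e"
    using herm[of 0 0] col0[of 0] by (simp add: complex_eq_iff)
  define A' where "A' = Matrix.mat n n (\<lambda>(i, j). M $$ (Suc i, Suc j))"
  have "A'\<^sup>\<dagger> = A'" by (rule eq_matI) (auto simp: A'_def herm[symmetric])
  then obtain U' d where U': "unitary_mat n U'" and A': "A' = congr_diag n U' d"
    using Suc.IH[of A'] by (auto simp: A'_def)
  have U'c: "U' \<in> carrier_mat n n" using U' by (simp add: unitary_mat_def)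
  (* The direct sum of the one-dimensional identity and U'. *)
  define W where "W = Matrix.mat ?n ?n (\<lambda>(i, j).
      case i of 0 \<Rightarrow> (case j of 0 \<Rightarrow> 1 | Suc _ \<Rightarrow> 0)
      | Suc i' \<Rightarrow> (case j of 0 \<Rightarrow> 0 | Suc j' \<Rightarrow> U' $$ (i', j')))"
  have W: "W \<in> carrier_mat ?n ?n" by (simp add: W_def)
  have W_simps: "W $$ (0, 0) = 1" "\<And>j. j < n \<Longrightarrow> W $$ (0, Suc j) = 0"
    "\<And>i. i < n \<Longrightarrow> W $$ (Suc i, 0) = 0"
    "\<And>i j. i < n \<Longrightarrow> j < n \<Longrightarrow> W $$ (Suc i, Suc j) = U' $$ (i, j)"
    by (auto simp: W_def)
  have W_congr_diag: "congr_diag ?n W f $$ (i, j) = (case i of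
      0 \<Rightarrow> (case j of 0 \<Rightarrow> complex_of_real (f 0) | Suc j' \<Rightarrow> 0)
      | Suc i' \<Rightarrow> (case j of 0 \<Rightarrow> 0 | Suc j' \<Rightarrow> congr_diag n U' (\<lambda>i. f (Suc i)) $$ (i', j')))"
    if "i < ?n" "j < ?n" for i j f
    unfolding congr_diag_index[OF W that] sum.lessThan_Suc_shift
    using that by (auto simp: W_simps congr_diag_index[OF U'c] split: nat.split)
  have UW: "unitary_mat ?n W"
  proof (rule unitaryI(2)[OF W])
    have "W * W\<^sup>\<dagger> = congr_diag ?n W (\<lambda>_. 1)"
      using W by (simp add: congr_diag_def right_mult_one_mat[of _ ?n ?n])
    also have "\<dots> = 1\<^sub>m ?n"
      using congr_diag_one[OF U'] by (intro eq_matI) (use W in \<open>auto simp: W_congr_diag split: nat.split\<close>)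
    finally show "W * W\<^sup>\<dagger> = 1\<^sub>m ?n" .
  qed
  have MW: "M = congr_diag ?n W (\<lambda>i. case i of 0 \<Rightarrow> Re e | Suc i' \<Rightarrow> d i')"
    using M W by (intro eq_matI)
      (auto simp: W_congr_diag col0 row0 e A'[symmetric] A'_def split: nat.split)
  have "A = U * M * U\<^sup>\<dagger>"
  proof -
    have "U * M * U\<^sup>\<dagger> = (U * U\<^sup>\<dagger>) * A * (U * U\<^sup>\<dagger>)"
      unfolding M_def using U A by (simp add: square_mult_assoc[where n = ?n])
    then show ?thesis using A
      by (simp add: UU1 left_mult_one_mat[of _ ?n ?n] right_mult_one_mat[of _ ?n ?n])
  qed
  then have "A = congr_diag ?n (U * W) (\<lambda>i. case i of 0 \<Rightarrow> Re e | Suc i' \<Rightarrow> d i')"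
    unfolding MW using congr_diag_congruence[OF U W] by simp
  then show ?case using unitary_mult[OF UU UW] by blast
qed

lemma antimono_permutation:
  fixes d :: "nat \<Rightarrow> real"
  shows "\<exists>s. bij_betw s {..<n} {..<n} \<and> (\<forall>i j. i \<le> j \<longrightarrow> j < n \<longrightarrow> d (s j) \<le> d (s i))"
proof -
  define L where "L = rev (sort_key d [0..<n])"
  have len: "length L = n" and dist: "distinct L" and set: "set L = {..<n}"
    by (auto simp: L_def)
  have "bij_betw (\<lambda>i. L ! i) {..<n} {..<n}"
    using bij_betw_nth[OF dist refl set[symmetric]] by (simp add: len)
  moreover have "d (L ! j) \<le> d (L ! i)" if "i \<le> j" "j < n" for i j
  proof -
    have "sorted (map d (sort_key d [0..<n]))" by simp
    then have "sorted_wrt (\<ge>) (map d L)"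
      by (simp add: L_def sorted_wrt_rev rev_map[symmetric])
    then have "i < j \<Longrightarrow> d (L ! j) \<le> d (L ! i)"
      using that by (auto simp: sorted_wrt_iff_nth_less len)
    then show ?thesis using that by (cases "i = j") auto
  qed
  ultimately show ?thesis by blast
qed

definition antimono_below :: "nat \<Rightarrow> (nat \<Rightarrow> real) \<Rightarrow> bool" where
  "antimono_below n d \<longleftrightarrow> (\<forall>i j. i \<le> j \<longrightarrow> j < n \<longrightarrow> d j \<le> d i)"

text \<open>
  Permuting the columns of the unitary matrix together with the eigenvalues sorts the latter.
  All later arguments compare eigenvalues by rank, so the sorted form is the useful one.
\<close>

theorem spectral_theorem:
  assumes A: "A \<in> carrier_mat n n" and h: "A\<^sup>\<dagger> = A"
  shows "\<exists>U d. unitary_mat n U \<and> A = congr_diag n U d \<and> antimono_below n d"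
proof -
  obtain U d where UU: "unitary_mat n U" and AU: "A = congr_diag n U d"
    using hermitian_diagonalizable[OF A h] by blast
  obtain s where s: "bij_betw s {..<n} {..<n}" and anti: "antimono_below n (d \<circ> s)"
    using antimono_permutation[of n d] by (auto simp: antimono_below_def)
  have sn: "s i < n" if "i < n" for i using s that by (auto simp: bij_betw_def)
  have U: "U \<in> carrier_mat n n" using UU by (simp add: unitary_mat_def)
  define W where "W = Matrix.mat n n (\<lambda>(i, j). U $$ (i, s j))"
  have W: "W \<in> carrier_mat n n" by (simp add: W_def)
  have eq: "congr_diag n W (f \<circ> s) = congr_diag n U f" for f
  proof (rule eq_matI)
    fix i j assume "i < dim_row (congr_diag n U f)" "j < dim_col (congr_diag n U f)"
    then have ij: "i < n" "j < n" using U by auto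
    have "congr_diag n W (f \<circ> s) $$ (i, j)
        = (\<Sum>l<n. U $$ (i, s l) * complex_of_real (f (s l)) * cnj (U $$ (j, s l)))"
      unfolding congr_diag_index[OF W ij] using ij by (intro sum.cong) (auto simp: W_def)
    also have "\<dots> = congr_diag n U f $$ (i, j)"
      unfolding congr_diag_index[OF U ij]
      by (rule sum.reindex_bij_betw[OF s, of "\<lambda>l. U $$ (i, l) * complex_of_real (f l) * cnj (U $$ (j, l))"])
    finally show "congr_diag n W (f \<circ> s) $$ (i, j) = congr_diag n U f $$ (i, j)" .
  qed (use U W in auto)
  have "W * W\<^sup>\<dagger> = congr_diag n W ((\<lambda>_. 1) \<circ> s)"
    using W by (simp add: congr_diag_def o_def right_mult_one_mat[of _ n n])
  then have "W * W\<^sup>\<dagger> = 1\<^sub>m n" unfolding eq using congr_diag_one[OF UU] by simp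
  then have "unitary_mat n W" using W by (rule unitaryI(2)[rotated])
  then show ?thesis using eq[of d] AU anti by metis
qed

section \<open>Positive definite matrices and their powers\<close>

lemma unitary_col:
  assumes U: "unitary_mat n U" and i: "i < n"
  shows "U\<^sup>\<dagger> *\<^sub>v col U i = unit_vec n i"
proof (rule eq_vecI)
  have c: "U \<in> carrier_mat n n" "U\<^sup>\<dagger> * U = 1\<^sub>m n" using U by (auto simp: unitary_mat_def)
  fix l assume "l < dim_vec (unit_vec n i :: complex vec)"
  then have l: "l < n" by simp
  have "(U\<^sup>\<dagger> *\<^sub>v col U i) $ l = (U\<^sup>\<dagger> * U) $$ (l, i)" using c(1) l i by simp
  then show "(U\<^sup>\<dagger> *\<^sub>v col U i) $ l = unit_vec n i $ l" using c(2) l i by (simp add: unit_vec_def)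
qed (use U in \<open>auto simp: unitary_mat_def\<close>)

lemma norm_sq_unit_vec: "i < n \<Longrightarrow> norm_sq (unit_vec n i) = 1"
proof -
  assume i: "i < n"
  have "norm_sq (unit_vec n i) = (\<Sum>l<n. if l = i then 1 else 0)"
    unfolding norm_sq_def by (rule sum.cong) (use i in \<open>auto simp: unit_vec_def\<close>)
  then show ?thesis using i by simp
qed

lemma norm_sq_unitary_col: "unitary_mat n U \<Longrightarrow> i < n \<Longrightarrow> norm_sq (col U i) = 1"
  using norm_sq_unitary[OF unitary_adjoint, of n U "col U i"] unitary_col[of n U i] norm_sq_unit_vec[of i n]
  by (metis carrier_matD(1) col_carrier_vec unitary_carrier carrier_matD(2) col_dim)

lemma unitary_col_nonzero: "unitary_mat n U \<Longrightarrow> i < n \<Longrightarrow> col U i \<noteq> 0\<^sub>v n"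
  using norm_sq_unitary_col[of n U i] by (auto simp: norm_sq_def simp del: dim_col)

lemma congr_diag_mult_col:
  assumes U: "unitary_mat n U" and i: "i < n"
  shows "congr_diag n U d *\<^sub>v col U i = complex_of_real (d i) \<cdot>\<^sub>v col U i"
proof -
  have c: "U \<in> carrier_mat n n" by (rule unitary_carrier[OF U])
  have ci: "col U i \<in> carrier_vec n" using c by auto
  have "congr_diag n U d *\<^sub>v col U i = (U * real_diag n d) *\<^sub>v (U\<^sup>\<dagger> *\<^sub>v col U i)"
    unfolding congr_diag_def by (rule assoc_mult_mat_vec[OF square_mult_carrier[OF c mat_diag_dim] adjoint_carrier[OF c] ci])
  also have "\<dots> = col (U * real_diag n d) i"
    unfolding unitary_col[OF U i]
    using c i carrier_vecI[of "row (U * real_diag n d) _" n] by (intro eq_vecI) (auto simp: mat_diag_def)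
  also have "\<dots> = complex_of_real (d i) \<cdot>\<^sub>v col U i"
    using c i by (intro eq_vecI) (auto simp: mat_diag_mult_right[OF c])
  finally show ?thesis .
qed

lemma quad_form_congr_diag_col:
  assumes U: "unitary_mat n U" and i: "i < n"
  shows "quad_form (congr_diag n U d) (col U i) = d i"
proof -
  have ci: "col U i \<in> carrier_vec n" using U i by (auto simp: unitary_mat_def)
  have "(congr_diag n U d *\<^sub>v col U i) \<bullet>c col U i = complex_of_real (d i * norm_sq (col U i))"
    unfolding congr_diag_mult_col[OF U i] using ci by (simp add: norm_sq_eq)
  then show ?thesis using norm_sq_unitary_col[OF U i] by (simp add: quad_form_def)
qed

lemma quad_form_congr_diag_pos:
  assumes U: "unitary_mat n U" and d: "\<And>i. i < n \<Longrightarrow> 0 < d i"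
    and v: "v \<in> carrier_vec n" "v \<noteq> 0\<^sub>v n"
  shows "0 < quad_form (congr_diag n U d) v"
proof -
  let ?z = "U\<^sup>\<dagger> *\<^sub>v v"
  have z: "?z \<in> carrier_vec n"
    by (rule mult_mat_vec_carrier[OF adjoint_carrier[OF unitary_carrier[OF U]] v(1)])
  have "norm_sq ?z = norm_sq v" by (rule norm_sq_unitary[OF unitary_adjoint[OF U] v(1)])
  then have "norm_sq ?z \<noteq> 0" using norm_sq_pos[OF v] by simp
  then have "\<exists>i<n. (cmod (?z $ i))\<^sup>2 \<noteq> 0"
    unfolding norm_sq_def using z by (metis (no_types, lifting) carrier_vecD lessThan_iff sum.neutral)
  then obtain i where i: "i < n" "(cmod (?z $ i))\<^sup>2 \<noteq> 0" by blast
  then have "0 < d i * (cmod (?z $ i))\<^sup>2" using d by simp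
  then show ?thesis
    unfolding quad_form_congr_diag[OF unitary_carrier[OF U] v(1)]
    using i d by (intro sum_pos2[of _ i]) (simp_all add: less_imp_le)
qed

lemma quad_form_congr_diag_nonneg:
  assumes U: "U \<in> carrier_mat p n" and d: "\<And>i. i < n \<Longrightarrow> 0 \<le> d i" and v: "v \<in> carrier_vec p"
  shows "0 \<le> quad_form (congr_diag n U d) v"
  unfolding quad_form_congr_diag[OF U v] using d by (intro sum_nonneg) auto

text \<open>
  The columns of \<open>U\<close> are eigenvectors, which gives one direction. For the other, an
  eigenvalue \<open>e\<close> with eigenvector \<open>v\<close> satisfies \<open>e \<parallel>v\<parallel>\<^sup>2 = (A v, v)\<close>, and this number
  is a positive combination of the \<open>d i\<close>.
\<close>

lemma congr_diag_pos_iff: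
  assumes U: "unitary_mat n U"
  shows "positive_definite (congr_diag n U d) \<longleftrightarrow> (\<forall>i<n. 0 < d i)"
proof
  have c: "U \<in> carrier_mat n n" by (rule unitary_carrier[OF U])
  note A = congr_diag_carrier[OF c, of d]
  show "positive_definite (congr_diag n U d) \<Longrightarrow> \<forall>i<n. 0 < d i"
  proof (intro allI impI)
    fix i assume pd: "positive_definite (congr_diag n U d)" and i: "i < n"
    from unitary_col_nonzero[OF U i] have "eigenvalue (congr_diag n U d) (complex_of_real (d i))"
      unfolding eigenvalue_def eigenvector_def using congr_diag_mult_col[OF U i] A c i
      by (intro exI[of _ "col U i"]) auto
    then show "0 < d i" using pd by (auto simp: positive_definite_def)
  qed
  show "positive_definite (congr_diag n U d)" if pos: "\<forall>i<n. 0 < d i"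
    unfolding positive_definite_def hermitian_mat_def
  proof (intro conjI allI impI)
    show "(congr_diag n U d)\<^sup>\<dagger> = congr_diag n U d" by (rule congr_diag_adjoint[OF c])
    fix e assume "eigenvalue (congr_diag n U d) e"
    then obtain v where v: "v \<in> carrier_vec n" "v \<noteq> 0\<^sub>v n" and ev: "congr_diag n U d *\<^sub>v v = e \<cdot>\<^sub>v v"
      using A by (auto simp: eigenvalue_def eigenvector_def)
    have 1: "(congr_diag n U d *\<^sub>v v) \<bullet>c v = e * complex_of_real (norm_sq v)"
      unfolding ev norm_sq_eq using v(1) by simp
    have "v \<bullet>c (congr_diag n U d *\<^sub>v v) = cnj e * complex_of_real (norm_sq v)"
      unfolding ev norm_sq_eq using v(1) by (simp add: conjugate_smult_vec)
    then have "e * complex_of_real (norm_sq v) = cnj e * complex_of_real (norm_sq v)"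
      using cscalar_adjoint[OF A v(1) v(1)] 1 by (simp add: congr_diag_adjoint[OF c])
    then have "e = cnj e" using norm_sq_pos[OF v] by simp
    then show "e \<in> \<real>" using Reals_cnj_iff by metis
    have "Re e * norm_sq v = quad_form (congr_diag n U d) v" unfolding quad_form_def 1 by simp
    then have "0 < Re e * norm_sq v" using quad_form_congr_diag_pos[OF U _ v, of d] pos by simp
    then show "0 < Re e" using norm_sq_pos[OF v] by (simp add: zero_less_mult_iff)
  qed
qed

definition pd :: "nat \<Rightarrow> complex mat \<Rightarrow> bool" where
  "pd n A \<longleftrightarrow> A \<in> carrier_mat n n \<and> positive_definite A"

lemma pd_carrier [simp]: "pd n A \<Longrightarrow> A \<in> carrier_mat n n"
  by (simp add: pd_def)

lemma pd_adjoint: "pd n A \<Longrightarrow> A\<^sup>\<dagger> = A"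
  by (simp add: pd_def positive_definite_def hermitian_mat_def)

lemma pd_congr_diag: "unitary_mat n U \<Longrightarrow> (\<And>i. i < n \<Longrightarrow> 0 < d i) \<Longrightarrow> pd n (congr_diag n U d)"
  by (simp add: pd_def congr_diag_pos_iff unitary_carrier)

lemma pd_obtain_congr_diag:
  assumes "pd n A"
  obtains U d where "unitary_mat n U" "\<And>i. i < n \<Longrightarrow> 0 < d i" "A = congr_diag n U d" "antimono_below n d"
proof -
  obtain U d where "unitary_mat n U" "A = congr_diag n U d" "antimono_below n d"
    using spectral_theorem[OF pd_carrier[OF assms] pd_adjoint[OF assms]] by blast
  with assms show ?thesis using that[of U d] by (auto simp: pd_def congr_diag_pos_iff)
qed

lemma pd_quad_form_pos: "pd n A \<Longrightarrow> v \<in> carrier_vec n \<Longrightarrow> v \<noteq> 0\<^sub>v n \<Longrightarrow> 0 < quad_form A v"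
  by (metis pd_obtain_congr_diag quad_form_congr_diag_pos)

text \<open>
  Evaluating the form at the eigenvectors shows that the eigenvalues are positive.
\<close>

lemma pdI_quad_form:
  assumes A: "A \<in> carrier_mat n n" "A\<^sup>\<dagger> = A"
    and pos: "\<And>v. v \<in> carrier_vec n \<Longrightarrow> v \<noteq> 0\<^sub>v n \<Longrightarrow> 0 < quad_form A v"
  shows "pd n A"
proof -
  obtain U d where U: "unitary_mat n U" and AU: "A = congr_diag n U d"
    using spectral_theorem[OF A] by blast
  have "0 < d i" if "i < n" for i
  proof -
    have "col U i \<noteq> 0\<^sub>v n" by (rule unitary_col_nonzero[OF U that])
    moreover have "col U i \<in> carrier_vec n" using U that by (auto simp: unitary_mat_def)
    ultimately show ?thesis using pos quad_form_congr_diag_col[OF U that, of d] AU by metis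
  qed
  then show ?thesis unfolding AU by (rule pd_congr_diag[OF U])
qed

lemma congruence_adjoint:
  fixes S A :: "complex mat"
  assumes S: "S \<in> carrier_mat p n" and A: "A \<in> carrier_mat n n" "A\<^sup>\<dagger> = A"
  shows "(S * A * S\<^sup>\<dagger>)\<^sup>\<dagger> = S * A * S\<^sup>\<dagger>"
proof -
  have "(S * A * S\<^sup>\<dagger>)\<^sup>\<dagger> = S * (A * S\<^sup>\<dagger>)"
    using adjoint_mult[OF mult_carrier_mat[OF S A(1)] adjoint_carrier[OF S]] adjoint_mult[OF S A(1)]
    by (simp add: A(2))
  then show ?thesis unfolding assoc_mult_mat[OF S A(1) adjoint_carrier[OF S]] .
qed

lemma pd_congruence:
  assumes A: "pd n A" and S: "S \<in> carrier_mat n n" and T: "T \<in> carrier_mat n n" and ST: "S * T = 1\<^sub>m n"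
  shows "pd n (S * A * S\<^sup>\<dagger>)"
proof (rule pdI_quad_form)
  show "S * A * S\<^sup>\<dagger> \<in> carrier_mat n n" using A S by simp
  show "(S * A * S\<^sup>\<dagger>)\<^sup>\<dagger> = S * A * S\<^sup>\<dagger>"
    by (rule congruence_adjoint[OF S pd_carrier[OF A] pd_adjoint[OF A]])
  fix v :: "complex vec" assume v: "v \<in> carrier_vec n" "v \<noteq> 0\<^sub>v n"
  have Sv: "S\<^sup>\<dagger> *\<^sub>v v \<in> carrier_vec n" by (rule mult_mat_vec_carrier[OF adjoint_carrier[OF S] v(1)])
  have "T\<^sup>\<dagger> * S\<^sup>\<dagger> = 1\<^sub>m n" using adjoint_mult[OF S T] ST by simp
  then have "T\<^sup>\<dagger> *\<^sub>v (S\<^sup>\<dagger> *\<^sub>v v) = v"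
    using assoc_mult_mat_vec[OF adjoint_carrier[OF T] adjoint_carrier[OF S] v(1)] v(1) by simp
  moreover have "T\<^sup>\<dagger> *\<^sub>v 0\<^sub>v n = 0\<^sub>v n" using T by (intro eq_vecI) auto
  ultimately have "S\<^sup>\<dagger> *\<^sub>v v \<noteq> 0\<^sub>v n" using v(2) by auto
  then show "0 < quad_form (S * A * S\<^sup>\<dagger>) v"
    unfolding quad_form_congruence[OF S pd_carrier[OF A] v(1)] by (rule pd_quad_form_pos[OF A Sv])
qed

text \<open>
  The functional calculus does not depend on the diagonalization: a unitary \<open>Z\<close> that
  intertwines the diagonal matrices of \<open>d\<close> and \<open>e\<close> has a nonzero entry at \<open>(i, j)\<close> only
  where \<open>d j = e i\<close>, so it also intertwines those of \<open>f \<circ> d\<close> and \<open>f \<circ> e\<close>.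
\<close>

lemma congr_diag_functional_calculus:
  assumes U: "unitary_mat n U" and W: "unitary_mat n W" and eq: "congr_diag n U d = congr_diag n W e"
  shows "congr_diag n U (\<lambda>i. f (d i)) = congr_diag n W (\<lambda>i. f (e i))"
proof -
  have Uc: "U \<in> carrier_mat n n" and Wc: "W \<in> carrier_mat n n"
    and UU: "U\<^sup>\<dagger> * U = 1\<^sub>m n" "U * U\<^sup>\<dagger> = 1\<^sub>m n" and WW: "W\<^sup>\<dagger> * W = 1\<^sub>m n" "W * W\<^sup>\<dagger> = 1\<^sub>m n"
    using U W by (auto simp: unitary_mat_def)
  define Z where "Z = W\<^sup>\<dagger> * U"
  have Z: "Z \<in> carrier_mat n n" using Uc Wc by (simp add: Z_def)
  note cs = Uc Wc Z adjoint_carrier[OF Uc] adjoint_carrier[OF Wc] mat_diag_dim square_mult_carrier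
  note one = left_mult_one_mat[of _ n n] right_mult_one_mat[of _ n n]
  have l: "W\<^sup>\<dagger> * congr_diag n U g * U = Z * real_diag n g" for g
  proof -
    have "W\<^sup>\<dagger> * congr_diag n U g * U = Z * real_diag n g * (U\<^sup>\<dagger> * U)"
      unfolding congr_diag_def Z_def using cs by (simp add: square_mult_assoc[where n = n])
    then show ?thesis unfolding UU using Z by (simp add: one)
  qed
  have r: "W\<^sup>\<dagger> * congr_diag n W g * U = real_diag n g * Z" for g
  proof -
    have "W\<^sup>\<dagger> * congr_diag n W g * U = (W\<^sup>\<dagger> * W) * real_diag n g * Z"
      unfolding congr_diag_def Z_def using cs by (simp add: square_mult_assoc[where n = n])
    then show ?thesis unfolding WW using Z by (simp add: one)
  qed
  have "Z * real_diag n d = real_diag n e * Z" using l r eq by metis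
  then have ent: "Z $$ (i, j) * complex_of_real (d j) = complex_of_real (e i) * Z $$ (i, j)"
    if "i < n" "j < n" for i j
    using that by (auto simp: mat_diag_mult_right[OF Z] mat_diag_mult_left[OF Z] dest!: arg_cong[of _ _ "\<lambda>M. M $$ (i, j)"])
  have "Z * real_diag n (\<lambda>i. f (d i)) = real_diag n (\<lambda>i. f (e i)) * Z"
    unfolding mat_diag_mult_right[OF Z] mat_diag_mult_left[OF Z]
  proof (rule cong_mat)
    fix i j assume "i < n" "j < n"
    then show "(\<lambda>(i, j). Z $$ (i, j) * complex_of_real (f (d j))) (i, j)
        = (\<lambda>(i, j). complex_of_real (f (e i)) * Z $$ (i, j)) (i, j)"
      using ent[of i j] by (cases "Z $$ (i, j) = 0") (auto simp: mult.commute)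
  qed simp_all
  then have *: "W\<^sup>\<dagger> * congr_diag n U (\<lambda>i. f (d i)) * U = W\<^sup>\<dagger> * congr_diag n W (\<lambda>i. f (e i)) * U"
    using l r by simp
  have recover: "W * (W\<^sup>\<dagger> * M * U) * U\<^sup>\<dagger> = M" if M: "M \<in> carrier_mat n n" for M
  proof -
    have "W * (W\<^sup>\<dagger> * M * U) * U\<^sup>\<dagger> = (W * W\<^sup>\<dagger>) * M * (U * U\<^sup>\<dagger>)"
      using cs M by (simp add: square_mult_assoc[where n = n])
    then show ?thesis unfolding UU WW using M by (simp add: one)
  qed
  show ?thesis
    using arg_cong[OF *, of "\<lambda>M. W * M * U\<^sup>\<dagger>"] recover Uc Wc by simp
qed

lemma pd_power_congr_diag:
  assumes U: "unitary_mat n U" and d: "\<And>i. i < n \<Longrightarrow> 0 < d i"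
  shows "pd_power (congr_diag n U d) t = congr_diag n U (\<lambda>i. d i powr t)"
proof -
  have dim: "dim_row (congr_diag n U d) = n" using unitary_carrier[OF U] by simp
  show ?thesis unfolding pd_power_def dim Let_def congr_diag_def[symmetric]
    using U d by (intro the_equality) (auto dest: congr_diag_functional_calculus[where f = "\<lambda>x. x powr t"])
qed

lemma pd_pd_power: "pd n A \<Longrightarrow> pd n (pd_power A t)"
  by (erule pd_obtain_congr_diag) (simp add: pd_power_congr_diag, rule pd_congr_diag, simp, metis less_irrefl powr_gt_zero)

lemma pd_power_mult:
  assumes A: "pd n A"
  shows "pd_power A s * pd_power A t = pd_power A (s + t)"
proof -
  obtain U d where U: "unitary_mat n U" "\<And>i. i < n \<Longrightarrow> 0 < d i" "A = congr_diag n U d"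
    using pd_obtain_congr_diag[OF A] by metis
  then show ?thesis by (simp add: pd_power_congr_diag congr_diag_mult powr_add)
qed

lemma pd_power_0: "pd n A \<Longrightarrow> pd_power A 0 = 1\<^sub>m n"
proof (erule pd_obtain_congr_diag)
  fix U d assume U: "unitary_mat n U" "\<And>i. i < n \<Longrightarrow> 0 < d i" "A = congr_diag n U d"
  have "congr_diag n U (\<lambda>i. d i powr 0) = congr_diag n U (\<lambda>_. 1)"
    by (rule congr_diag_cong) (use U(2) in force)
  then show "pd_power A 0 = 1\<^sub>m n" by (simp only: U(3) pd_power_congr_diag[OF U(1,2)] congr_diag_one[OF U(1)])
qed

lemma pd_power_1: "pd n A \<Longrightarrow> pd_power A 1 = A"
proof (erule pd_obtain_congr_diag)
  fix U d assume U: "unitary_mat n U" "\<And>i. i < n \<Longrightarrow> 0 < d i" "A = congr_diag n U d"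
  have "congr_diag n U (\<lambda>i. d i powr 1) = congr_diag n U d"
    by (rule congr_diag_cong) (use U(2) in force)
  then show "pd_power A 1 = A" by (simp only: U(3) pd_power_congr_diag[OF U(1,2)])
qed

lemma pd_power_half:
  assumes "pd n A"
  shows "pd_power A (1/2) * pd_power A (1/2) = A"
    and "pd_power A (1/2) * pd_power A (-1/2) = 1\<^sub>m n"
    and "pd_power A (-1/2) * pd_power A (1/2) = 1\<^sub>m n"
  using assms by (simp_all add: pd_power_mult pd_power_0 pd_power_1)

lemma inverse_mat_eqI:
  assumes A: "A \<in> carrier_mat n n" and B: "B \<in> carrier_mat n n" and AB: "A * B = 1\<^sub>m n"
  shows "inverse_mat A = B"
proof -
  have BA: "B * A = 1\<^sub>m n" by (rule mat_mult_left_right_inverse[OF A B AB])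
  have "A \<in> Units (ring_mat TYPE(complex) n ())"
    unfolding Units_def using A B AB BA by (auto simp: ring_mat_def)
  then obtain C where C: "mat_inverse A = Some C"
    using mat_inverse(1)[OF A, of "()"] by (cases "mat_inverse A") auto
  from mat_inverse(2)[OF A C] have AC: "A * C = 1\<^sub>m n" and Cc: "C \<in> carrier_mat n n" by auto
  have "C = (B * A) * C" using BA Cc by (simp add: left_mult_one_mat[of _ n n])
  also have "\<dots> = B" using A B Cc AC by (simp add: square_mult_assoc[where n = n] right_mult_one_mat[of _ n n])
  finally show ?thesis using C by (simp add: inverse_mat_def)
qed

lemma inverse_mat_congr_diag:
  assumes U: "unitary_mat n U" and d: "\<And>i. i < n \<Longrightarrow> 0 < d i"
  shows "inverse_mat (congr_diag n U d) = congr_diag n U (\<lambda>i. 1 / d i)"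
proof (rule inverse_mat_eqI[where n = n])
  have "congr_diag n U (\<lambda>i. d i * (1 / d i)) = congr_diag n U (\<lambda>_. 1)"
    by (rule congr_diag_cong) (use d in \<open>auto simp: less_imp_neq[symmetric]\<close>)
  then show "congr_diag n U d * congr_diag n U (\<lambda>i. 1 / d i) = 1\<^sub>m n"
    unfolding congr_diag_mult[OF U] congr_diag_one[OF U] .
qed (use unitary_carrier[OF U] in simp_all)

lemma pd_inverse_mat: "pd n A \<Longrightarrow> pd n (inverse_mat A)"
  by (erule pd_obtain_congr_diag) (auto simp: inverse_mat_congr_diag intro!: pd_congr_diag)

section \<open>Weighted geometric means\<close>

lemma congr_diag_scale:
  assumes S: "S \<in> carrier_mat n n"
  shows "congr_diag n (S * real_diag n c) d = congr_diag n S (\<lambda>i. (c i)\<^sup>2 * d i)"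
proof -
  have "congr_diag n (S * real_diag n c) d = S * congr_diag n (real_diag n c) d * S\<^sup>\<dagger>"
    by (rule congr_diag_congruence[OF S mat_diag_dim, symmetric])
  also have "congr_diag n (real_diag n c) d = real_diag n (\<lambda>i. (c i)\<^sup>2 * d i)"
    by (simp add: congr_diag_def power2_eq_square mult_ac)
  finally show ?thesis by (simp add: congr_diag_def)
qed

lemma congr_diag_smult:
  assumes S: "S \<in> carrier_mat p n"
  shows "complex_of_real c \<cdot>\<^sub>m congr_diag n S d = congr_diag n S (\<lambda>i. c * d i)"
  using S by (intro eq_matI) (auto simp: congr_diag_index sum_distrib_left intro!: sum.cong)

lemma pd_congr_diag_invertible:
  assumes S: "S \<in> carrier_mat n n" and T: "T \<in> carrier_mat n n" and ST: "S * T = 1\<^sub>m n"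
    and d: "\<And>i. i < n \<Longrightarrow> 0 < d i"
  shows "pd n (congr_diag n S d)"
proof -
  have "pd n (congr_diag n (1\<^sub>m n) d)" by (rule pd_congr_diag[OF unitary_one d])
  from pd_congruence[OF this S T ST] show ?thesis
    unfolding congr_diag_id by (simp add: congr_diag_def)
qed

text \<open>
  The geometric mean is covariant under congruence, so on simultaneously diagonalized matrices it is
  the scalar weighted geometric mean of the diagonal entries. With \<open>X\<close> the first matrix, the matrix
  \<open>X^(-1/2) S diag(a)^(1/2)\<close> is unitary and diagonalizes \<open>X^(-1/2) B X^(-1/2)\<close>.
\<close>

lemma geometric_mean_congr_diag:
  assumes S: "S \<in> carrier_mat n n" and T: "T \<in> carrier_mat n n" and ST: "S * T = 1\<^sub>m n"
    and a: "\<And>i. i < n \<Longrightarrow> 0 < a i" and b: "\<And>i. i < n \<Longrightarrow> 0 < b i"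
  shows "geometric_mean t (congr_diag n S a) (congr_diag n S b) = congr_diag n S (\<lambda>i. a i powr (1 - t) * b i powr t)"
proof -
  let ?X = "congr_diag n S a"
  define R where "R = pd_power ?X (1/2)"
  define Q where "Q = pd_power ?X (-1/2)"
  have pX: "pd n ?X" by (rule pd_congr_diag_invertible[OF S T ST a])
  have pR: "pd n R" and pQ: "pd n Q" using pd_pd_power[OF pX] by (auto simp: R_def Q_def)
  note R = pd_carrier[OF pR] and Q = pd_carrier[OF pQ]
  have RR: "R * R = ?X" and RQ: "R * Q = 1\<^sub>m n" and QR: "Q * R = 1\<^sub>m n"
    using pd_power_half[OF pX] by (auto simp: R_def Q_def)
  note one = left_mult_one_mat[of _ n n] right_mult_one_mat[of _ n n]
  have QXQ: "Q * ?X * Q = 1\<^sub>m n"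
  proof -
    have "Q * ?X * Q = (Q * R) * (R * Q)"
      unfolding RR[symmetric] using Q R by (simp add: square_mult_assoc[where n = n])
    then show ?thesis using RQ QR by simp
  qed
  define W where "W = Q * S * real_diag n (\<lambda>i. sqrt (a i))"
  have W: "W \<in> carrier_mat n n" using Q S by (simp add: W_def)
  have congr_diag_W: "congr_diag n W d = Q * congr_diag n S (\<lambda>i. a i * d i) * Q" for d
  proof -
    have "congr_diag n W d = congr_diag n (Q * S) (\<lambda>i. a i * d i)"
      unfolding W_def congr_diag_scale[OF square_mult_carrier[OF Q S]]
      by (rule congr_diag_cong) (use a in \<open>simp add: less_imp_le\<close>)
    then show ?thesis using congr_diag_congruence[OF Q S] pd_adjoint[OF pQ] by simp
  qed
  have UW: "unitary_mat n W"
  proof (rule unitaryI(2)[OF W])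
    have "W * W\<^sup>\<dagger> = congr_diag n W (\<lambda>_. 1)" using W by (simp add: congr_diag_def one)
    also have "\<dots> = 1\<^sub>m n" unfolding congr_diag_W by (simp add: QXQ)
    finally show "W * W\<^sup>\<dagger> = 1\<^sub>m n" .
  qed
  have QBQ: "Q * congr_diag n S b * Q = congr_diag n W (\<lambda>i. b i / a i)"
  proof -
    have "congr_diag n S b = congr_diag n S (\<lambda>i. a i * (b i / a i))"
      by (rule congr_diag_cong) (use a in \<open>simp add: less_imp_neq[symmetric]\<close>)
    then show ?thesis unfolding congr_diag_W by simp
  qed
  have RSR: "R * (Q * congr_diag n S f * Q) * R = congr_diag n S f" for f
  proof -
    have "R * (Q * congr_diag n S f * Q) * R = (R * Q) * congr_diag n S f * (Q * R)"
      using Q R congr_diag_carrier[OF S, of f] by (simp add: square_mult_assoc[where n = n])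
    then show ?thesis unfolding RQ QR using congr_diag_carrier[OF S, of f] by (simp add: one)
  qed
  have "geometric_mean t ?X (congr_diag n S b) = R * pd_power (congr_diag n W (\<lambda>i. b i / a i)) t * R"
    unfolding geometric_mean_def R_def[symmetric] Q_def[symmetric] QBQ ..
  also have "\<dots> = R * congr_diag n W (\<lambda>i. (b i / a i) powr t) * R"
    by (subst pd_power_congr_diag[OF UW]) (use a b in auto)
  also have "\<dots> = congr_diag n S (\<lambda>i. a i * (b i / a i) powr t)"
    unfolding congr_diag_W RSR ..
  also have "\<dots> = congr_diag n S (\<lambda>i. a i powr (1 - t) * b i powr t)"
  proof (rule congr_diag_cong)
    fix i assume "i < n"
    then show "a i * (b i / a i) powr t = a i powr (1 - t) * b i powr t"
      using a[of i] b[of i] by (simp add: powr_divide powr_diff)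
  qed
  finally show ?thesis .
qed

text \<open>
  Diagonalize \<open>X^(-1/2) A X^(-1/2)\<close> by a unitary \<open>W\<close> and take \<open>S = X^(1/2) W\<close>.
  Together with the previous lemma this reduces identities for geometric means to identities between
  real numbers.
\<close>

lemma simultaneous_diagonalization:
  assumes X: "pd n X" and A: "pd n A"
  obtains S T d where "S \<in> carrier_mat n n" "T \<in> carrier_mat n n" "S * T = 1\<^sub>m n"
    "\<And>i. i < n \<Longrightarrow> 0 < d i" "X = congr_diag n S (\<lambda>_. 1)" "A = congr_diag n S d"
proof -
  define R where "R = pd_power X (1/2)"
  define Q where "Q = pd_power X (-1/2)"
  have pR: "pd n R" and pQ: "pd n Q" using pd_pd_power[OF X] by (auto simp: R_def Q_def)
  note R = pd_carrier[OF pR] and Q = pd_carrier[OF pQ]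
  have RR: "R * R = X" and RQ: "R * Q = 1\<^sub>m n" and QR: "Q * R = 1\<^sub>m n"
    using pd_power_half[OF X] by (auto simp: R_def Q_def)
  note one = left_mult_one_mat[of _ n n] right_mult_one_mat[of _ n n]
  have "pd n (Q * A * Q)"
    using pd_congruence[OF A Q R QR] pd_adjoint[OF pQ] by simp
  then obtain W d where UW: "unitary_mat n W" and d: "\<And>i. i < n \<Longrightarrow> 0 < d i" and QAQ: "Q * A * Q = congr_diag n W d"
    by (rule pd_obtain_congr_diag) blast
  have W: "W \<in> carrier_mat n n" and WW: "W * W\<^sup>\<dagger> = 1\<^sub>m n" using UW by (auto simp: unitary_mat_def)
  have congr_diag_RW: "congr_diag n (R * W) f = R * congr_diag n W f * R" for f
    using congr_diag_congruence[OF R W] pd_adjoint[OF pR] by simp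
  show ?thesis
  proof (rule that[of "R * W" "W\<^sup>\<dagger> * Q" d])
    have "R * W * (W\<^sup>\<dagger> * Q) = R * (W * W\<^sup>\<dagger>) * Q" using R W Q by (simp add: square_mult_assoc[where n = n])
    then show "R * W * (W\<^sup>\<dagger> * Q) = 1\<^sub>m n" unfolding WW using R RQ by (simp add: one)
    show "X = congr_diag n (R * W) (\<lambda>_. 1)" unfolding congr_diag_RW congr_diag_one[OF UW] using R RR by (simp add: one)
    have "R * (Q * A * Q) * R = (R * Q) * A * (Q * R)"
      using R Q A by (simp add: square_mult_assoc[where n = n])
    then show "A = congr_diag n (R * W) d" unfolding congr_diag_RW QAQ[symmetric] RQ QR using A by (simp add: one)
  qed (use R W Q d in auto)
qed

lemma pd_geometric_mean: "pd n X \<Longrightarrow> pd n A \<Longrightarrow> pd n (geometric_mean t X A)"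
proof -
  assume X: "pd n X" and A: "pd n A"
  obtain S T d where S: "S \<in> carrier_mat n n" "T \<in> carrier_mat n n" "S * T = 1\<^sub>m n"
    and d: "\<And>i. i < n \<Longrightarrow> 0 < d i" and eq: "X = congr_diag n S (\<lambda>_. 1)" "A = congr_diag n S d"
    by (rule simultaneous_diagonalization[OF X A]) blast
  have "0 < (1::real) powr (1 - t) * d i powr t" if "i < n" for i using d[OF that] by simp
  then show ?thesis unfolding eq
    using geometric_mean_congr_diag[OF S, of "\<lambda>_. 1" d t] d pd_congr_diag_invertible[OF S] by simp
qed

lemma geometric_mean_commute:
  assumes X: "pd n X" and A: "pd n A"
  shows "geometric_mean t X A = geometric_mean (1 - t) A X"
proof -
  obtain S T d where S: "S \<in> carrier_mat n n" "T \<in> carrier_mat n n" "S * T = 1\<^sub>m n"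
    and d: "\<And>i. i < n \<Longrightarrow> 0 < d i" and eq: "X = congr_diag n S (\<lambda>_. 1)" "A = congr_diag n S d"
    by (rule simultaneous_diagonalization[OF X A]) blast
  show ?thesis unfolding eq
    using geometric_mean_congr_diag[OF S, of "\<lambda>_. 1" d t] geometric_mean_congr_diag[OF S, of d "\<lambda>_. 1" "1 - t"] d
    by (simp add: mult.commute)
qed

lemma geometric_mean_smult_left:
  assumes X: "pd n X" and A: "pd n A" and c: "0 < c"
  shows "geometric_mean t (complex_of_real c \<cdot>\<^sub>m X) A
    = complex_of_real (c powr (1 - t)) \<cdot>\<^sub>m geometric_mean t X A"
proof -
  obtain S T d where S: "S \<in> carrier_mat n n" "T \<in> carrier_mat n n" "S * T = 1\<^sub>m n"
    and d: "\<And>i. i < n \<Longrightarrow> 0 < d i" and eq: "X = congr_diag n S (\<lambda>_. 1)" "A = congr_diag n S d"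
    by (rule simultaneous_diagonalization[OF X A]) blast
  show ?thesis unfolding eq congr_diag_smult[OF S(1)]
    using geometric_mean_congr_diag[OF S, of "\<lambda>_. 1" d t] geometric_mean_congr_diag[OF S, of "\<lambda>_. c * 1" d t] d c
      congr_diag_smult[OF S(1), of "c powr (1 - t)"]
    by simp
qed

lemma geometric_mean_powers:
  assumes X: "pd n X"
  shows "geometric_mean t (pd_power X a) (pd_power X b) = pd_power X ((1 - t) * a + t * b)"
proof -
  obtain U d where UU: "unitary_mat n U" and d: "\<And>i. i < n \<Longrightarrow> 0 < d i" and eq: "X = congr_diag n U d"
    using pd_obtain_congr_diag[OF X] by metis
  have U: "U \<in> carrier_mat n n" "U\<^sup>\<dagger> \<in> carrier_mat n n" "U * U\<^sup>\<dagger> = 1\<^sub>m n"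
    using UU by (auto simp: unitary_mat_def)
  have "0 < d i powr s" if "i < n" for i s using d[OF that] by simp
  then show ?thesis unfolding eq
    using geometric_mean_congr_diag[OF U, of "\<lambda>i. d i powr a" "\<lambda>i. d i powr b" t]
    by (simp add: pd_power_congr_diag[OF UU d] powr_powr powr_add mult.commute)
qed

section \<open>The Loewner order and the Loewner--Heinz inequality\<close>

definition loewner :: "nat \<Rightarrow> complex mat \<Rightarrow> complex mat \<Rightarrow> bool" where
  "loewner n A B \<longleftrightarrow> (\<forall>v\<in>carrier_vec n. quad_form A v \<le> quad_form B v)"

lemma loewner_refl: "loewner n A A"
  by (simp add: loewner_def)

lemma loewner_trans: "loewner n A B \<Longrightarrow> loewner n B C \<Longrightarrow> loewner n A C"
  unfolding loewner_def by (meson order_trans)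

lemma loewner_congruence:
  assumes le: "loewner n A B" and A: "A \<in> carrier_mat n n" and B: "B \<in> carrier_mat n n"
    and S: "S \<in> carrier_mat n n"
  shows "loewner n (S * A * S\<^sup>\<dagger>) (S * B * S\<^sup>\<dagger>)"
  unfolding loewner_def
proof
  fix v :: "complex vec" assume v: "v \<in> carrier_vec n"
  have "S\<^sup>\<dagger> *\<^sub>v v \<in> carrier_vec n" by (rule mult_mat_vec_carrier[OF adjoint_carrier[OF S] v])
  then show "quad_form (S * A * S\<^sup>\<dagger>) v \<le> quad_form (S * B * S\<^sup>\<dagger>) v"
    unfolding quad_form_congruence[OF S A v] quad_form_congruence[OF S B v] using le by (simp add: loewner_def)
qed

lemma quad_form_smult: "A \<in> carrier_mat n n \<Longrightarrow> v \<in> carrier_vec n \<Longrightarrow> quad_form (complex_of_real c \<cdot>\<^sub>m A) v = c * quad_form A v"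
proof -
  assume A: "A \<in> carrier_mat n n" and v: "v \<in> carrier_vec n"
  have "(complex_of_real c \<cdot>\<^sub>m A) *\<^sub>v v = complex_of_real c \<cdot>\<^sub>v (A *\<^sub>v v)"
    using A v by (intro eq_vecI) auto
  moreover have "A *\<^sub>v v \<in> carrier_vec n" by (rule mult_mat_vec_carrier[OF A v])
  ultimately show ?thesis using v by (simp add: quad_form_def)
qed

text \<open>
  Let \<open>R\<close> and \<open>T\<close> be the square roots of \<open>X\<close> and \<open>Y\<close>, and let \<open>u\<close> be an
  eigenvector of \<open>M = T - R\<close> with eigenvalue \<open>\<mu>\<close>. From \<open>Y - X = M T + R M\<close> one gets
  \<open>0 \<le> ((Y - X) u, u) = \<mu> ((T + R) u, u)\<close>, so \<open>\<mu>\<close> cannot be negative.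
\<close>

lemma sqrt_mono:
  assumes X: "pd n X" and Y: "pd n Y" and le: "loewner n X Y"
  shows "loewner n (pd_power X (1/2)) (pd_power Y (1/2))"
proof -
  define R where "R = pd_power X (1/2)"
  define T where "T = pd_power Y (1/2)"
  have pR: "pd n R" and pT: "pd n T" using pd_pd_power X Y by (auto simp: R_def T_def)
  note R = pd_carrier[OF pR] and T = pd_carrier[OF pT]
  have RR: "R * R = X" and TT: "T * T = Y" using pd_power_half(1) X Y by (auto simp: R_def T_def)
  define M where "M = T - R"
  have M: "M \<in> carrier_mat n n" using R T by (simp add: M_def minus_carrier_mat)
  have "cnj (R $$ (j, i)) = R $$ (i, j)" "cnj (T $$ (j, i)) = T $$ (i, j)" if "i < n" "j < n" for i j
    using that adjoint_index[of i R j] adjoint_index[of i T j] R T pd_adjoint[OF pR] pd_adjoint[OF pT]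
    by auto
  then have "M\<^sup>\<dagger> = M"
    using R T by (intro eq_matI) (auto simp: M_def)
  then obtain U \<mu> where U: "unitary_mat n U" and MU: "M = congr_diag n U \<mu>"
    using spectral_theorem[OF M] by blast
  have "0 \<le> \<mu> i" if i: "i < n" for i
  proof -
    define u where "u = col U i"
    have u: "u \<in> carrier_vec n" using U i by (auto simp: u_def unitary_mat_def)
    have u0: "u \<noteq> 0\<^sub>v n" unfolding u_def by (rule unitary_col_nonzero[OF U i])
    have Ru: "R *\<^sub>v u \<in> carrier_vec n" and Tu: "T *\<^sub>v u \<in> carrier_vec n"
      and TTu: "T *\<^sub>v (T *\<^sub>v u) \<in> carrier_vec n" and RTu: "R *\<^sub>v (T *\<^sub>v u) \<in> carrier_vec n"
      and RRu: "R *\<^sub>v (R *\<^sub>v u) \<in> carrier_vec n"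
      using R T u by (auto intro: mult_mat_vec_carrier)
    have Mu: "M *\<^sub>v u = complex_of_real (\<mu> i) \<cdot>\<^sub>v u"
      unfolding MU u_def by (rule congr_diag_mult_col[OF U i])
    have 1: "(T *\<^sub>v (T *\<^sub>v u)) \<bullet>c u - (R *\<^sub>v (T *\<^sub>v u)) \<bullet>c u = complex_of_real (\<mu> i) * ((T *\<^sub>v u) \<bullet>c u)"
    proof -
      have "(T *\<^sub>v (T *\<^sub>v u)) \<bullet>c u - (R *\<^sub>v (T *\<^sub>v u)) \<bullet>c u = (M *\<^sub>v (T *\<^sub>v u)) \<bullet>c u"
        unfolding M_def minus_mult_distrib_mat_vec[OF T R Tu]
        using minus_scalar_prod_distrib[OF TTu RTu] u by simp
      also have "\<dots> = (T *\<^sub>v u) \<bullet>c (M *\<^sub>v u)"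
        using cscalar_adjoint[OF M Tu u] \<open>M\<^sup>\<dagger> = M\<close> by simp
      finally show ?thesis unfolding Mu using Tu u by (simp add: conjugate_smult_vec)
    qed
    have 2: "(R *\<^sub>v (T *\<^sub>v u)) \<bullet>c u - (R *\<^sub>v (R *\<^sub>v u)) \<bullet>c u = complex_of_real (\<mu> i) * ((R *\<^sub>v u) \<bullet>c u)"
    proof -
      have "(R *\<^sub>v (T *\<^sub>v u)) \<bullet>c u - (R *\<^sub>v (R *\<^sub>v u)) \<bullet>c u = (T *\<^sub>v u) \<bullet>c (R *\<^sub>v u) - (R *\<^sub>v u) \<bullet>c (R *\<^sub>v u)"
        using cscalar_adjoint[OF R Tu u] cscalar_adjoint[OF R Ru u] pd_adjoint[OF pR] by simp
      also have "\<dots> = (M *\<^sub>v u) \<bullet>c (R *\<^sub>v u)"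
        unfolding M_def minus_mult_distrib_mat_vec[OF T R u]
        using minus_scalar_prod_distrib[OF Tu Ru] Ru by simp
      also have "\<dots> = complex_of_real (\<mu> i) * (u \<bullet>c (R *\<^sub>v u))"
        unfolding Mu using u Ru by simp
      finally show ?thesis using cscalar_adjoint[OF R u u] pd_adjoint[OF pR] by simp
    qed
    have "quad_form Y u - quad_form X u = Re ((T *\<^sub>v (T *\<^sub>v u)) \<bullet>c u - (R *\<^sub>v (R *\<^sub>v u)) \<bullet>c u)"
      unfolding quad_form_def TT[symmetric] RR[symmetric]
      by (simp add: assoc_mult_mat_vec[OF T T u] assoc_mult_mat_vec[OF R R u])
    also have "\<dots> = Re (complex_of_real (\<mu> i) * ((T *\<^sub>v u) \<bullet>c u) + complex_of_real (\<mu> i) * ((R *\<^sub>v u) \<bullet>c u))"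
      unfolding 1[symmetric] 2[symmetric] by simp
    also have "\<dots> = \<mu> i * (quad_form T u + quad_form R u)" by (simp add: quad_form_def distrib_left)
    finally have "0 \<le> \<mu> i * (quad_form T u + quad_form R u)"
      using le[unfolded loewner_def, rule_format, OF u] by linarith
    moreover have "0 < quad_form T u + quad_form R u" using pd_quad_form_pos[OF pT u u0] pd_quad_form_pos[OF pR u u0] by simp
    ultimately show ?thesis by (simp add: zero_le_mult_iff)
  qed
  then have pos: "0 \<le> quad_form M v" if "v \<in> carrier_vec n" for v
    unfolding MU using quad_form_congr_diag_nonneg[OF unitary_carrier[OF U] _ that] by blast
  show ?thesis unfolding loewner_def R_def[symmetric] T_def[symmetric]
  proof
    fix v :: "complex vec" assume v: "v \<in> carrier_vec n"
    have "quad_form M v = quad_form T v - quad_form R v"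
      unfolding quad_form_def M_def minus_mult_distrib_mat_vec[OF T R v]
      using minus_scalar_prod_distrib[of "T *\<^sub>v v" n "R *\<^sub>v v" "conjugate v"] R T v
      by (simp add: mult_mat_vec_carrier[of _ n n])
    then show "quad_form R v \<le> quad_form T v" using pos[OF v] by simp
  qed
qed

text \<open>
  Monotonicity of the geometric mean in its second argument is monotonicity of the power, moved by two
  congruences. It is used for exponent \<open>1/2\<close> on the way to the Loewner--Heinz inequality, and for
  general exponents afterwards.
\<close>

lemma geometric_mean_mono_right_general:
  assumes A: "pd n A" and X: "pd n X" and Y: "pd n Y" and le: "loewner n X Y"
    and power_mono: "\<And>P Q. pd n P \<Longrightarrow> pd n Q \<Longrightarrow> loewner n P Q \<Longrightarrow> loewner n (pd_power P t) (pd_power Q t)"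
  shows "loewner n (geometric_mean t A X) (geometric_mean t A Y)"
proof -
  define R where "R = pd_power A (1/2)"
  define Q where "Q = pd_power A (-1/2)"
  have pR: "pd n R" and pQ: "pd n Q" using pd_pd_power[OF A] by (auto simp: R_def Q_def)
  note R = pd_carrier[OF pR] and Q = pd_carrier[OF pQ]
  have QR: "Q * R = 1\<^sub>m n" using pd_power_half[OF A] by (auto simp: R_def Q_def)
  have pp: "pd n (Q * P * Q)" if "pd n P" for P
    using pd_congruence[OF that Q R QR] pd_adjoint[OF pQ] by simp
  have "loewner n (Q * X * Q) (Q * Y * Q)"
    using loewner_congruence[OF le pd_carrier[OF X] pd_carrier[OF Y] Q] pd_adjoint[OF pQ] by simp
  then have "loewner n (pd_power (Q * X * Q) t) (pd_power (Q * Y * Q) t)"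
    by (rule power_mono[OF pp[OF X] pp[OF Y]])
  from loewner_congruence[OF this pd_carrier[OF pd_pd_power[OF pp[OF X]]] pd_carrier[OF pd_pd_power[OF pp[OF Y]]] R]
  show ?thesis
    unfolding geometric_mean_def R_def[symmetric] Q_def[symmetric] pd_adjoint[OF pR] .
qed

text \<open>
  For exponent \<open>1/2\<close> the mean is symmetric, so monotonicity in one argument gives joint
  monotonicity.
\<close>

lemma geometric_mean_half_mono:
  assumes "pd n A" "pd n B" "pd n C" "pd n D" "loewner n A C" "loewner n B D"
  shows "loewner n (geometric_mean (1/2) A B) (geometric_mean (1/2) C D)"
proof -
  have "loewner n (geometric_mean (1/2) A B) (geometric_mean (1/2) A D)"
    by (rule geometric_mean_mono_right_general) (use assms sqrt_mono in auto)
  moreover have "loewner n (geometric_mean (1/2) D A) (geometric_mean (1/2) D C)"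
    by (rule geometric_mean_mono_right_general) (use assms sqrt_mono in auto)
  ultimately show ?thesis
    using geometric_mean_commute[of n A D "1/2"] geometric_mean_commute[of n C D "1/2"] assms
      loewner_trans by simp
qed

text \<open>
  A set that contains the end points of the unit interval and is closed under midpoints contains all
  dyadic rationals of the interval, which are dense.
\<close>

lemma dyadic_interval_dense:
  fixes E :: "real set"
  assumes "0 \<in> E" "1 \<in> E" and mid: "\<And>a b. a \<in> E \<Longrightarrow> b \<in> E \<Longrightarrow> (a + b) / 2 \<in> E"
    and s: "0 \<le> s" "s \<le> 1"
  shows "\<exists>f. (\<forall>N. f N \<in> E) \<and> f \<longlonglongrightarrow> s"
proof -
  have dy: "real k / 2 ^ N \<in> E" if "k \<le> 2 ^ N" for k N
    using that
  proof (induction N arbitrary: k)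
    case 0
    then have "k = 0 \<or> k = 1" by auto
    then show ?case using assms by auto
  next
    case (Suc N)
    show ?case
    proof (cases "even k")
      case True
      then obtain l where "k = 2 * l" by blast
      then show ?thesis using Suc.IH[of l] Suc.prems by simp
    next
      case False
      then obtain l where k: "k = 2 * l + 1" by (auto elim: oddE)
      then have "l + 1 \<le> 2 ^ N" using Suc.prems by simp
      then have "(real l / 2 ^ N + real (l + 1) / 2 ^ N) / 2 \<in> E"
        using Suc.IH[of l] Suc.IH[of "l + 1"] mid by simp
      moreover have "(real l / 2 ^ N + real (l + 1) / 2 ^ N) / 2 = real k / 2 ^ Suc N"
        by (simp add: k field_simps)
      ultimately show ?thesis by metis
    qed
  qed
  define f where "f N = real (nat \<lfloor>s * 2 ^ N\<rfloor>) / 2 ^ N" for N :: nat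
  have fl: "real (nat \<lfloor>s * 2 ^ N\<rfloor>) = of_int \<lfloor>s * 2 ^ N\<rfloor>" for N using s by simp
  have "f N \<in> E" for N
  proof -
    have "s * 2 ^ N \<le> 2 ^ N" using s by (simp add: mult_left_le_one_le)
    then have "real (nat \<lfloor>s * 2 ^ N\<rfloor>) \<le> real (2 ^ N)" unfolding fl
      by (metis of_int_floor_le of_nat_numeral of_nat_power order_trans)
    then show ?thesis unfolding f_def by (intro dy) linarith
  qed
  moreover have "f \<longlonglongrightarrow> s"
  proof (rule tendsto_sandwich)
    show "\<forall>\<^sub>F N in sequentially. s - (1/2) ^ N \<le> f N"
    proof (rule always_eventually, rule allI)
      fix N
      have "s * 2 ^ N - 1 \<le> of_int \<lfloor>s * 2 ^ N\<rfloor>" by linarith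
      then have "(s * 2 ^ N - 1) / 2 ^ N \<le> f N" unfolding f_def fl by (intro divide_right_mono) auto
      then show "s - (1/2) ^ N \<le> f N" by (simp add: diff_divide_distrib power_divide)
    qed
    show "\<forall>\<^sub>F N in sequentially. f N \<le> s"
      by (rule always_eventually) (auto simp: f_def fl divide_le_eq)
    show "(\<lambda>N. s - (1/2) ^ N) \<longlonglongrightarrow> s"
      using tendsto_diff[OF tendsto_const LIMSEQ_power_zero[of "1/2::real"], of s] by simp
  qed simp
  ultimately show ?thesis by blast
qed

text \<open>
  The exponents for which the power is monotone at \<open>X\<close> and \<open>Y\<close> include 0 and 1 and are
  closed under midpoints, since \<open>X^((a+b)/2)\<close> is the geometric mean of \<open>X^a\<close> and \<open>X^b\<close>,
  which is jointly monotone. Continuity in the exponent does the rest.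
\<close>

theorem loewner_heinz:
  assumes X: "pd n X" and Y: "pd n Y" and le: "loewner n X Y" and s: "0 \<le> s" "s \<le> 1"
  shows "loewner n (pd_power X s) (pd_power Y s)"
proof -
  define E where "E = {s. loewner n (pd_power X s) (pd_power Y s)}"
  have "0 \<in> E" using X Y by (simp add: E_def pd_power_0 loewner_refl)
  moreover have "1 \<in> E" using X Y le by (simp add: E_def pd_power_1)
  moreover have "(a + b) / 2 \<in> E" if "a \<in> E" "b \<in> E" for a b
  proof -
    have "loewner n (geometric_mean (1/2) (pd_power X a) (pd_power X b))
        (geometric_mean (1/2) (pd_power Y a) (pd_power Y b))"
      by (rule geometric_mean_half_mono) (use that X Y pd_pd_power in \<open>auto simp: E_def\<close>)
    then show ?thesis unfolding geometric_mean_powers[OF X] geometric_mean_powers[OF Y]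
      by (simp add: E_def add_divide_distrib)
  qed
  ultimately obtain f where f: "\<And>N. f N \<in> E" "f \<longlonglongrightarrow> s"
    using dyadic_interval_dense[of E s] s by auto
  have cont: "(\<lambda>N. quad_form (pd_power Z (f N)) v) \<longlonglongrightarrow> quad_form (pd_power Z s) v"
    if Z: "pd n Z" and v: "v \<in> carrier_vec n" for Z v
  proof -
    obtain U d where U: "unitary_mat n U" and d: "\<And>i. i < n \<Longrightarrow> 0 < d i" and eq: "Z = congr_diag n U d"
      using pd_obtain_congr_diag[OF Z] by metis
    have "pd_power (congr_diag n U d) q = congr_diag n U (\<lambda>i. d i powr q)" for q
      by (rule pd_power_congr_diag[OF U d])
    then show ?thesis unfolding eq
      by (simp only: quad_form_congr_diag[OF unitary_carrier[OF U] v], intro tendsto_sum tendsto_mult tendsto_powr tendsto_const f(2))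
         (use d in \<open>auto simp: less_imp_neq[symmetric]\<close>)
  qed
  show ?thesis unfolding loewner_def
  proof
    fix v :: "complex vec" assume v: "v \<in> carrier_vec n"
    show "quad_form (pd_power X s) v \<le> quad_form (pd_power Y s) v"
      by (rule LIMSEQ_le[OF cont[OF X v] cont[OF Y v]])
         (use f(1) v in \<open>auto simp: E_def loewner_def\<close>)
  qed
qed

text \<open>
  The mean of order \<open>t\<close> is the mean of order \<open>1 - t\<close> with exchanged arguments, so this is
  monotonicity of the power with exponent \<open>1 - t\<close>.
\<close>

lemma geometric_mean_mono_left:
  assumes A: "pd n A" and X: "pd n X" and Y: "pd n Y" and le: "loewner n X Y" and t: "0 \<le> t" "t \<le> 1"
  shows "loewner n (geometric_mean t X A) (geometric_mean t Y A)"
  unfolding geometric_mean_commute[OF X A] geometric_mean_commute[OF Y A]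
  by (rule geometric_mean_mono_right_general[OF A X Y le]) (use loewner_heinz t in auto)

section \<open>Limits and comparison of positive definite matrices\<close>

lemma quad_form_index:
  assumes M: "M \<in> carrier_mat n n" and v: "v \<in> carrier_vec n"
  shows "quad_form M v = Re (\<Sum>i<n. \<Sum>l<n. M $$ (i, l) * v $ l * cnj (v $ i))"
proof -
  have "(M *\<^sub>v v) \<bullet>c v = (\<Sum>i<n. (M *\<^sub>v v) $ i * cnj (v $ i))"
    using M v by (auto simp: scalar_prod_def atLeast0LessThan intro!: sum.cong)
  also have "\<dots> = (\<Sum>i<n. \<Sum>l<n. M $$ (i, l) * v $ l * cnj (v $ i))"
    by (intro sum.cong refl) (simp add: mult_vec_index[OF M v] sum_distrib_right del: index_mult_mat_vec)
  finally show ?thesis by (simp add: quad_form_def)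
qed

lemma weighted_sum_carrier [simp]: "weighted_sum_mat n m w B \<in> carrier_mat n n"
  by (simp add: weighted_sum_mat_def)

lemma quad_form_weighted_sum:
  assumes B: "\<And>j. j < m \<Longrightarrow> B j \<in> carrier_mat n n" and v: "v \<in> carrier_vec n"
  shows "quad_form (weighted_sum_mat n m w B) v = (\<Sum>j<m. w j * quad_form (B j) v)"
proof -
  define s where "s j = (\<Sum>i<n. \<Sum>l<n. B j $$ (i, l) * v $ l * cnj (v $ i))" for j
  have "(\<Sum>i<n. \<Sum>l<n. weighted_sum_mat n m w B $$ (i, l) * v $ l * cnj (v $ i))
      = (\<Sum>i<n. \<Sum>l<n. \<Sum>j<m. complex_of_real (w j) * (B j $$ (i, l) * v $ l * cnj (v $ i)))"
    by (intro sum.cong refl) (simp add: weighted_sum_mat_def sum_distrib_right mult.assoc)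
  also have "\<dots> = (\<Sum>i<n. \<Sum>j<m. \<Sum>l<n. complex_of_real (w j) * (B j $$ (i, l) * v $ l * cnj (v $ i)))"
    by (intro sum.cong refl sum.swap)
  also have "\<dots> = (\<Sum>j<m. \<Sum>i<n. \<Sum>l<n. complex_of_real (w j) * (B j $$ (i, l) * v $ l * cnj (v $ i)))"
    by (rule sum.swap)
  also have "\<dots> = (\<Sum>j<m. complex_of_real (w j) * s j)"
    by (simp add: s_def sum_distrib_left)
  finally have "quad_form (weighted_sum_mat n m w B) v = Re (\<Sum>j<m. complex_of_real (w j) * s j)"
    unfolding quad_form_index[OF weighted_sum_carrier v] by (rule arg_cong)
  also have "\<dots> = (\<Sum>j<m. w j * Re (s j))" by simp
  also have "\<dots> = (\<Sum>j<m. w j * quad_form (B j) v)"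
    by (intro sum.cong refl) (simp only: s_def quad_form_index[OF B v] lessThan_iff)
  finally show ?thesis .
qed

text \<open>
  Evaluate the two forms at the vectors dual to the columns of a matrix \<open>S\<close> that diagonalizes both:
  this compares their diagonal entries.
\<close>

lemma loewner_antisym:
  assumes X: "pd n X" and Y: "pd n Y" and XY: "loewner n X Y" and YX: "loewner n Y X"
  shows "X = Y"
proof -
  obtain S T d where S: "S \<in> carrier_mat n n" and T: "T \<in> carrier_mat n n" and ST: "S * T = 1\<^sub>m n"
    and "\<And>i. i < n \<Longrightarrow> 0 < d i" and Xe: "X = congr_diag n S (\<lambda>_. 1)" and Ye: "Y = congr_diag n S d"
    by (rule simultaneous_diagonalization[OF X Y]) blast
  have TS: "T * S = 1\<^sub>m n" by (rule mat_mult_left_right_inverse[OF S T ST])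
  have "d i = 1" if i: "i < n" for i
  proof -
    (* The vector that the adjoint of S sends to the i-th unit vector. *)
    define v where "v = T\<^sup>\<dagger> *\<^sub>v unit_vec n i"
    have v: "v \<in> carrier_vec n"
      unfolding v_def by (rule mult_mat_vec_carrier[OF adjoint_carrier[OF T] unit_vec_carrier])
    have "S\<^sup>\<dagger> * T\<^sup>\<dagger> = 1\<^sub>m n" using adjoint_mult[OF T S] TS by simp
    then have Sv: "S\<^sup>\<dagger> *\<^sub>v v = unit_vec n i"
      unfolding v_def using assoc_mult_mat_vec[OF adjoint_carrier[OF S] adjoint_carrier[OF T] unit_vec_carrier]
      by (metis one_mult_mat_vec unit_vec_carrier)
    have "quad_form (congr_diag n S f) v = f i" for f
    proof -
      have "quad_form (congr_diag n S f) v = (\<Sum>l<n. if i = l then f i else 0)"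
        unfolding quad_form_congr_diag[OF S v] Sv using i by (intro sum.cong) (auto simp: unit_vec_def)
      then show ?thesis using i by simp
    qed
    then show ?thesis using XY YX v unfolding loewner_def Xe Ye by (metis order_antisym)
  qed
  then show ?thesis unfolding Xe Ye by (intro congr_diag_cong) simp
qed

lemma pd_quad_form_nonneg: "pd n A \<Longrightarrow> v \<in> carrier_vec n \<Longrightarrow> 0 \<le> quad_form A v"
  by (metis pd_obtain_congr_diag quad_form_congr_diag_nonneg unitary_carrier less_imp_le)

lemma pd_smult: "pd n X \<Longrightarrow> 0 < c \<Longrightarrow> pd n (complex_of_real c \<cdot>\<^sub>m X)"
  by (erule pd_obtain_congr_diag) (auto simp: congr_diag_smult[OF unitary_carrier] intro!: pd_congr_diag)

text \<open>
  Two positive definite matrices are at finite Thompson distance: after simultaneous diagonalization any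
  \<open>c\<close> above all diagonal entries works.
\<close>

lemma pd_dominated:
  assumes X: "pd n X" and Y: "pd n Y"
  obtains c where "1 \<le> c" "loewner n X (complex_of_real c \<cdot>\<^sub>m Y)"
proof -
  obtain S T d where S: "S \<in> carrier_mat n n" and "T \<in> carrier_mat n n" "S * T = 1\<^sub>m n"
    and d: "\<And>i. i < n \<Longrightarrow> 0 < d i" and Ye: "Y = congr_diag n S (\<lambda>_. 1)" and Xe: "X = congr_diag n S d"
    by (rule simultaneous_diagonalization[OF Y X]) blast
  (* The sum bounds each d i, and the extra 1 makes c at least 1. *)
  define c where "c = 1 + (\<Sum>i<n. d i)"
  have "d i \<le> c" if "i < n" for i
    unfolding c_def using member_le_sum[of i "{..<n}" d] d that by (force intro: less_imp_le)
  then have "loewner n X (complex_of_real c \<cdot>\<^sub>m Y)"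
    unfolding loewner_def Xe Ye congr_diag_smult[OF S]
    by (auto simp: quad_form_congr_diag[OF S] intro!: sum_mono mult_right_mono)
  moreover have "1 \<le> c" unfolding c_def using sum_nonneg[of "{..<n}" d] d by force
  ultimately show ?thesis by (rule that[rotated])
qed

lemma polarization:
  assumes M: "M \<in> carrier_mat n n" and u: "u \<in> carrier_vec n" and v: "v \<in> carrier_vec n"
  defines "h \<equiv> \<lambda>a. (M *\<^sub>v (u + a \<cdot>\<^sub>v v)) \<bullet>c (u + a \<cdot>\<^sub>v v)"
  shows "(M *\<^sub>v u) \<bullet>c v = (h 1 - h (-1) + \<i> * h \<i> - \<i> * h (-\<i>)) / 4"
proof -
  have Mu: "M *\<^sub>v u \<in> carrier_vec n" and Mv: "M *\<^sub>v v \<in> carrier_vec n"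
    using mult_mat_vec_carrier M u v by auto
  have "h a = (M *\<^sub>v u) \<bullet>c u + cnj a * ((M *\<^sub>v u) \<bullet>c v) + a * ((M *\<^sub>v v) \<bullet>c u)
      + a * cnj a * ((M *\<^sub>v v) \<bullet>c v)" for a
  proof -
    have 1: "M *\<^sub>v (u + a \<cdot>\<^sub>v v) = M *\<^sub>v u + a \<cdot>\<^sub>v (M *\<^sub>v v)"
      using mult_add_distrib_mat_vec[OF M u, of "a \<cdot>\<^sub>v v"] mult_mat_vec[OF M v] v by simp
    have 2: "conjugate (u + a \<cdot>\<^sub>v v) = conjugate u + cnj a \<cdot>\<^sub>v conjugate v"
      using conjugate_add_vec[OF u, of "a \<cdot>\<^sub>v v"] v by (simp add: conjugate_smult_vec)
    show ?thesis unfolding h_def 1 2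
      using u v Mu Mv
      by (simp add: add_scalar_prod_distrib[of _ n] scalar_prod_add_distrib[of _ n] algebra_simps)
  qed
  then show ?thesis by (simp add: algebra_simps)
qed

lemma hermitian_quadratic_real:
  assumes M: "M \<in> carrier_mat n n" "M\<^sup>\<dagger> = M" and v: "v \<in> carrier_vec n"
  shows "(M *\<^sub>v v) \<bullet>c v = complex_of_real (quad_form M v)"
proof -
  have Mv: "M *\<^sub>v v \<in> carrier_vec n" using mult_mat_vec_carrier M v by auto
  have "(M *\<^sub>v v) \<bullet>c v = v \<bullet>c (M *\<^sub>v v)" using cscalar_adjoint[OF M(1) v v] M(2) by simp
  also have "\<dots> = cnj ((M *\<^sub>v v) \<bullet>c v)"
    using conjugate_sprod_vec[OF Mv, of "conjugate v"] v Mv comm_scalar_prod[of v n "conjugate (M *\<^sub>v v)"]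
    by simp
  finally show ?thesis unfolding quad_form_def by (metis Reals_cnj_iff of_real_Re)
qed

text \<open>
  By polarization the entries of a Hermitian matrix are linear combinations of values of its quadratic
  form, so convergence of the forms passes to the matrices.
\<close>

lemma convergent_entries:
  assumes X: "\<And>N. X N \<in> carrier_mat n n" "\<And>N. (X N)\<^sup>\<dagger> = X N"
    and conv: "\<And>v. v \<in> carrier_vec n \<Longrightarrow> convergent (\<lambda>N. quad_form (X N) v)"
    and i: "i < n" and l: "l < n"
  shows "convergent (\<lambda>N. X N $$ (i, l))"
proof -
  define u where "u a = unit_vec n l + a \<cdot>\<^sub>v unit_vec n i" for a :: complex
  have u: "u a \<in> carrier_vec n" for a by (simp add: u_def)
  have ent: "X N $$ (i, l) = (complex_of_real (quad_form (X N) (u 1)) - complex_of_real (quad_form (X N) (u (-1)))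
      + \<i> * complex_of_real (quad_form (X N) (u \<i>)) - \<i> * complex_of_real (quad_form (X N) (u (-\<i>)))) / 4" for N
  proof -
    have "X N *\<^sub>v unit_vec n l \<in> carrier_vec n" by (rule mult_mat_vec_carrier[OF X(1) unit_vec_carrier])
    moreover have "conjugate (unit_vec n i) = (unit_vec n i :: complex vec)"
      by (rule eq_vecI) (auto simp: unit_vec_def)
    ultimately have "(X N *\<^sub>v unit_vec n l) \<bullet>c unit_vec n i = (X N *\<^sub>v unit_vec n l) $ i"
      using i by (simp add: scalar_prod_right_unit)
    also have "\<dots> = X N $$ (i, l)"
      using X(1)[of N] i l by (simp add: scalar_prod_right_unit[of l n "row (X N) i"])
    finally show ?thesis
      using polarization[OF X(1) unit_vec_carrier unit_vec_carrier, of N l i]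
      unfolding u_def[symmetric] hermitian_quadratic_real[OF X u] by simp
  qed
  have c: "convergent (\<lambda>N. complex_of_real (quad_form (X N) (u a)))" for a
  proof -
    obtain L where "(\<lambda>N. quad_form (X N) (u a)) \<longlonglongrightarrow> L" using conv[OF u] by (auto simp: convergent_def)
    then show ?thesis by (rule convergentI[OF tendsto_of_real])
  qed
  show ?thesis unfolding ent divide_inverse
    by (intro convergent_mult convergent_diff convergent_add convergent_const c)
qed


lemma hermitian_limit:
  assumes X: "\<And>N. X N \<in> carrier_mat n n" "\<And>N. (X N)\<^sup>\<dagger> = X N"
    and conv: "\<And>v. v \<in> carrier_vec n \<Longrightarrow> convergent (\<lambda>N. quad_form (X N) v)"
  shows "\<exists>Y. Y \<in> carrier_mat n n \<and> Y\<^sup>\<dagger> = Y \<and> (\<forall>v\<in>carrier_vec n. (\<lambda>N. quad_form (X N) v) \<longlonglongrightarrow> quad_form Y v)"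
proof -
  define Y where "Y = Matrix.mat n n (\<lambda>(i, l). lim (\<lambda>N. X N $$ (i, l)))"
  have Y: "Y \<in> carrier_mat n n" by (simp add: Y_def)
  have ent: "(\<lambda>N. X N $$ (i, l)) \<longlonglongrightarrow> Y $$ (i, l)" if "i < n" "l < n" for i l
    using convergent_entries[OF X conv that] that by (simp add: Y_def convergent_LIMSEQ_iff)
  have "Y\<^sup>\<dagger> = Y"
  proof (rule eq_matI)
    fix i l assume "i < dim_row Y" "l < dim_col Y"
    then have il: "i < n" "l < n" using Y by auto
    have "cnj (X N $$ (l, i)) = X N $$ (i, l)" for N
      using adjoint_index[of i "X N" l] X[of N] il by auto
    then have "(\<lambda>N. X N $$ (i, l)) \<longlonglongrightarrow> cnj (Y $$ (l, i))"
      using tendsto_cnj[OF ent[OF il(2,1)]] by simp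
    then have "cnj (Y $$ (l, i)) = Y $$ (i, l)"
      using ent[OF il] LIMSEQ_unique by blast
    then show "Y\<^sup>\<dagger> $$ (i, l) = Y $$ (i, l)" using il Y by simp
  qed (use Y in auto)
  moreover have "(\<lambda>N. quad_form (X N) v) \<longlonglongrightarrow> quad_form Y v" if v: "v \<in> carrier_vec n" for v
    unfolding quad_form_index[OF X(1) v] quad_form_index[OF Y v]
    by (intro tendsto_Re tendsto_sum tendsto_mult tendsto_const ent) auto
  ultimately show ?thesis using Y by blast
qed

section \<open>Existence and uniqueness of the power mean of positive order\<close>

locale power_mean_equation =
  fixes n m :: nat and t :: real and w :: "nat \<Rightarrow> real" and B :: "nat \<Rightarrow> complex mat"
  assumes m_pos: "1 \<le> m" and w_pos: "\<And>j. j < m \<Longrightarrow> 0 < w j" and w_sum: "(\<Sum>j<m. w j) = 1"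
    and B_pd: "\<And>j. j < m \<Longrightarrow> pd n (B j)" and t: "0 < t" "t \<le> 1"
begin

definition mean_map :: "complex mat \<Rightarrow> complex mat" where
  "mean_map X = weighted_sum_mat n m w (\<lambda>j. geometric_mean t X (B j))"

lemma mean_map_carrier: "mean_map X \<in> carrier_mat n n"
  by (simp add: mean_map_def)

lemma quad_form_mean_map: "pd n X \<Longrightarrow> v \<in> carrier_vec n \<Longrightarrow> quad_form (mean_map X) v = (\<Sum>j<m. w j * quad_form (geometric_mean t X (B j)) v)"
  unfolding mean_map_def by (rule quad_form_weighted_sum) (auto intro: pd_carrier pd_geometric_mean B_pd)

lemma pd_mean_map: assumes X: "pd n X" shows "pd n (mean_map X)"
proof (rule pdI_quad_form[OF mean_map_carrier])
  have h: "cnj (geometric_mean t X (B j) $$ (l, i)) = geometric_mean t X (B j) $$ (i, l)"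
    if "j < m" "i < n" "l < n" for i j l
  proof -
    have "pd n (geometric_mean t X (B j))" by (rule pd_geometric_mean[OF X B_pd[OF that(1)]])
    from pd_carrier[OF this] pd_adjoint[OF this] show ?thesis
      using adjoint_index[of i "geometric_mean t X (B j)" l] that by auto
  qed
  show "(mean_map X)\<^sup>\<dagger> = mean_map X"
    by (rule eq_matI) (auto simp: mean_map_def weighted_sum_mat_def h intro!: sum.cong)
  fix v :: "complex vec" assume v: "v \<in> carrier_vec n" "v \<noteq> 0\<^sub>v n"
  show "0 < quad_form (mean_map X) v" unfolding quad_form_mean_map[OF X v(1)]
    by (intro sum_pos mult_pos_pos) (use m_pos w_pos pd_quad_form_pos[OF pd_geometric_mean[OF X B_pd] v] in \<open>auto simp: Suc_le_eq\<close>)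
qed

lemma mean_map_mono:
  assumes X: "pd n X" and Y: "pd n Y" and le: "loewner n X Y"
  shows "loewner n (mean_map X) (mean_map Y)"
  unfolding loewner_def
proof
  fix v :: "complex vec" assume v: "v \<in> carrier_vec n"
  show "quad_form (mean_map X) v \<le> quad_form (mean_map Y) v" unfolding quad_form_mean_map[OF X v] quad_form_mean_map[OF Y v]
  proof (rule sum_mono)
    fix j assume "j \<in> {..<m}"
    then have j: "j < m" by simp
    have "loewner n (geometric_mean t X (B j)) (geometric_mean t Y (B j))"
      by (rule geometric_mean_mono_left[OF B_pd[OF j] X Y le]) (use t in auto)
    then show "w j * quad_form (geometric_mean t X (B j)) v \<le> w j * quad_form (geometric_mean t Y (B j)) v"
      using v w_pos[OF j] by (simp add: loewner_def)
  qed
qed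

text \<open>
  For the Thompson metric, the infimum of the numbers \<open>ln c\<close> such that \<open>X \<le> c Y\<close> and
  \<open>Y \<le> c X\<close>, this says that the map is a contraction with constant \<open>1 - t\<close>: it is monotone,
  and homogeneous of degree \<open>1 - t\<close>.
\<close>

lemma mean_map_contraction:
  assumes X: "pd n X" and Y: "pd n Y" and c: "0 < c"
    and le: "\<And>v. v \<in> carrier_vec n \<Longrightarrow> quad_form X v \<le> c * quad_form Y v" and v: "v \<in> carrier_vec n"
  shows "quad_form (mean_map X) v \<le> c powr (1 - t) * quad_form (mean_map Y) v"
proof -
  let ?cY = "complex_of_real c \<cdot>\<^sub>m Y"
  have cY: "pd n ?cY" by (rule pd_smult[OF Y c])
  have "loewner n X ?cY" using le quad_form_smult[OF pd_carrier[OF Y]] by (simp add: loewner_def)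
  then have "quad_form (mean_map X) v \<le> quad_form (mean_map ?cY) v" using mean_map_mono[OF X cY] v by (simp add: loewner_def)
  also have "\<dots> = (\<Sum>j<m. w j * (c powr (1 - t) * quad_form (geometric_mean t Y (B j)) v))"
    unfolding quad_form_mean_map[OF cY v]
    by (intro sum.cong refl)
       (simp add: geometric_mean_smult_left[OF Y B_pd c] quad_form_smult[OF pd_carrier[OF pd_geometric_mean[OF Y B_pd]] v])
  also have "\<dots> = c powr (1 - t) * quad_form (mean_map Y) v"
    unfolding quad_form_mean_map[OF Y v] sum_distrib_left by (simp add: mult.left_commute)
  finally show ?thesis .
qed

lemma powr_contraction_tendsto: "(\<lambda>N. c powr (k * (1 - t) ^ N)) \<longlonglongrightarrow> 1" if "0 < c" for c k :: real
proof -
  have "(\<lambda>N. (1 - t) ^ N) \<longlonglongrightarrow> 0" using t by (intro LIMSEQ_power_zero) auto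
  then have "(\<lambda>N. c powr (k * (1 - t) ^ N)) \<longlonglongrightarrow> c powr (k * 0)"
    using that by (intro tendsto_powr tendsto_mult tendsto_const) auto
  then show ?thesis using that by simp
qed

text \<open>
  Iterating the contraction improves \<open>X \<le> c Y\<close> to \<open>X \<le> c^((1-t)^N) Y\<close> for every
  \<open>N\<close>; let \<open>N\<close> tend to infinity. Exchanging the roles gives uniqueness.
\<close>

lemma fixed_point_le:
  assumes X: "pd n X" "mean_map X = X" and Y: "pd n Y" "mean_map Y = Y"
  shows "loewner n X Y"
proof -
  obtain c where c: "1 \<le> c" "loewner n X (complex_of_real c \<cdot>\<^sub>m Y)"
    using pd_dominated[OF X(1) Y(1)] by blast
  have "\<forall>v\<in>carrier_vec n. quad_form X v \<le> c powr (1 * (1 - t) ^ N) * quad_form Y v" for N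
  proof (induction N)
    case 0
    then show ?case using c quad_form_smult[OF pd_carrier[OF Y(1)]] by (simp add: loewner_def)
  next
    case (Suc N)
    have "(c powr (1 * (1 - t) ^ N)) powr (1 - t) = c powr (1 * (1 - t) ^ Suc N)"
      by (simp add: powr_powr mult.commute)
    then show ?case
      using mean_map_contraction[OF X(1) Y(1), of "c powr (1 * (1 - t) ^ N)"] Suc c(1) unfolding X(2) Y(2) by simp
  qed
  then have le: "\<forall>N\<ge>0. quad_form X v \<le> c powr (1 * (1 - t) ^ N) * quad_form Y v" if "v \<in> carrier_vec n" for v
    using that by blast
  have lim: "(\<lambda>N. c powr (1 * (1 - t) ^ N) * quad_form Y v) \<longlonglongrightarrow> 1 * quad_form Y v" for v
    using c(1) by (intro tendsto_mult powr_contraction_tendsto tendsto_const) auto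
  show ?thesis unfolding loewner_def
    using LIMSEQ_le_const[OF lim] le by fastforce
qed

text \<open>
  Start the iteration at a multiple \<open>X0\<close> of the identity that lies below all \<open>B j\<close>. Then
  \<open>X0\<close> lies below its image, so the iterates increase, and the contraction property bounds each later
  iterate by \<open>b^((1-t)^N / t)\<close> times the \<open>N\<close>-th one. The limit \<open>Y\<close> therefore satisfies
  \<open>X N \<le> Y \<le> c X N\<close> with factors \<open>c\<close> that tend to 1. Applying the monotone and homogeneous
  map to this sandwich shows that \<open>Y\<close> is a fixed point.
\<close>

lemma fixed_point_exists: "\<exists>X. pd n X \<and> mean_map X = X"
proof -
  have one: "pd n (1\<^sub>m n)" using pd_congr_diag[OF unitary_one, of n "\<lambda>_. 1"] by (simp add: congr_diag_one)
  have "\<forall>j\<in>{..<m}. \<exists>c. 1 \<le> c \<and> loewner n (1\<^sub>m n) (complex_of_real c \<cdot>\<^sub>m B j)"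
    using pd_dominated[OF one B_pd] by (metis lessThan_iff)
  then obtain c where c: "\<And>j. j < m \<Longrightarrow> 1 \<le> c j"
    and cB: "\<And>j. j < m \<Longrightarrow> loewner n (1\<^sub>m n) (complex_of_real (c j) \<cdot>\<^sub>m B j)"
    by (metis bchoice lessThan_iff)
  (* Each c j is at most 1 / a, so a times the identity lies below B j. *)
  define a where "a = 1 / (1 + (\<Sum>j<m. c j))"
  have c0: "0 \<le> (\<Sum>j<m. c j)" using c by (intro sum_nonneg) force
  then have a: "0 < a" by (simp add: a_def)
  define X0 where "X0 = complex_of_real a \<cdot>\<^sub>m 1\<^sub>m n"
  have X0: "pd n X0" unfolding X0_def by (rule pd_smult[OF one a])
  have X0B: "loewner n X0 (B j)" if j: "j < m" for j
    unfolding loewner_def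
  proof
    fix v :: "complex vec" assume v: "v \<in> carrier_vec n"
    have 2: "quad_form (1\<^sub>m n) v \<le> c j * quad_form (B j) v"
      using cB[OF j, unfolded loewner_def, rule_format, OF v]
      unfolding quad_form_smult[OF pd_carrier[OF B_pd[OF j]] v] .
    have B0: "0 \<le> quad_form (B j) v" by (rule pd_quad_form_nonneg[OF B_pd[OF j] v])
    have "c j \<le> (\<Sum>j<m. c j)" using member_le_sum[of j "{..<m}" c] j c by force
    then have "a * c j \<le> 1" using c0 c[OF j] by (simp add: a_def field_simps)
    then have "a * c j * quad_form (B j) v \<le> 1 * quad_form (B j) v" using B0 by (rule mult_right_mono)
    moreover have "a * quad_form (1\<^sub>m n) v \<le> a * (c j * quad_form (B j) v)" using 2 a by simp
    ultimately show "quad_form X0 v \<le> quad_form (B j) v"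
      unfolding X0_def quad_form_smult[OF one_carrier_mat v] by (simp add: mult.assoc)
  qed
  have X0F: "loewner n X0 (mean_map X0)" unfolding loewner_def
  proof
    fix v :: "complex vec" assume v: "v \<in> carrier_vec n"
    have "geometric_mean t X0 X0 = X0"
    proof -
      have "X0 = congr_diag n (1\<^sub>m n) (\<lambda>_. a * 1)"
        unfolding congr_diag_smult[OF one_carrier_mat, symmetric] X0_def by (simp add: congr_diag_one)
      then show ?thesis
        using geometric_mean_congr_diag[of "1\<^sub>m n" n "1\<^sub>m n" "\<lambda>_. a" "\<lambda>_. a" t] a by (simp flip: powr_add)
    qed
    moreover have "loewner n (geometric_mean t X0 X0) (geometric_mean t X0 (B j))" if "j < m" for j
      by (rule geometric_mean_mono_right_general[OF X0 X0 B_pd[OF that] X0B[OF that]])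
         (use loewner_heinz t in auto)
    ultimately have le: "quad_form X0 v \<le> quad_form (geometric_mean t X0 (B j)) v" if "j < m" for j
      using that v by (simp add: loewner_def)
    have "quad_form X0 v = (\<Sum>j<m. w j * quad_form X0 v)" using w_sum by (simp flip: sum_distrib_right)
    also have "\<dots> \<le> quad_form (mean_map X0) v" unfolding quad_form_mean_map[OF X0 v]
      using le w_pos by (intro sum_mono mult_left_mono) (auto intro: less_imp_le)
    finally show "quad_form X0 v \<le> quad_form (mean_map X0) v" .
  qed
  define X where "X N = (mean_map ^^ N) X0" for N
  have XS: "X (Suc N) = mean_map (X N)" for N by (simp add: X_def)
  have pX: "pd n (X N)" for N by (induction N) (auto simp: X_def X0 intro: pd_mean_map)
  have inc: "quad_form (X N) v \<le> quad_form (X (Suc N)) v" if v: "v \<in> carrier_vec n" for N v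
  proof -
    have "loewner n (X N) (X (Suc N))"
    proof (induction N)
      case 0 then show ?case using X0F by (simp add: X_def)
    next
      case (Suc N) then show ?case using mean_map_mono[OF pX pX Suc] by (simp add: XS)
    qed
    then show ?thesis using v by (simp add: loewner_def)
  qed
  obtain b where b: "1 \<le> b" "loewner n (mean_map X0) (complex_of_real b \<cdot>\<^sub>m X0)"
    using pd_dominated[OF pd_mean_map[OF X0] X0] by blast
  have step: "\<forall>v\<in>carrier_vec n. quad_form (X (Suc N)) v \<le> b powr ((1 - t) ^ N) * quad_form (X N) v" for N
  proof (induction N)
    case 0
    then show ?case using b quad_form_smult[OF pd_carrier[OF X0]] by (simp add: loewner_def X_def)
  next
    case (Suc N)
    have "(b powr ((1 - t) ^ N)) powr (1 - t) = b powr ((1 - t) ^ Suc N)"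
      by (simp add: powr_powr mult.commute)
    then show ?case
      using mean_map_contraction[OF pX pX, of "b powr ((1 - t) ^ N)" "Suc N" N] Suc b(1) unfolding XS by simp
  qed
  (* The exponent is the geometric sum of (1 - t)^M over N <= M < N + K. *)
  have far: "quad_form (X (N + K)) v \<le> b powr (((1 - t) ^ N - (1 - t) ^ (N + K)) / t) * quad_form (X N) v"
    if v: "v \<in> carrier_vec n" for N K v
  proof (induction K)
    case 0 then show ?case using b by simp
  next
    case (Suc K)
    have "quad_form (X (N + Suc K)) v \<le> b powr ((1 - t) ^ (N + K)) * quad_form (X (N + K)) v"
      using step[of "N + K"] v by simp
    also have "\<dots> \<le> b powr ((1 - t) ^ (N + K)) * (b powr (((1 - t) ^ N - (1 - t) ^ (N + K)) / t) * quad_form (X N) v)"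
      by (rule mult_left_mono[OF Suc]) simp
    also have "\<dots> = b powr ((1 - t) ^ (N + K) + ((1 - t) ^ N - (1 - t) ^ (N + K)) / t) * quad_form (X N) v"
      by (simp add: powr_add)
    also have "(1 - t) ^ (N + K) + ((1 - t) ^ N - (1 - t) ^ (N + K)) / t
        = ((1 - t) ^ N - (1 - t) ^ (N + Suc K)) / t"
      using t by (simp add: field_simps)
    finally show ?case .
  qed
  have far': "quad_form (X (N + K)) v \<le> b powr (1 / t * (1 - t) ^ N) * quad_form (X N) v"
    if v: "v \<in> carrier_vec n" for N K v
  proof (rule order_trans[OF far[OF v]], rule mult_right_mono[OF _ pd_quad_form_nonneg[OF pX v]])
    have "((1 - t) ^ N - (1 - t) ^ (N + K)) / t \<le> 1 / t * (1 - t) ^ N"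
      using t by (simp add: field_simps)
    then show "b powr (((1 - t) ^ N - (1 - t) ^ (N + K)) / t) \<le> b powr (1 / t * (1 - t) ^ N)"
      using b(1) by (rule powr_mono)
  qed
  have "convergent (\<lambda>N. quad_form (X N) v)" if v: "v \<in> carrier_vec n" for v
  proof -
    have "incseq (\<lambda>N. quad_form (X N) v)" using inc[OF v] by (rule incseq_SucI)
    moreover have "quad_form (X N) v \<le> b powr (1 / t * (1 - t) ^ 0) * quad_form (X 0) v" for N
      using far'[OF v, of 0 N] by simp
    ultimately show ?thesis using incseq_convergent convergent_def by metis
  qed
  then obtain Y where Y: "Y \<in> carrier_mat n n" "Y\<^sup>\<dagger> = Y"
    and lim: "\<And>v. v \<in> carrier_vec n \<Longrightarrow> (\<lambda>N. quad_form (X N) v) \<longlonglongrightarrow> quad_form Y v"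
    using hermitian_limit[of X n] pX pd_carrier pd_adjoint by metis
  have XY: "quad_form (X N) v \<le> quad_form Y v" if v: "v \<in> carrier_vec n" for N v
    using incseq_le[OF incseq_SucI lim[OF v]] inc[OF v] by blast
  have YX: "quad_form Y v \<le> b powr (1 / t * (1 - t) ^ N) * quad_form (X N) v" if v: "v \<in> carrier_vec n" for N v
  proof (rule LIMSEQ_le_const2[OF lim[OF v]])
    show "\<exists>N0. \<forall>M\<ge>N0. quad_form (X M) v \<le> b powr (1 / t * (1 - t) ^ N) * quad_form (X N) v"
      using far'[OF v, of N] by (metis le_add_diff_inverse)
  qed
  have pY: "pd n Y"
  proof (rule pdI_quad_form[OF Y])
    fix v :: "complex vec" assume "v \<in> carrier_vec n" "v \<noteq> 0\<^sub>v n"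
    then show "0 < quad_form Y v" using pd_quad_form_pos[OF pX[of 0]] XY[of v 0] by (meson less_le_trans)
  qed
  have FY1: "loewner n Y (mean_map Y)" unfolding loewner_def
  proof
    fix v :: "complex vec" assume v: "v \<in> carrier_vec n"
    have "loewner n (mean_map (X N)) (mean_map Y)" for N
      by (rule mean_map_mono[OF pX pY]) (simp add: loewner_def XY)
    then have "quad_form (X (Suc N)) v \<le> quad_form (mean_map Y) v" for N using v by (simp add: loewner_def XS)
    then show "quad_form Y v \<le> quad_form (mean_map Y) v"
      by (intro LIMSEQ_le_const2[OF LIMSEQ_Suc[OF lim[OF v]]]) blast
  qed
  have FY2: "loewner n (mean_map Y) Y" unfolding loewner_def
  proof
    fix v :: "complex vec" assume v: "v \<in> carrier_vec n"
    have le: "quad_form (mean_map Y) v \<le> b powr (((1 - t) / t) * (1 - t) ^ N) * quad_form (X (Suc N)) v" for N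
    proof -
      have "(b powr (1 / t * (1 - t) ^ N)) powr (1 - t) = b powr (((1 - t) / t) * (1 - t) ^ N)"
        by (simp add: powr_powr mult_ac)
      then show ?thesis
        using mean_map_contraction[OF pY pX[of N], of "b powr (1 / t * (1 - t) ^ N)" v] YX b(1) v
        by (simp add: XS)
    qed
    have "(\<lambda>N. b powr (((1 - t) / t) * (1 - t) ^ N) * quad_form (X (Suc N)) v) \<longlonglongrightarrow> 1 * quad_form Y v"
      using b(1) by (intro tendsto_mult powr_contraction_tendsto LIMSEQ_Suc[OF lim[OF v]]) auto
    from LIMSEQ_le_const[OF this, of "quad_form (mean_map Y) v"] show "quad_form (mean_map Y) v \<le> quad_form Y v"
      using le by simp
  qed
  show ?thesis using loewner_antisym[OF pd_mean_map[OF pY] pY FY2 FY1] pY by blast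
qed

text \<open>
  Existence and uniqueness turn the definite description into the solution of the equation.
\<close>

theorem power_mean_pos_solves:
  defines "X \<equiv> power_mean_pos n m t w B"
  shows "pd n X" "mean_map X = X"
proof -
  have "\<exists>!X. X \<in> carrier_mat n n \<and> positive_definite X
      \<and> X = weighted_sum_mat n m w (\<lambda>j. geometric_mean t X (B j))"
    using fixed_point_exists fixed_point_le loewner_antisym
    unfolding pd_def[symmetric] conj_assoc[symmetric] mean_map_def[symmetric]
    by (metis pd_def)
  from theI'[OF this] show "pd n X" "mean_map X = X"
    unfolding X_def power_mean_pos_def pd_def mean_map_def by auto
qed

end

section \<open>Comparison of eigenvalues\<close>

text \<open>
  There are \<open>i\<close> equations in the \<open>i + 1\<close> unknowns \<open>c 0, ..., c i\<close>. Padded by a zero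
  row, they form a square system with determinant zero.
\<close>

lemma vanishing_combination:
  fixes N :: "complex mat"
  assumes N: "N \<in> carrier_mat n k" and i: "i < k" and kn: "k \<le> n"
  shows "\<exists>c\<in>carrier_vec k. c \<noteq> 0\<^sub>v k \<and> (\<forall>p<k. i < p \<longrightarrow> c $ p = 0) \<and> (\<forall>q<i. (N *\<^sub>v c) $ q = 0)"
proof -
  define K where "K = Matrix.mat (Suc i) (Suc i) (\<lambda>(q, p). if q < i then N $$ (q, p) else 0)"
  have K: "K \<in> carrier_mat (Suc i) (Suc i)" by (simp add: K_def)
  have "K\<^sup>T *\<^sub>v unit_vec (Suc i) i = 0\<^sub>v (Suc i)"
  proof (rule eq_vecI)
    fix p assume "p < dim_vec (0\<^sub>v (Suc i) :: complex vec)"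
    then have p: "p < Suc i" by simp
    have "row K\<^sup>T p \<in> carrier_vec (Suc i)" using row_carrier[of "K\<^sup>T" p] K by simp
    then show "(K\<^sup>T *\<^sub>v unit_vec (Suc i) i) $ p = 0\<^sub>v (Suc i) $ p"
      using p K by (simp add: scalar_prod_right_unit) (simp add: K_def)
  qed (use K in auto)
  then have "det K\<^sup>T = 0"
    using det_0_iff_vec_prod_zero[of "K\<^sup>T" "Suc i"] K
    by (metis transpose_carrier_mat lessI unit_vec_carrier unit_vec_nonzero)
  then have "det K = 0" using det_transpose[OF K] by simp
  then obtain c where c: "c \<in> carrier_vec (Suc i)" "c \<noteq> 0\<^sub>v (Suc i)" "K *\<^sub>v c = 0\<^sub>v (Suc i)"
    using det_0_iff_vec_prod_zero[OF K] by blast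
  define c' where "c' = vec k (\<lambda>p. if p \<le> i then c $ p else 0)"
  have c': "c' \<in> carrier_vec k" by (simp add: c'_def)
  have "c' \<noteq> 0\<^sub>v k"
  proof
    assume z: "c' = 0\<^sub>v k"
    have "c $ p = 0" if "p < Suc i" for p
      using arg_cong[OF z, of "\<lambda>v. v $ p"] that i by (simp add: c'_def)
    then have "c = 0\<^sub>v (Suc i)" using c(1) by (intro eq_vecI) auto
    with c(2) show False by simp
  qed
  moreover have "(N *\<^sub>v c') $ q = 0" if q: "q < i" for q
  proof -
    have "(N *\<^sub>v c') $ q = (\<Sum>p<k. N $$ (q, p) * c' $ p)"
      by (rule mult_vec_index[OF N c']) (use q i kn in simp)
    also have "\<dots> = (\<Sum>p<Suc i. N $$ (q, p) * c $ p)"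
      by (rule sum.mono_neutral_cong_right) (use i in \<open>auto simp: c'_def\<close>)
    also have "\<dots> = (K *\<^sub>v c) $ q"
      unfolding mult_vec_index[OF K c(1) less_SucI[OF q]]
      by (rule sum.cong) (use q in \<open>auto simp: K_def\<close>)
    finally show ?thesis using c(3) q by simp
  qed
  moreover have "\<forall>p<k. i < p \<longrightarrow> c' $ p = 0" by (simp add: c'_def)
  ultimately show ?thesis using c' by blast
qed

text \<open>
  The Courant--Fischer principle in the form needed here: for \<open>V\<close> the identity it is Weyl's
  monotonicity theorem, and for an isometry \<open>V\<close> it includes Cauchy interlacing. Some nonzero
  combination \<open>x\<close> of the first \<open>i + 1\<close> eigenvectors of the small matrix is mapped into the span
  of the eigenvectors of the large one with index at least \<open>i\<close>, and at \<open>x\<close> the two forms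
  separate \<open>g i\<close> from \<open>a i\<close>.
\<close>

theorem eigenvalue_comparison:
  assumes U: "unitary_mat k U" and W: "unitary_mat n W"
    and V: "V \<in> carrier_mat n k" and VV: "V\<^sup>\<dagger> * V = 1\<^sub>m k" and kn: "k \<le> n"
    and g: "antimono_below k g" and a: "antimono_below n a"
    and le: "\<And>x. x \<in> carrier_vec k \<Longrightarrow> quad_form (congr_diag k U g) x \<le> quad_form (congr_diag n W a) (V *\<^sub>v x)"
    and i: "i < k"
  shows "g i \<le> a i"
proof -
  have Uc: "U \<in> carrier_mat k k" and Wc: "W \<in> carrier_mat n n" and UU: "U\<^sup>\<dagger> * U = 1\<^sub>m k"
    using U W by (auto simp: unitary_mat_def)
  have VU: "V * U \<in> carrier_mat n k" by (rule mult_carrier_mat[OF V Uc])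
  have N: "W\<^sup>\<dagger> * (V * U) \<in> carrier_mat n k" by (rule mult_carrier_mat[OF adjoint_carrier[OF Wc] VU])
  obtain c where c: "c \<in> carrier_vec k" "c \<noteq> 0\<^sub>v k" and hi: "\<forall>p<k. i < p \<longrightarrow> c $ p = 0"
    and lo: "\<forall>q<i. ((W\<^sup>\<dagger> * (V * U)) *\<^sub>v c) $ q = 0"
    using vanishing_combination[OF N i kn] by blast
  define x where "x = U *\<^sub>v c"
  define y where "y = W\<^sup>\<dagger> *\<^sub>v (V *\<^sub>v x)"
  have x: "x \<in> carrier_vec k" unfolding x_def by (rule mult_mat_vec_carrier[OF Uc c(1)])
  have Vx: "V *\<^sub>v x \<in> carrier_vec n" by (rule mult_mat_vec_carrier[OF V x])
  have y: "y \<in> carrier_vec n" unfolding y_def by (rule mult_mat_vec_carrier[OF adjoint_carrier[OF Wc] Vx])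
  have y0: "y $ q = 0" if "q < i" for q
    using lo that unfolding y_def x_def
    by (simp only: assoc_mult_mat_vec[OF V Uc c(1)] assoc_mult_mat_vec[OF adjoint_carrier[OF Wc] VU c(1)])
  have Ux: "U\<^sup>\<dagger> *\<^sub>v x = c"
    unfolding x_def using assoc_mult_mat_vec[OF adjoint_carrier[OF Uc] Uc c(1)] UU c(1) by simp
  have nx: "norm_sq x = norm_sq c" unfolding x_def by (rule norm_sq_unitary[OF U c(1)])
  have ny: "norm_sq y = norm_sq c"
    unfolding y_def norm_sq_unitary[OF unitary_adjoint[OF W] Vx] norm_sq_isometry[OF V VV x] nx ..
  have "g i * norm_sq c = (\<Sum>p<k. g i * (cmod (c $ p))\<^sup>2)"
    using c(1) by (simp add: norm_sq_def sum_distrib_left)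
  also have "\<dots> \<le> (\<Sum>p<k. g p * (cmod (c $ p))\<^sup>2)"
  proof (rule sum_mono)
    fix p assume "p \<in> {..<k}"
    then show "g i * (cmod (c $ p))\<^sup>2 \<le> g p * (cmod (c $ p))\<^sup>2"
      using hi g i by (cases "p \<le> i") (auto simp: antimono_below_def intro!: mult_right_mono)
  qed
  also have "\<dots> = quad_form (congr_diag k U g) x" unfolding quad_form_congr_diag[OF Uc x] Ux ..
  also have "\<dots> \<le> quad_form (congr_diag n W a) (V *\<^sub>v x)" by (rule le[OF x])
  also have "\<dots> = (\<Sum>q<n. a q * (cmod (y $ q))\<^sup>2)" unfolding quad_form_congr_diag[OF Wc Vx] y_def ..
  also have "\<dots> \<le> (\<Sum>q<n. a i * (cmod (y $ q))\<^sup>2)"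
  proof (rule sum_mono)
    fix q assume "q \<in> {..<n}"
    then show "a q * (cmod (y $ q))\<^sup>2 \<le> a i * (cmod (y $ q))\<^sup>2"
      using y0 a by (cases "q < i") (auto simp: antimono_below_def intro!: mult_right_mono)
  qed
  also have "\<dots> = a i * norm_sq y" using y by (simp add: norm_sq_def sum_distrib_left)
  also have "\<dots> = a i * norm_sq c" by (simp only: ny)
  finally show ?thesis using norm_sq_pos[OF c] by simp
qed

lemma det_real_diag: "det (real_diag n d) = complex_of_real (\<Prod>i<n. d i)"
proof -
  have "upper_triangular (real_diag n d)" by (auto simp: mat_diag_def)
  then have "det (real_diag n d) = prod_list (diag_mat (real_diag n d))"
    by (rule det_upper_triangular[OF _ mat_diag_dim])
  also have "diag_mat (real_diag n d) = map (\<lambda>i. complex_of_real (d i)) [0..<n]"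
    by (auto simp: diag_mat_def mat_diag_def)
  finally show ?thesis by (simp add: prod.distinct_set_conv_list[symmetric] atLeast0LessThan)
qed

lemma det_congr_diag: "unitary_mat n U \<Longrightarrow> det (congr_diag n U d) = complex_of_real (\<Prod>i<n. d i)"
proof -
  assume UU: "unitary_mat n U"
  then have U: "U \<in> carrier_mat n n" and "U * U\<^sup>\<dagger> = 1\<^sub>m n" by (auto simp: unitary_mat_def)
  then have "det U * det (U\<^sup>\<dagger>) = 1" using det_mult[OF U adjoint_carrier[OF U]] by simp
  moreover have "det (congr_diag n U d) = det U * det (real_diag n d) * det (U\<^sup>\<dagger>)"
    unfolding congr_diag_def det_mult[OF square_mult_carrier[OF U mat_diag_dim] adjoint_carrier[OF U]] det_mult[OF U mat_diag_dim] ..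
  ultimately have "det (congr_diag n U d) = det (real_diag n d)" by (simp add: mult_ac)
  then show ?thesis by (simp add: det_real_diag)
qed

section \<open>Log-majorization and traces of powers\<close>

text \<open>
  The heart of the proof, by a truncation argument in the style of Li and Mathias. Let
  \<open>D = diag(p)^(1/2)\<close> and \<open>L = Q diag(l) Q^H\<close>, so that \<open>D L D\<close> lies below the
  compression of a matrix with eigenvalues \<open>\<alpha>\<close>. Replace \<open>L\<close> by the smaller matrix
  \<open>min(L, exp(-c))\<close> and let \<open>g\<close> be the eigenvalues of the resulting \<open>G\<close>. Since \<open>G\<close>
  lies below \<open>D L D\<close> and below \<open>exp(-c) diag(p)\<close>, each \<open>g i\<close> is at most \<open>\<alpha> i\<close> and at
  most \<open>exp(-c) p i\<close>. So every summand on the left is at most \<open>ln (p i) - c - ln (g i)\<close>, and the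
  sum of these numbers is a logarithm of determinants, equal to the right-hand side.
  
  This is a weak majorization of the numbers \<open>ln (p i / \<alpha> i)\<close> by the numbers
  \<open>- ln (l i)\<close>, expressed through all thresholds \<open>c\<close>, which avoids sorting the former.
\<close>

theorem log_threshold_majorization:
  assumes Q: "unitary_mat k Q" and l: "\<And>i. i < k \<Longrightarrow> 0 < l i"
    and p: "\<And>i. i < k \<Longrightarrow> 0 < p i" "antimono_below k p"
    and W: "unitary_mat n W" and \<alpha>: "antimono_below n \<alpha>" "\<And>i. i < n \<Longrightarrow> 0 < \<alpha> i"
    and V: "V \<in> carrier_mat n k" and VV: "V\<^sup>\<dagger> * V = 1\<^sub>m k" and kn: "k \<le> n"
    and le: "\<And>x. x \<in> carrier_vec k \<Longrightarrow>
      quad_form (congr_diag k (real_diag k (\<lambda>i. sqrt (p i)) * Q) l) x \<le> quad_form (congr_diag n W \<alpha>) (V *\<^sub>v x)"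
  shows "(\<Sum>i<k. max 0 (ln (p i / \<alpha> i) - c)) \<le> (\<Sum>i<k. max 0 (- ln (l i) - c))"
proof -
  let ?D = "real_diag k (\<lambda>i. sqrt (p i))"
  (* The eigenvalues of the truncation min(L, exp(-c)). *)
  define \<mu> where "\<mu> i = min (l i) (exp (- c))" for i
  define G where "G = congr_diag k (?D * Q) \<mu>"
  have Qc: "Q \<in> carrier_mat k k" by (rule unitary_carrier[OF Q])
  have DQ: "?D * Q \<in> carrier_mat k k" by (rule square_mult_carrier[OF mat_diag_dim Qc])
  have cong: "congr_diag k (?D * Q) f = ?D * congr_diag k Q f * ?D" for f
    using congr_diag_congruence[OF mat_diag_dim Qc, of "\<lambda>i. complex_of_real (sqrt (p i))" f] by simp
  have \<mu>: "0 < \<mu> i" if "i < k" for i using l[OF that] by (simp add: \<mu>_def)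
  have "pd k G"
  proof -
    have "?D * real_diag k (\<lambda>i. 1 / sqrt (p i)) = real_diag k (\<lambda>i. sqrt (p i) * (1 / sqrt (p i)))"
      by (simp only: mat_diag_diag of_real_mult)
    also have "\<dots> = real_diag k (\<lambda>_. 1)"
      by (rule real_diag_cong) (use p(1) in \<open>auto simp: less_imp_neq[symmetric]\<close>)
    finally have "?D * real_diag k (\<lambda>i. 1 / sqrt (p i)) = 1\<^sub>m k" by simp
    from pd_congruence[OF pd_congr_diag[OF Q \<mu>] mat_diag_dim mat_diag_dim this]
    show ?thesis unfolding G_def cong by simp
  qed
  then obtain R g where R: "unitary_mat k R" and g: "\<And>i. i < k \<Longrightarrow> 0 < g i" and GR: "G = congr_diag k R g"
    and ga: "antimono_below k g"
    by (rule pd_obtain_congr_diag) blast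
  have g\<alpha>: "g i \<le> \<alpha> i" if "i < k" for i
  proof (rule eigenvalue_comparison[OF R W V VV kn ga \<alpha>(1) _ that])
    fix x :: "complex vec" assume x: "x \<in> carrier_vec k"
    have "quad_form G x \<le> quad_form (congr_diag k (?D * Q) l) x"
      unfolding G_def quad_form_congr_diag[OF DQ x] by (intro sum_mono mult_right_mono) (auto simp: \<mu>_def)
    then show "quad_form (congr_diag k R g) x \<le> quad_form (congr_diag n W \<alpha>) (V *\<^sub>v x)" using le[OF x] GR by simp
  qed
  have gp: "g i \<le> exp (- c) * p i" if "i < k" for i
  proof (rule eigenvalue_comparison[OF R unitary_one one_carrier_mat _ order_refl ga _ _ that])
    show "antimono_below k (\<lambda>i. exp (- c) * p i)" using p(2) by (simp add: antimono_below_def)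
    fix x :: "complex vec" assume x: "x \<in> carrier_vec k"
    have "quad_form G x \<le> quad_form (congr_diag k (?D * Q) (\<lambda>_. exp (- c))) x"
      unfolding G_def quad_form_congr_diag[OF DQ x] by (intro sum_mono mult_right_mono) (auto simp: \<mu>_def)
    also have "congr_diag k Q (\<lambda>_. exp (- c)) = real_diag k (\<lambda>_. exp (- c))"
      using congr_diag_smult[OF Qc, of "exp (- c)" "\<lambda>_. 1"] congr_diag_smult[OF one_carrier_mat, of "exp (- c)" k "\<lambda>_. 1"]
        congr_diag_one[OF Q] congr_diag_one[OF unitary_one] congr_diag_id by simp
    then have "congr_diag k (?D * Q) (\<lambda>_. exp (- c)) = real_diag k (\<lambda>i. sqrt (p i) * exp (- c) * sqrt (p i))"
      unfolding cong by simp
    also have "\<dots> = congr_diag k (1\<^sub>m k) (\<lambda>i. exp (- c) * p i)"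
      unfolding congr_diag_id by (rule real_diag_cong) (use p(1) in \<open>simp add: mult_ac less_imp_le flip: power2_eq_square\<close>)
    finally show "quad_form (congr_diag k R g) x \<le> quad_form (congr_diag k (1\<^sub>m k) (\<lambda>i. exp (- c) * p i)) (1\<^sub>m k *\<^sub>v x)"
      using GR x by simp
  qed simp
  have "complex_of_real (\<Prod>i<k. g i) = det G" unfolding GR by (rule det_congr_diag[OF R, symmetric])
  also have "\<dots> = det ?D * det (congr_diag k Q \<mu>) * det ?D"
    unfolding G_def cong det_mult[OF square_mult_carrier[OF mat_diag_dim congr_diag_carrier[OF Qc]] mat_diag_dim]
      det_mult[OF mat_diag_dim congr_diag_carrier[OF Qc]] ..
  also have "\<dots> = complex_of_real ((\<Prod>i<k. sqrt (p i)) * (\<Prod>i<k. \<mu> i) * (\<Prod>i<k. sqrt (p i)))"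
    unfolding det_congr_diag[OF Q] det_real_diag by simp
  also have "(\<Prod>i<k. sqrt (p i)) * (\<Prod>i<k. \<mu> i) * (\<Prod>i<k. sqrt (p i)) = (\<Prod>i<k. p i * \<mu> i)"
    unfolding prod.distrib[symmetric]
    by (rule prod.cong) (use p(1) in \<open>auto simp: mult_ac less_imp_le simp flip: power2_eq_square\<close>)
  finally have "(\<Prod>i<k. g i) = (\<Prod>i<k. p i * \<mu> i)" by (simp only: of_real_eq_iff)
  then have "ln (\<Prod>i<k. g i) = ln (\<Prod>i<k. p i * \<mu> i)" by simp
  moreover have "ln (\<Prod>i<k. g i) = (\<Sum>i<k. ln (g i))"
    by (rule ln_prod[OF finite_lessThan]) (metis g lessThan_iff less_irrefl)
  moreover have "ln (\<Prod>i<k. p i * \<mu> i) = (\<Sum>i<k. ln (p i * \<mu> i))"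
    by (rule ln_prod[OF finite_lessThan]) (metis p(1) \<mu> mult_pos_pos lessThan_iff less_irrefl)
  ultimately have sum_ln: "(\<Sum>i<k. ln (g i)) = (\<Sum>i<k. ln (p i * \<mu> i))" by simp
  have "(\<Sum>i<k. max 0 (ln (p i / \<alpha> i) - c)) \<le> (\<Sum>i<k. ln (p i) - c - ln (g i))"
  proof (rule sum_mono)
    fix i assume "i \<in> {..<k}"
    then have i: "i < k" by simp
    have "ln (g i) \<le> ln (\<alpha> i)" using g\<alpha>[OF i] g[OF i] by simp
    moreover have "ln (g i) \<le> - c + ln (p i)"
      using gp[OF i] g[OF i] p(1)[OF i] by (metis exp_gt_zero ln_exp ln_le_cancel_iff ln_mult_pos mult_pos_pos)
    moreover have "ln (p i / \<alpha> i) = ln (p i) - ln (\<alpha> i)"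
      using p(1)[OF i] \<alpha>(2)[of i] i kn by (simp add: ln_div)
    ultimately show "max 0 (ln (p i / \<alpha> i) - c) \<le> ln (p i) - c - ln (g i)" by simp
  qed
  also have "\<dots> = (\<Sum>i<k. ln (p i) - c - ln (p i * \<mu> i))"
    by (simp add: sum_subtractf sum_ln)
  also have "\<dots> = (\<Sum>i<k. max 0 (- ln (l i) - c))"
  proof (rule sum.cong)
    fix i assume "i \<in> {..<k}"
    then have i: "i < k" by simp
    have "ln (\<mu> i) = min (ln (l i)) (- c)"
      using l[OF i] by (auto simp: \<mu>_def min_def) (metis exp_gt_zero ln_exp ln_le_cancel_iff)+
    then show "ln (p i) - c - ln (p i * \<mu> i) = max 0 (- ln (l i) - c)"
      using p(1)[OF i] \<mu>[OF i] by (simp add: ln_mult_pos)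
  qed simp
  finally show ?thesis .
qed

text \<open>
  Summation by parts. The lower bound \<open>s\<close> of the weights is there for the induction, which uses the
  hypothesis for \<open>s\<close> the last weight.
\<close>

lemma abel_sum_nonneg:
  fixes \<phi> d :: "nat \<Rightarrow> real"
  assumes "\<And>i j. i \<le> j \<Longrightarrow> j < k \<Longrightarrow> \<phi> j \<le> \<phi> i"
    and "\<And>l. l \<le> k \<Longrightarrow> 0 \<le> (\<Sum>i<l. d i)" and "l \<le> k" and "\<And>i. i < l \<Longrightarrow> s \<le> \<phi> i"
  shows "s * (\<Sum>i<l. d i) \<le> (\<Sum>i<l. \<phi> i * d i)"
  using assms(3,4)
proof (induction l arbitrary: s)
  case (Suc l)
  have "\<phi> l * (\<Sum>i<l. d i) \<le> (\<Sum>i<l. \<phi> i * d i)"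
    using Suc.prems assms(1) by (intro Suc.IH) auto
  moreover have "s * (\<Sum>i<Suc l. d i) \<le> \<phi> l * (\<Sum>i<Suc l. d i)"
    by (rule mult_right_mono[OF Suc.prems(2) assms(2)[OF Suc.prems(1)]]) simp
  ultimately show ?case by (simp add: distrib_left)
qed simp

text \<open>
  The Hardy--Littlewood--Polya principle for the increasing convex functions \<open>exp (t x)\<close>. After
  sorting, threshold inequalities give inequalities between partial sums; the tangent inequality for
  the exponential function and summation by parts conclude.
\<close>

lemma sum_exp_le_of_thresholds:
  fixes a b :: "nat \<Rightarrow> real"
  assumes thr: "\<And>c. (\<Sum>i<k. max 0 (a i - c)) \<le> (\<Sum>i<k. max 0 (b i - c))" and t: "0 \<le> t"
  shows "(\<Sum>i<k. exp (t * a i)) \<le> (\<Sum>i<k. exp (t * b i))"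
proof -
  obtain r where r: "bij_betw r {..<k} {..<k}" and ra: "\<And>i j. i \<le> j \<Longrightarrow> j < k \<Longrightarrow> a (r j) \<le> a (r i)"
    using antimono_permutation[of k a] by blast
  obtain s where s: "bij_betw s {..<k} {..<k}" and sb: "\<And>i j. i \<le> j \<Longrightarrow> j < k \<Longrightarrow> b (s j) \<le> b (s i)"
    using antimono_permutation[of k b] by blast
  have re_a: "(\<Sum>i<k. f (a (r i))) = (\<Sum>i<k. f (a i))" for f :: "real \<Rightarrow> real"
    by (rule sum.reindex_bij_betw[OF r, of "\<lambda>i. f (a i)"])
  have re_b: "(\<Sum>i<k. f (b (s i))) = (\<Sum>i<k. f (b i))" for f :: "real \<Rightarrow> real"
    by (rule sum.reindex_bij_betw[OF s, of "\<lambda>i. f (b i)"])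
  have partial: "0 \<le> (\<Sum>i<l. b (s i) - a (r i))" if l: "l \<le> k" for l
  proof (cases l)
    case (Suc l')
    (* At this threshold no summand on the right is truncated before position l, and all later ones vanish. *)
    define c where "c = b (s l')"
    have "(\<Sum>i<l. a (r i) - c) \<le> (\<Sum>i<l. max 0 (a (r i) - c))" by (rule sum_mono) simp
    also have "\<dots> \<le> (\<Sum>i<k. max 0 (a (r i) - c))" using l by (intro sum_mono2) auto
    also have "\<dots> \<le> (\<Sum>i<k. max 0 (b (s i) - c))"
      unfolding re_a[of "\<lambda>x. max 0 (x - c)"] re_b[of "\<lambda>x. max 0 (x - c)"] by (rule thr)
    also have "\<dots> = (\<Sum>i<l. b (s i) - c)"
    proof (rule sum.mono_neutral_cong_right)
      show "\<forall>i\<in>{..<k} - {..<l}. max 0 (b (s i) - c) = 0"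
        using sb[of l'] Suc by (auto simp: c_def intro!: max_absorb1)
      show "max 0 (b (s i) - c) = b (s i) - c" if "i \<in> {..<l}" for i
        using sb[of i l'] that Suc l by (simp add: c_def)
    qed (use l in auto)
    finally show ?thesis by (simp add: sum_subtractf)
  qed simp
  have "0 * (\<Sum>i<k. b (s i) - a (r i)) \<le> (\<Sum>i<k. (t * exp (t * a (r i))) * (b (s i) - a (r i)))"
    by (rule abel_sum_nonneg[where k = k]) (use partial ra t in \<open>auto intro!: mult_left_mono\<close>)
  also have "\<dots> \<le> (\<Sum>i<k. exp (t * b (s i)) - exp (t * a (r i)))"
  proof (rule sum_mono)
    fix i
    have "exp (t * a (r i)) * (1 + t * (b (s i) - a (r i))) \<le> exp (t * a (r i)) * exp (t * (b (s i) - a (r i)))"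
      by (intro mult_left_mono exp_ge_add_one_self) simp
    also have "\<dots> = exp (t * b (s i))" by (simp add: algebra_simps flip: exp_add)
    finally show "(t * exp (t * a (r i))) * (b (s i) - a (r i)) \<le> exp (t * b (s i)) - exp (t * a (r i))"
      by (simp add: algebra_simps)
  qed
  finally show ?thesis
    unfolding sum_subtractf re_a[of "\<lambda>x. exp (t * x)"] re_b[of "\<lambda>x. exp (t * x)"] by simp
qed

text \<open>
  Jensen's inequality for the convex function \<open>x^(-t)\<close> at the points \<open>1 / h p\<close>, from its
  tangent at \<open>L\<close>.
\<close>

lemma jensen_negative_power:
  fixes c h :: "nat \<Rightarrow> real"
  assumes c: "\<And>p. p < n \<Longrightarrow> 0 \<le> c p" "(\<Sum>p<n. c p) = 1" and h: "\<And>p. p < n \<Longrightarrow> 0 < h p"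
    and L: "(\<Sum>p<n. c p / h p) = L" "0 < L" and t: "0 \<le> t"
  shows "L powr (- t) \<le> (\<Sum>p<n. c p * h p powr t)"
proof -
  have "L powr (- t) = L powr (- t) * ((1 + t) * (\<Sum>p<n. c p) - t * ((\<Sum>p<n. c p / h p) / L))"
    unfolding L(1) c(2) using L(2) by simp
  also have "\<dots> = (\<Sum>p<n. c p * (L powr (- t) * (1 - t * (1 / (h p * L) - 1))))"
    unfolding sum_distrib_left sum_divide_distrib sum_subtractf[symmetric]
    by (rule sum.cong) (auto simp: algebra_simps)
  also have "\<dots> \<le> (\<Sum>p<n. c p * h p powr t)"
  proof (intro sum_mono mult_left_mono)
    fix p assume "p \<in> {..<n}"
    then have hp: "0 < h p" and cp: "0 \<le> c p" using h c by auto
    show "0 \<le> c p" by (rule cp)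
    (* By the tangent inequality at 1; the average of u over the weights c p is 1. *)
    define u where "u = 1 / (h p * L)"
    have u: "0 < u" using hp L(2) by (simp add: u_def)
    have "1 - t * (u - 1) \<le> 1 + - t * ln u"
      using mult_left_mono[OF ln_le_minus_one[OF u] t] by simp
    also have "\<dots> \<le> exp (- t * ln u)" by (rule exp_ge_add_one_self)
    also have "\<dots> = u powr (- t)" using u by (simp add: powr_def)
    finally have "L powr (- t) * (1 - t * (u - 1)) \<le> L powr (- t) * u powr (- t)"
      by (rule mult_left_mono) simp
    also have "\<dots> = (L * u) powr (- t)" using L(2) u by (simp add: powr_mult)
    also have "L * u = 1 / h p" using L(2) by (simp add: u_def)
    also have "(1 / h p) powr (- t) = h p powr t" using hp by (simp add: powr_divide powr_minus)
    finally show "L powr (- t) * (1 - t * (1 / (h p * L) - 1)) \<le> h p powr t" by (simp add: u_def)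
  qed
  finally show ?thesis .
qed

lemma congr_diag_diag_entry:
  assumes "Y \<in> carrier_mat k n" "i < k"
  shows "congr_diag n Y f $$ (i, i) = complex_of_real (\<Sum>p<n. (cmod (Y $$ (i, p)))\<^sup>2 * f p)"
  unfolding congr_diag_index[OF assms(1,2,2)] of_real_sum
  by (rule sum.cong) (simp_all add: complex_norm_square[symmetric] mult_ac del: of_real_power
      flip: complex_norm_square)

text \<open>
  With \<open>H = W diag(h) W^H\<close> this is \<open>tr (V^H H^(-1) V)^(-t) \<le> tr (V^H H^t V)\<close>. In an
  eigenbasis of the compression of \<open>H^(-1)\<close> it is Jensen's inequality for each basis vector.
\<close>

lemma peierls_inequality:
  assumes W: "unitary_mat n W" and h: "\<And>p. p < n \<Longrightarrow> 0 < h p"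
    and V: "V \<in> carrier_mat n k" and VV: "V\<^sup>\<dagger> * V = 1\<^sub>m k"
    and Q: "unitary_mat k Q" and l: "\<And>q. q < k \<Longrightarrow> 0 < l q"
    and comp: "V\<^sup>\<dagger> * congr_diag n W (\<lambda>p. 1 / h p) * V = congr_diag k Q l" and t: "0 \<le> t"
  shows "(\<Sum>q<k. l q powr (- t)) \<le> (\<Sum>i<k. Re ((V\<^sup>\<dagger> * congr_diag n W (\<lambda>p. h p powr t) * V) $$ (i, i)))"
proof -
  have Wc: "W \<in> carrier_mat n n" and Qc: "Q \<in> carrier_mat k k" and QQ: "Q\<^sup>\<dagger> * Q = 1\<^sub>m k"
    using W Q by (auto simp: unitary_mat_def)
  note Va = adjoint_carrier[OF V] and Qa = adjoint_carrier[OF Qc]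
  define Y where "Y = V\<^sup>\<dagger> * W"
  have Y: "Y \<in> carrier_mat k n" unfolding Y_def by (rule mult_carrier_mat[OF Va Wc])
  have specY: "V\<^sup>\<dagger> * congr_diag n W f * V = congr_diag n Y f" for f
    using congr_diag_congruence[OF Va Wc, of f] by (simp add: Y_def)
  (* Up to conjugation, the rows of T are the eigenvectors of the compression in the eigenbasis W. *)
  define T where "T = Q\<^sup>\<dagger> * Y"
  have T: "T \<in> carrier_mat k n" unfolding T_def by (rule mult_carrier_mat[OF Qa Y])
  have specT: "congr_diag n T f = Q\<^sup>\<dagger> * congr_diag n Y f * Q" for f
    using congr_diag_congruence[OF Qa Y, of f] by (simp add: T_def)
  have diagT: "congr_diag n T (\<lambda>p. 1 / h p) = real_diag k l"
  proof -
    have "congr_diag n T (\<lambda>p. 1 / h p) = congr_diag k (Q\<^sup>\<dagger> * Q) l"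
      unfolding specT specY[symmetric] comp using congr_diag_congruence[OF Qa Qc, of l] by simp
    then show ?thesis unfolding QQ congr_diag_id .
  qed
  have oneT: "congr_diag n T (\<lambda>_. 1) = 1\<^sub>m k"
  proof -
    have "congr_diag n Y (\<lambda>_. 1) = 1\<^sub>m k"
      unfolding specY[symmetric] congr_diag_one[OF W] right_mult_one_mat[OF Va] by (rule VV)
    then show ?thesis unfolding specT using QQ right_mult_one_mat[OF Qa] by simp
  qed
  (* The trace does not change under the unitary Q. *)
  have col: "(\<Sum>q<k. (cmod (T $$ (q, p)))\<^sup>2) = (\<Sum>i<k. (cmod (Y $$ (i, p)))\<^sup>2)" if p: "p < n" for p
  proof -
    have cY: "col Y p \<in> carrier_vec k" using Y by auto
    have "col T p = Q\<^sup>\<dagger> *\<^sub>v col Y p" unfolding T_def by (rule col_mult2[OF Qa Y p])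
    then have "norm_sq (col T p) = norm_sq (col Y p)" using norm_sq_unitary[OF unitary_adjoint[OF Q] cY] by simp
    then show ?thesis using T Y p by (simp add: norm_sq_def)
  qed
  have "(\<Sum>q<k. l q powr (- t)) \<le> (\<Sum>q<k. \<Sum>p<n. (cmod (T $$ (q, p)))\<^sup>2 * h p powr t)"
  proof (rule sum_mono)
    fix q assume "q \<in> {..<k}"
    then have q: "q < k" by simp
    have "complex_of_real (\<Sum>p<n. (cmod (T $$ (q, p)))\<^sup>2 * 1) = complex_of_real 1"
      unfolding congr_diag_diag_entry[OF T q, symmetric] oneT using q by simp
    then have 1: "(\<Sum>p<n. (cmod (T $$ (q, p)))\<^sup>2) = 1" unfolding of_real_eq_iff by simp
    have "complex_of_real (\<Sum>p<n. (cmod (T $$ (q, p)))\<^sup>2 * (1 / h p)) = complex_of_real (l q)"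
      unfolding congr_diag_diag_entry[OF T q, symmetric] diagT using q by (simp add: mat_diag_def)
    then have 2: "(\<Sum>p<n. (cmod (T $$ (q, p)))\<^sup>2 / h p) = l q" unfolding of_real_eq_iff by simp
    show "l q powr (- t) \<le> (\<Sum>p<n. (cmod (T $$ (q, p)))\<^sup>2 * h p powr t)"
      by (rule jensen_negative_power[OF _ 1 h 2 l[OF q] t]) auto
  qed
  also have "\<dots> = (\<Sum>p<n. (\<Sum>q<k. (cmod (T $$ (q, p)))\<^sup>2) * h p powr t)"
    unfolding sum_distrib_right by (rule sum.swap)
  also have "\<dots> = (\<Sum>p<n. (\<Sum>i<k. (cmod (Y $$ (i, p)))\<^sup>2) * h p powr t)"
    by (rule sum.cong) (auto simp: col)
  also have "\<dots> = (\<Sum>i<k. \<Sum>p<n. (cmod (Y $$ (i, p)))\<^sup>2 * h p powr t)"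
    unfolding sum_distrib_right by (rule sum.swap)
  also have "\<dots> = (\<Sum>i<k. Re ((V\<^sup>\<dagger> * congr_diag n W (\<lambda>p. h p powr t) * V) $$ (i, i)))"
    unfolding specY by (rule sum.cong) (auto simp: congr_diag_diag_entry[OF Y])
  finally show ?thesis .
qed

text \<open>
  Combine \<open>log_threshold_majorization\<close>, \<open>sum_exp_le_of_thresholds\<close> and
  \<open>peierls_inequality\<close> for the compression \<open>L\<close> of \<open>H^(-1)\<close> to the span of the first
  \<open>k\<close> basis vectors, where \<open>H = W diag(h) W^H\<close> and \<open>M = Z diag(\<alpha>) Z^H\<close>. The hypothesis
  says \<open>H^(-1) = P^(-1/2) M P^(-1/2)\<close> with \<open>P = diag(p)\<close>, and the compression commutes with
  the diagonal matrix \<open>P\<close>, so \<open>P^(1/2) L P^(1/2)\<close> is the compression of \<open>M\<close>.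
\<close>

theorem trace_lower_bound:
  assumes W: "unitary_mat n W" and h: "\<And>i. i < n \<Longrightarrow> 0 < h i"
    and Z: "unitary_mat n Z" and \<alpha>: "\<And>i. i < n \<Longrightarrow> 0 < \<alpha> i" "antimono_below n \<alpha>"
    and p: "\<And>i. i < n \<Longrightarrow> 0 < p i" "antimono_below n p"
    and eq: "congr_diag n W (\<lambda>i. 1 / h i)
      = real_diag n (\<lambda>i. 1 / sqrt (p i)) * congr_diag n Z \<alpha> * real_diag n (\<lambda>i. 1 / sqrt (p i))"
    and kn: "k \<le> n" and t: "0 \<le> t"
  shows "(\<Sum>i<k. (p i / \<alpha> i) powr t) \<le> (\<Sum>i<k. Re (congr_diag n W (\<lambda>i. h i powr t) $$ (i, i)))"
proof -
  (* The inclusion of the span of the first k unit vectors. *)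
  define E where "E = Matrix.mat n k (\<lambda>(i, j). if i = j then 1 else (0::complex))"
  have E: "E \<in> carrier_mat n k" by (simp add: E_def)
  note Ea = adjoint_carrier[OF E]
  have compress: "(E\<^sup>\<dagger> * M * E) $$ (i, j) = M $$ (i, j)" if M: "M \<in> carrier_mat n n" and ij: "i < k" "j < k" for M i j
  proof -
    have i': "i < n" and j': "j < n" using ij kn by auto
    have EM: "E\<^sup>\<dagger> * M \<in> carrier_mat k n" by (rule mult_carrier_mat[OF Ea M])
    have "(E\<^sup>\<dagger> * M) $$ (i, l) = M $$ (i, l)" if "l < n" for l
    proof -
      have "(E\<^sup>\<dagger> * M) $$ (i, l) = (\<Sum>s<n. if s = i then M $$ (i, l) else 0)"
        unfolding mult_index[OF Ea M ij(1) that]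
        by (rule sum.cong) (use ij kn in \<open>auto simp: E_def\<close>)
      then show ?thesis using i' by simp
    qed
    then have "(E\<^sup>\<dagger> * M * E) $$ (i, j) = (\<Sum>s<n. if s = j then M $$ (i, j) else 0)"
      unfolding mult_index[OF EM E ij]
      by (intro sum.cong) (use ij kn in \<open>auto simp: E_def\<close>)
    then show ?thesis using j' by simp
  qed
  have EE: "E\<^sup>\<dagger> * E = 1\<^sub>m k"
  proof (rule eq_matI)
    fix i j assume "i < dim_row (1\<^sub>m k :: complex mat)" "j < dim_col (1\<^sub>m k :: complex mat)"
    then show "(E\<^sup>\<dagger> * E) $$ (i, j) = 1\<^sub>m k $$ (i, j)"
      using compress[of "1\<^sub>m n" i j] right_mult_one_mat[OF Ea] kn by simp
  qed (use E in auto)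
  let ?N = "congr_diag n W (\<lambda>i. 1 / h i)"
  have Wc: "W \<in> carrier_mat n n" by (rule unitary_carrier[OF W])
  have N: "?N \<in> carrier_mat n n" by (rule congr_diag_carrier[OF Wc])
  define L where "L = E\<^sup>\<dagger> * ?N * E"
  have qfL: "quad_form L x = quad_form ?N (E *\<^sub>v x)" if "x \<in> carrier_vec k" for x
    using quad_form_congruence[OF Ea N that] by (simp add: L_def)
  have "pd k L"
  proof (rule pdI_quad_form)
    show "L \<in> carrier_mat k k" unfolding L_def by (rule mult_carrier3[OF Ea N E])
    show "L\<^sup>\<dagger> = L" unfolding L_def using congruence_adjoint[OF Ea N congr_diag_adjoint[OF Wc]] by simp
    fix x :: "complex vec" assume x: "x \<in> carrier_vec k" "x \<noteq> 0\<^sub>v k"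
    have "0 < norm_sq (E *\<^sub>v x)" unfolding norm_sq_isometry[OF E EE x(1)] by (rule norm_sq_pos[OF x])
    then have "E *\<^sub>v x \<noteq> 0\<^sub>v n" by (auto simp: norm_sq_def simp del: dim_mult_mat_vec)
    then show "0 < quad_form L x" unfolding qfL[OF x(1)]
      by (intro quad_form_congr_diag_pos[OF W]) (use h mult_mat_vec_carrier[OF E x(1)] in auto)
  qed
  then obtain Q l where Q: "unitary_mat k Q" and l: "\<And>i. i < k \<Longrightarrow> 0 < l i" and LQ: "L = congr_diag k Q l"
    and "antimono_below k l"
    by (rule pd_obtain_congr_diag) blast
  have Qc: "Q \<in> carrier_mat k k" by (rule unitary_carrier[OF Q])
  let ?D = "real_diag k (\<lambda>i. sqrt (p i))" and ?D' = "real_diag n (\<lambda>i. 1 / sqrt (p i))"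
  have le: "quad_form (congr_diag k (?D * Q) l) x \<le> quad_form (congr_diag n Z \<alpha>) (E *\<^sub>v x)" if x: "x \<in> carrier_vec k" for x
  proof -
    have Dx: "?D *\<^sub>v x \<in> carrier_vec k" by (rule mult_mat_vec_carrier[OF mat_diag_dim x])
    have EDx: "E *\<^sub>v (?D *\<^sub>v x) \<in> carrier_vec n" by (rule mult_mat_vec_carrier[OF E Dx])
    have DE: "?D' * (E * ?D) = E"
    proof -
      have ED: "E * ?D \<in> carrier_mat n k" by (rule mult_carrier_mat[OF E mat_diag_dim])
      have ent: "(E * ?D) $$ (i, j) = (if i = j then complex_of_real (sqrt (p i)) else 0)"
        if "i < n" "j < k" for i j
        unfolding mat_diag_mult_right[OF E] using that by (simp add: E_def)
      have "p i \<noteq> 0" if "i < n" for i using p(1)[OF that] by simp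
      moreover have "E $$ (i, j) = (if i = j then 1 else 0)" if "i < n" "j < k" for i j
        using that by (simp add: E_def)
      ultimately show ?thesis unfolding mat_diag_mult_left[OF ED]
        by (intro eq_matI) (use kn carrier_matD[OF E] in \<open>auto simp: ent\<close>)
    qed
    have "quad_form (congr_diag k (?D * Q) l) x = quad_form (?D * L * ?D) x"
      using congr_diag_congruence[OF mat_diag_dim Qc, of "\<lambda>i. complex_of_real (sqrt (p i))" l] LQ by simp
    also have "\<dots> = quad_form L (?D *\<^sub>v x)"
      using quad_form_congruence[OF mat_diag_dim _ x, of L "\<lambda>i. complex_of_real (sqrt (p i))"] LQ congr_diag_carrier[OF Qc] by simp
    also have "\<dots> = quad_form ?N (E *\<^sub>v (?D *\<^sub>v x))" by (rule qfL[OF Dx])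
    also have "\<dots> = quad_form (congr_diag n Z \<alpha>) (?D' *\<^sub>v (E *\<^sub>v (?D *\<^sub>v x)))"
      unfolding eq
      by (rule quad_form_congruence[OF mat_diag_dim congr_diag_carrier[OF unitary_carrier[OF Z]] EDx,
            of "\<lambda>i. complex_of_real (1 / sqrt (p i))", unfolded real_diag_adjoint])
    also have "?D' *\<^sub>v (E *\<^sub>v (?D *\<^sub>v x)) = (?D' * (E * ?D)) *\<^sub>v x"
      by (simp only: assoc_mult_mat_vec[OF E mat_diag_dim x]
          assoc_mult_mat_vec[OF mat_diag_dim mult_carrier_mat[OF E mat_diag_dim] x])
    finally show ?thesis unfolding DE by simp
  qed
  have pk: "antimono_below k p" using p(2) kn by (simp add: antimono_below_def)
  have "(\<Sum>i<k. exp (t * ln (p i / \<alpha> i))) \<le> (\<Sum>i<k. exp (t * (- ln (l i))))"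
    by (rule sum_exp_le_of_thresholds[OF log_threshold_majorization[OF Q l _ pk Z \<alpha>(2,1) E EE kn le] t])
       (use p(1) kn in auto)
  moreover have "exp (t * ln (p i / \<alpha> i)) = (p i / \<alpha> i) powr t" if "i < k" for i
    using p(1)[of i] \<alpha>(1)[of i] that kn by (simp add: powr_def)
  moreover have "exp (t * (- ln (l i))) = l i powr (- t)" if "i < k" for i
    using l[OF that] by (simp add: powr_def)
  ultimately have "(\<Sum>i<k. (p i / \<alpha> i) powr t) \<le> (\<Sum>i<k. l i powr (- t))" by simp
  also have "\<dots> \<le> (\<Sum>i<k. Re ((E\<^sup>\<dagger> * congr_diag n W (\<lambda>p. h p powr t) * E) $$ (i, i)))"
    by (rule peierls_inequality[OF W h E EE Q l _ t]) (use LQ L_def in auto)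
  also have "\<dots> = (\<Sum>i<k. Re (congr_diag n W (\<lambda>i. h i powr t) $$ (i, i)))"
    by (rule sum.cong) (auto simp: compress[OF congr_diag_carrier[OF Wc]])
  finally show ?thesis .
qed

section \<open>The geometric mean in the eigenbasis of its first argument\<close>

lemma quad_form_unit_vec:
  assumes M: "M \<in> carrier_mat n n" and i: "i < n"
  shows "quad_form M (unit_vec n i) = Re (M $$ (i, i))"
proof -
  have "M *\<^sub>v unit_vec n i \<in> carrier_vec n" by (rule mult_mat_vec_carrier[OF M unit_vec_carrier])
  moreover have "conjugate (unit_vec n i) = (unit_vec n i :: complex vec)"
    by (rule eq_vecI) (auto simp: unit_vec_def)
  ultimately have "(M *\<^sub>v unit_vec n i) \<bullet>c unit_vec n i = (M *\<^sub>v unit_vec n i) $ i"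
    using i by (simp add: scalar_prod_right_unit)
  also have "\<dots> = M $$ (i, i)"
    using M i by (simp add: scalar_prod_right_unit[of i n "row M i"])
  finally show ?thesis by (simp add: quad_form_def)
qed

lemma quad_form_scaled_vec:
  assumes "M \<in> carrier_mat n n" "v \<in> carrier_vec n"
  shows "quad_form M (complex_of_real c \<cdot>\<^sub>v v) = c\<^sup>2 * quad_form M v"
proof -
  have "M *\<^sub>v v \<in> carrier_vec n" by (rule mult_mat_vec_carrier[OF assms])
  then have "(M *\<^sub>v (complex_of_real c \<cdot>\<^sub>v v)) \<bullet>c (complex_of_real c \<cdot>\<^sub>v v)
      = complex_of_real (c\<^sup>2) * ((M *\<^sub>v v) \<bullet>c v)"
    using assms(2) by (simp add: mult_mat_vec[OF assms] conjugate_smult_vec power2_eq_square)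
  then show ?thesis unfolding quad_form_def by (simp del: of_real_power)
qed

text \<open>
  Let \<open>X = U diag(1/p) U^H\<close>, \<open>A = Z diag(\<alpha>) Z^H\<close> and
  \<open>H = X^(-1/2) A^(-1) X^(-1/2)\<close>. The mean of \<open>X\<close> and \<open>A^(-1)\<close> is
  \<open>X^(1/2) H^t X^(1/2)\<close>, so \<open>\<tau>\<close> is the diagonal of \<open>H^t\<close> in the eigenbasis of
  \<open>X\<close>, and \<open>H^(-1) = X^(1/2) A X^(1/2)\<close> has in this basis the form required by the trace bound.
\<close>

lemma geometric_mean_diagonal_bound:
  assumes U: "unitary_mat n U" and p: "\<And>i. i < n \<Longrightarrow> 0 < p i" "antimono_below n p"
    and Z: "unitary_mat n Z" and \<alpha>: "\<And>i. i < n \<Longrightarrow> 0 < \<alpha> i" "antimono_below n \<alpha>" and t: "0 \<le> t"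
  obtains \<tau> where
    "\<And>i. i < n \<Longrightarrow> quad_form (geometric_mean t (congr_diag n U (\<lambda>i. 1 / p i)) (inverse_mat (congr_diag n Z \<alpha>))) (col U i) = \<tau> i / p i"
    "\<And>k. k \<le> n \<Longrightarrow> (\<Sum>i<k. (p i / \<alpha> i) powr t) \<le> (\<Sum>i<k. \<tau> i)"
proof -
  let ?X = "congr_diag n U (\<lambda>i. 1 / p i)" and ?A = "congr_diag n Z \<alpha>"
  define B where "B = inverse_mat ?A"
  have Uc: "U \<in> carrier_mat n n" and UU: "U\<^sup>\<dagger> * U = 1\<^sub>m n" and Zc: "Z \<in> carrier_mat n n"
    using U Z by (auto simp: unitary_mat_def)
  note Ua = adjoint_carrier[OF Uc]
  note one = left_mult_one_mat[of _ n n] right_mult_one_mat[of _ n n]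
  have pA: "pd n ?A" by (rule pd_congr_diag[OF Z \<alpha>(1)])
  have pB: "pd n B" unfolding B_def by (rule pd_inverse_mat[OF pA])
  note A = pd_carrier[OF pA] and B = pd_carrier[OF pB]
  have BA: "B * ?A = 1\<^sub>m n"
  proof -
    have "congr_diag n Z (\<lambda>i. 1 / \<alpha> i * \<alpha> i) = congr_diag n Z (\<lambda>_. 1)"
      by (rule congr_diag_cong) (use \<alpha>(1) in \<open>auto simp: less_imp_neq[symmetric]\<close>)
    moreover have "B = congr_diag n Z (\<lambda>i. 1 / \<alpha> i)" unfolding B_def by (rule inverse_mat_congr_diag[OF Z \<alpha>(1)])
    ultimately show ?thesis unfolding congr_diag_one[OF Z] by (simp only: congr_diag_mult[OF Z])
  qed
  define R where "R = pd_power ?X (1/2)"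
  define Q where "Q = pd_power ?X (-1/2)"
  have pX: "pd n ?X" by (rule pd_congr_diag[OF U]) (use p(1) in simp)
  have pR: "pd n R" and pQ: "pd n Q" using pd_pd_power[OF pX] by (auto simp: R_def Q_def)
  note R = pd_carrier[OF pR] and Q = pd_carrier[OF pQ]
  have RQ: "R * Q = 1\<^sub>m n" and QR: "Q * R = 1\<^sub>m n"
    using pd_power_half[OF pX] by (auto simp: R_def Q_def)
  have RU: "R = congr_diag n U (\<lambda>i. 1 / sqrt (p i))"
  proof -
    have "R = congr_diag n U (\<lambda>i. (1 / p i) powr (1/2))"
      unfolding R_def by (rule pd_power_congr_diag[OF U]) (use p(1) in simp)
    also have "\<dots> = congr_diag n U (\<lambda>i. 1 / sqrt (p i))"
      by (rule congr_diag_cong) (use p(1) in \<open>simp add: powr_half_sqrt real_sqrt_divide less_imp_le\<close>)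
    finally show ?thesis .
  qed
  have pH: "pd n (Q * B * Q)" using pd_congruence[OF pB Q R QR] pd_adjoint[OF pQ] by simp
  then obtain W' h where UW': "unitary_mat n W'" and h: "\<And>i. i < n \<Longrightarrow> 0 < h i"
    and H: "Q * B * Q = congr_diag n W' h" and "antimono_below n h"
    by (rule pd_obtain_congr_diag) blast
  have W': "W' \<in> carrier_mat n n" by (rule unitary_carrier[OF UW'])
  define W where "W = U\<^sup>\<dagger> * W'"
  have UW: "unitary_mat n W" unfolding W_def by (rule unitary_mult[OF unitary_adjoint[OF U] UW'])
  have specW: "congr_diag n W f = U\<^sup>\<dagger> * congr_diag n W' f * U" for f
    unfolding W_def using congr_diag_congruence[OF Ua W', of f] by simp
  have Hinv: "congr_diag n W' (\<lambda>i. 1 / h i) = R * ?A * R"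
  proof -
    have "inverse_mat (Q * B * Q) = R * ?A * R"
    proof (rule inverse_mat_eqI[OF pd_carrier[OF pH]])
      have "Q * B * Q * (R * ?A * R) = Q * B * (Q * R) * ?A * R"
        using Q R A B by (simp add: square_mult_assoc[where n = n])
      also have "\<dots> = Q * (B * ?A) * R"
        unfolding QR using Q R A B by (simp add: square_mult_assoc[where n = n] one)
      finally show "Q * B * Q * (R * ?A * R) = 1\<^sub>m n" unfolding BA using Q QR by (simp add: one)
    qed (use R A in simp)
    moreover have "inverse_mat (Q * B * Q) = congr_diag n W' (\<lambda>i. 1 / h i)"
      unfolding H by (rule inverse_mat_congr_diag[OF UW' h])
    ultimately show ?thesis by simp
  qed
  let ?D' = "real_diag n (\<lambda>i. 1 / sqrt (p i))"
  have eq: "congr_diag n W (\<lambda>i. 1 / h i) = ?D' * congr_diag n (U\<^sup>\<dagger> * Z) \<alpha> * ?D'"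
  proof -
    have UR: "U\<^sup>\<dagger> * R = ?D' * U\<^sup>\<dagger>" and RU': "R * U = U * ?D'"
    proof -
      have "U\<^sup>\<dagger> * R = (U\<^sup>\<dagger> * U) * ?D' * U\<^sup>\<dagger>"
        unfolding RU congr_diag_def by (simp only: square_mult_assoc[where n = n] Uc Ua mat_diag_dim square_mult_carrier)
      then show "U\<^sup>\<dagger> * R = ?D' * U\<^sup>\<dagger>" unfolding UU left_mult_one_mat[OF mat_diag_dim] .
      have "R * U = U * ?D' * (U\<^sup>\<dagger> * U)"
        unfolding RU congr_diag_def by (simp only: square_mult_assoc[where n = n] Uc Ua mat_diag_dim square_mult_carrier)
      then show "R * U = U * ?D'" unfolding UU right_mult_one_mat[OF square_mult_carrier[OF Uc mat_diag_dim]] .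
    qed
    have "congr_diag n W (\<lambda>i. 1 / h i) = (U\<^sup>\<dagger> * R) * ?A * (R * U)"
      unfolding specW Hinv by (simp only: square_mult_assoc[where n = n] Uc Ua R A square_mult_carrier)
    also have "\<dots> = ?D' * (U\<^sup>\<dagger> * ?A * U) * ?D'"
      unfolding UR RU' by (simp only: square_mult_assoc[where n = n] Uc Ua A square_mult_carrier mat_diag_dim)
    also have "U\<^sup>\<dagger> * ?A * U = congr_diag n (U\<^sup>\<dagger> * Z) \<alpha>"
      using congr_diag_congruence[OF Ua Zc, of \<alpha>] by simp
    finally show ?thesis .
  qed
  show ?thesis
  proof (rule that[of "\<lambda>i. Re (congr_diag n W (\<lambda>i. h i powr t) $$ (i, i))"])
    show "(\<Sum>i<k. (p i / \<alpha> i) powr t) \<le> (\<Sum>i<k. Re (congr_diag n W (\<lambda>i. h i powr t) $$ (i, i)))"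
      if "k \<le> n" for k
      by (rule trace_lower_bound[OF UW h unitary_mult[OF unitary_adjoint[OF U] Z] \<alpha> p eq that t])
    fix i assume i: "i < n"
    have ci: "col U i \<in> carrier_vec n" using Uc by auto
    let ?K = "congr_diag n W' (\<lambda>i. h i powr t)"
    have K: "?K \<in> carrier_mat n n" by (rule congr_diag_carrier[OF W'])
    have "geometric_mean t ?X B = R * ?K * R"
      unfolding geometric_mean_def R_def[symmetric] Q_def[symmetric] H
      by (simp only: pd_power_congr_diag[OF UW' h])
    then have "quad_form (geometric_mean t ?X B) (col U i) = quad_form ?K (R *\<^sub>v col U i)"
      using quad_form_congruence[OF R K ci] pd_adjoint[OF pR] by simp
    also have "R *\<^sub>v col U i = complex_of_real (1 / sqrt (p i)) \<cdot>\<^sub>v col U i"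
      unfolding RU by (rule congr_diag_mult_col[OF U i])
    also have "quad_form ?K \<dots> = (1 / sqrt (p i))\<^sup>2 * quad_form ?K (col U i)" by (rule quad_form_scaled_vec[OF K ci])
    also have "(1 / sqrt (p i))\<^sup>2 = 1 / p i" using p(1)[OF i] by (simp add: power_divide)
    also have "quad_form ?K (col U i) = quad_form (congr_diag n W (\<lambda>i. h i powr t)) (unit_vec n i)"
    proof -
      have "U *\<^sub>v unit_vec n i = col U i"
        using Uc i carrier_vecI[of "row U _" n] by (intro eq_vecI) auto
      then show ?thesis unfolding specW using quad_form_congruence[OF Ua K unit_vec_carrier, of i] by simp
    qed
    also have "\<dots> = Re (congr_diag n W (\<lambda>i. h i powr t) $$ (i, i))"
      by (rule quad_form_unit_vec[OF congr_diag_carrier[OF unitary_carrier[OF UW]] i])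
    finally show "quad_form (geometric_mean t ?X (inverse_mat ?A)) (col U i)
        = Re (congr_diag n W (\<lambda>i. h i powr t) $$ (i, i)) / p i" by (simp add: B_def)
  qed
qed

section \<open>The power mean of negative order\<close>

lemma rev_sort_antimono:
  assumes "antimono_below n d"
  shows "rev (sort (map d [0..<n])) = map d [0..<n]"
proof -
  have "sorted (rev (map d [0..<n]))"
    using assms by (auto simp: sorted_iff_nth_mono rev_nth antimono_below_def)
  then have "sort (map d [0..<n]) = rev (map d [0..<n])"
    by (intro properties_for_sort) auto
  then show ?thesis by simp
qed

lemma eigval_desc_congr_diag:
  assumes U: "unitary_mat n U" and d: "antimono_below n d" and i: "i < n"
  shows "eigval_desc (congr_diag n U d) i = d i"
proof -
  have Uc: "U \<in> carrier_mat n n" and UU: "U\<^sup>\<dagger> * U = 1\<^sub>m n" "U * U\<^sup>\<dagger> = 1\<^sub>m n"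
    using U by (auto simp: unitary_mat_def)
  have "similar_mat_wit (congr_diag n U d) (real_diag n d) U (U\<^sup>\<dagger>)"
    by (rule similar_mat_witI[of _ _ n]) (use Uc UU in \<open>auto simp: congr_diag_def\<close>)
  then have "char_poly (congr_diag n U d) = char_poly (real_diag n d)"
    by (intro char_poly_similar) (auto simp: similar_mat_def)
  also have "\<dots> = (\<Prod>a\<leftarrow>diag_mat (real_diag n d). [:- a, 1:])"
    by (rule char_poly_upper_triangular[OF mat_diag_dim]) (auto simp: mat_diag_def)
  also have "diag_mat (real_diag n d) = map (\<lambda>i. complex_of_real (d i)) [0..<n]"
    by (auto simp: diag_mat_def mat_diag_def)
  finally have cp: "char_poly (congr_diag n U d) = (\<Prod>a\<leftarrow>map (\<lambda>i. complex_of_real (d i)) [0..<n]. [:- a, 1:])" .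
  have roots: "proots (\<Prod>a\<leftarrow>as. [:- a, 1:]) = mset as" for as :: "complex list"
  proof (induction as)
    case (Cons a as)
    have "(\<Prod>a\<leftarrow>as. [:- a, 1:]) \<noteq> 0" by (auto simp: prod_list_zero_iff)
    then have "proots ([:- a, 1:] * (\<Prod>a\<leftarrow>as. [:- a, 1:])) = proots [:- a, 1:] + proots (\<Prod>a\<leftarrow>as. [:- a, 1:])"
      by (intro proots_mult) auto
    then show ?case using Cons by simp
  qed simp
  have "image_mset Re (proots (char_poly (congr_diag n U d))) = mset (map d [0..<n])"
    unfolding cp roots by (simp add: image_mset.compositionality o_def)
  then have "eigval_desc (congr_diag n U d) i = rev (sort (map d [0..<n])) ! i"
    unfolding eigval_desc_def by (simp only: sorted_list_of_multiset_mset)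
  then show ?thesis unfolding rev_sort_antimono[OF d] using i by simp
qed

lemma prod_le_of_sum_ln_le:
  fixes x y :: "nat \<Rightarrow> real"
  assumes "\<And>i. i < k \<Longrightarrow> 0 < x i" "\<And>i. i < k \<Longrightarrow> 0 < y i" "(\<Sum>i<k. ln (x i)) \<le> (\<Sum>i<k. ln (y i))"
  shows "(\<Prod>i<k. x i) \<le> (\<Prod>i<k. y i)"
proof -
  have "ln (\<Prod>i<k. x i) = (\<Sum>i<k. ln (x i))" "ln (\<Prod>i<k. y i) = (\<Sum>i<k. ln (y i))"
    by (rule ln_prod[OF finite_lessThan]; metis assms(1,2) lessThan_iff less_irrefl)+
  moreover have "0 < (\<Prod>i<k. x i)" "0 < (\<Prod>i<k. y i)" using assms by (auto intro: prod_pos)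
  ultimately show ?thesis using assms(3) by (metis ln_le_cancel_iff)
qed

lemma prod_list_take_upt: "k \<le> n \<Longrightarrow> prod_list (take k (map f [0..<n])) = (\<Prod>i<k. f i :: real)"
  by (simp add: take_map prod.distinct_set_conv_list[symmetric] atLeast0LessThan)

theorem theorem1p2:
  fixes m n :: nat and r :: real
    and w :: "nat \<Rightarrow> real" and A :: "nat \<Rightarrow> complex mat"
  assumes "m \<ge> 1" and "n \<ge> 1"
    and "\<And>j. j < m \<Longrightarrow> 0 < w j"
    and "(\<Sum>j<m. w j) = 1"
    and "\<And>j. j < m \<Longrightarrow> A j \<in> carrier_mat n n"
    and "\<And>j. j < m \<Longrightarrow> positive_definite (A j)"
    and "-1 \<le> r" and "r < 0"
  shows "weakly_log_majorized
    (map (\<lambda>i. eigval_desc (power_mean n m r w A) i) [0..<n])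
    (map (\<lambda>i. scalar_power_mean m r w (\<lambda>j. eigval_desc (A j) i)) [0..<n])"
proof -
  note w_pos = assms(3)
  define t where "t = - r"
  have t: "0 < t" "t \<le> 1" using assms(7,8) by (auto simp: t_def)
  have pA: "pd n (A j)" if "j < m" for j using assms(5,6)[OF that] by (simp add: pd_def)
  interpret power_mean_equation n m t w "\<lambda>j. inverse_mat (A j)"
    by unfold_locales (use assms pA t pd_inverse_mat in auto)
  define X where "X = power_mean_pos n m t w (\<lambda>j. inverse_mat (A j))"
  have pX: "pd n X" and FX: "mean_map X = X" using power_mean_pos_solves by (auto simp: X_def)
  define P where "P = power_mean n m r w A"
  have P: "P = inverse_mat X" using assms(8) by (simp add: P_def power_mean_def X_def t_def)
  have pP: "pd n P" unfolding P by (rule pd_inverse_mat[OF pX])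
  then obtain U p where U: "unitary_mat n U" and p: "\<And>i. i < n \<Longrightarrow> 0 < p i" and PU: "P = congr_diag n U p"
    and pa: "antimono_below n p"
    by (rule pd_obtain_congr_diag) blast
  have XU: "X = congr_diag n U (\<lambda>i. 1 / p i)"
  proof -
    obtain U' x where x: "unitary_mat n U'" "\<And>i. i < n \<Longrightarrow> 0 < x i" "X = congr_diag n U' x" "antimono_below n x"
      using pX by (rule pd_obtain_congr_diag) blast
    have "P = congr_diag n U' (\<lambda>i. 1 / x i)" unfolding P x(3) by (rule inverse_mat_congr_diag[OF x(1,2)])
    then have "inverse_mat P = congr_diag n U' (\<lambda>i. 1 / (1 / x i))"
      by (simp only:, intro inverse_mat_congr_diag[OF x(1)]) (use x(2) in simp)
    moreover have "inverse_mat P = congr_diag n U (\<lambda>i. 1 / p i)" unfolding PU by (rule inverse_mat_congr_diag[OF U p])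
    ultimately show ?thesis unfolding x(3) by simp
  qed
  have "\<forall>j\<in>{..<m}. \<exists>Z \<alpha>. unitary_mat n Z \<and> (\<forall>i<n. 0 < \<alpha> i) \<and> A j = congr_diag n Z \<alpha> \<and> antimono_below n \<alpha>"
    using pA by (metis lessThan_iff pd_obtain_congr_diag)
  then obtain Z \<alpha> where Z: "\<And>j. j < m \<Longrightarrow> unitary_mat n (Z j)"
    and \<alpha>: "\<And>j i. j < m \<Longrightarrow> i < n \<Longrightarrow> 0 < \<alpha> j i" and AZ: "\<And>j. j < m \<Longrightarrow> A j = congr_diag n (Z j) (\<alpha> j)"
    and \<alpha>a: "\<And>j. j < m \<Longrightarrow> antimono_below n (\<alpha> j)"
    by (metis bchoice lessThan_iff)
  have "\<exists>\<tau>. (\<forall>i<n. quad_form (geometric_mean t X (inverse_mat (A j))) (col U i) = \<tau> i / p i)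
      \<and> (\<forall>k\<le>n. (\<Sum>i<k. (p i / \<alpha> j i) powr t) \<le> (\<Sum>i<k. \<tau> i))" if j: "j < m" for j
    unfolding XU AZ[OF j]
    using geometric_mean_diagonal_bound[OF U p pa Z[OF j] \<alpha>[OF j] \<alpha>a[OF j], of t] t(1) by (metis less_imp_le)
  then obtain \<tau> where
    \<tau>: "\<And>j i. j < m \<Longrightarrow> i < n \<Longrightarrow> quad_form (geometric_mean t X (inverse_mat (A j))) (col U i) = \<tau> j i / p i"
    and \<tau>_le: "\<And>j k. j < m \<Longrightarrow> k \<le> n \<Longrightarrow> (\<Sum>i<k. (p i / \<alpha> j i) powr t) \<le> (\<Sum>i<k. \<tau> j i)"
    by metis
  (* The equation for X, evaluated at its eigenvectors. *)
  have \<tau>_sum: "(\<Sum>j<m. w j * \<tau> j i) = 1" if i: "i < n" for i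
  proof -
    have ci: "col U i \<in> carrier_vec n" using unitary_carrier[OF U] by auto
    have "1 / p i = quad_form (mean_map X) (col U i)" unfolding FX unfolding XU quad_form_congr_diag_col[OF U i] ..
    also have "\<dots> = (\<Sum>j<m. w j * (\<tau> j i / p i))"
      unfolding quad_form_mean_map[OF pX ci] by (rule sum.cong) (auto simp: \<tau> i)
    also have "\<dots> = (\<Sum>j<m. w j * \<tau> j i) / p i" by (simp add: sum_divide_distrib)
    finally show ?thesis using p[OF i] by simp
  qed
  define s where "s i = (\<Sum>j<m. w j * \<alpha> j i powr r)" for i
  have s_pos: "0 < s i" if i: "i < n" for i
    unfolding s_def
  proof (rule sum_pos)
    show "0 < w j * \<alpha> j i powr r" if "j \<in> {..<m}" for j
      using w_pos[of j] \<alpha>[of j i] that i by simp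
  qed (use assms(1) in \<open>auto simp: lessThan_empty_iff\<close>)
  define q where "q i = s i powr (1 / r)" for i
  have q_pos: "0 < q i" if "i < n" for i using s_pos[OF that] by (simp add: q_def)
  have qa: "antimono_below n q"
    unfolding antimono_below_def
  proof (intro allI impI)
    fix i l assume il: "i \<le> l" "l < n"
    have "s i \<le> s l" unfolding s_def
    proof (rule sum_mono)
      fix j assume "j \<in> {..<m}"
      then have j: "j < m" by simp
      have "\<alpha> j l \<le> \<alpha> j i" using \<alpha>a[OF j] il by (simp add: antimono_below_def)
      then have "\<alpha> j i powr r \<le> \<alpha> j l powr r"
        using \<alpha>[OF j il(2)] assms(8) by (intro powr_mono2') auto
      then show "w j * \<alpha> j i powr r \<le> w j * \<alpha> j l powr r" using w_pos[OF j] by simp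
    qed
    then show "q l \<le> q i" unfolding q_def
      using s_pos[of i] il assms(8) by (intro powr_mono2') auto
  qed
  have prod_le: "(\<Prod>i<k. p i) \<le> (\<Prod>i<k. q i)" if k: "k \<le> n" for k
  proof (rule prod_le_of_sum_ln_le)
    have "(\<Sum>i<k. p i powr t * s i) = (\<Sum>i<k. \<Sum>j<m. w j * (p i / \<alpha> j i) powr t)"
      unfolding s_def sum_distrib_left
    proof (intro sum.cong refl)
      fix i j assume "i \<in> {..<k}" "j \<in> {..<m}"
      then have "0 < p i" "0 < \<alpha> j i" using p \<alpha> k by auto
      then show "p i powr t * (w j * \<alpha> j i powr r) = w j * (p i / \<alpha> j i) powr t"
        by (simp add: t_def powr_divide powr_minus_divide)
    qed
    also have "\<dots> = (\<Sum>j<m. w j * (\<Sum>i<k. (p i / \<alpha> j i) powr t))"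
      unfolding sum_distrib_left by (rule sum.swap)
    also have "\<dots> \<le> (\<Sum>j<m. w j * (\<Sum>i<k. \<tau> j i))"
    proof (rule sum_mono)
      fix j assume "j \<in> {..<m}"
      then have j: "j < m" by simp
      show "w j * (\<Sum>i<k. (p i / \<alpha> j i) powr t) \<le> w j * (\<Sum>i<k. \<tau> j i)"
        by (rule mult_left_mono[OF \<tau>_le[OF j k] less_imp_le[OF w_pos[OF j]]])
    qed
    also have "\<dots> = (\<Sum>i<k. \<Sum>j<m. w j * \<tau> j i)"
      unfolding sum_distrib_left by (rule sum.swap)
    also have "\<dots> = (\<Sum>i<k. 1)" by (rule sum.cong) (use \<tau>_sum k in auto)
    finally have le: "(\<Sum>i<k. p i powr t * s i - 1) \<le> 0" by (simp add: sum_subtractf)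
    (* The arithmetic-geometric mean inequality, in the form ln y <= y - 1. *)
    have "(\<Sum>i<k. t * (ln (p i) - ln (q i))) \<le> (\<Sum>i<k. p i powr t * s i - 1)"
    proof (rule sum_mono)
      fix i assume "i \<in> {..<k}"
      then have pi: "0 < p i" and si: "0 < s i" using p s_pos k by auto
      have "t * (ln (p i) - ln (q i)) = ln (p i powr t * s i)"
        using pi si assms(8) by (simp add: q_def t_def ln_mult_pos ln_powr algebra_simps)
      also have "\<dots> \<le> p i powr t * s i - 1" by (rule ln_le_minus_one) (use pi si in simp)
      finally show "t * (ln (p i) - ln (q i)) \<le> p i powr t * s i - 1" .
    qed
    with le have "t * ((\<Sum>i<k. ln (p i)) - (\<Sum>i<k. ln (q i))) \<le> 0"
      by (simp add: sum_distrib_left[symmetric] sum_subtractf)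
    then show "(\<Sum>i<k. ln (p i)) \<le> (\<Sum>i<k. ln (q i))" using t(1) by (simp add: mult_le_0_iff)
  qed (use p q_pos k in auto)
  have lhs: "map (\<lambda>i. eigval_desc (power_mean n m r w A) i) [0..<n] = map p [0..<n]"
    unfolding P_def[symmetric] PU by (rule map_cong) (auto simp: eigval_desc_congr_diag[OF U pa])
  have "scalar_power_mean m r w (\<lambda>j. eigval_desc (A j) i) = q i" if i: "i < n" for i
  proof -
    have "(\<Sum>j<m. w j * eigval_desc (A j) i powr r) = s i"
      unfolding s_def by (rule sum.cong) (auto simp: AZ eigval_desc_congr_diag[OF Z \<alpha>a i])
    then show ?thesis by (simp add: scalar_power_mean_def q_def)
  qed
  then have rhs: "map (\<lambda>i. scalar_power_mean m r w (\<lambda>j. eigval_desc (A j) i)) [0..<n] = map q [0..<n]"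
    by simp
  show ?thesis unfolding lhs rhs weakly_log_majorized_def rev_sort_antimono[OF pa] rev_sort_antimono[OF qa]
    using p q_pos prod_le by (auto simp: prod_list_take_upt)
qed

end
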